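(* Let $\mathbf v=\begin{bmatrix}a+b\phi\\c+d\phi\end{bmatrix}\in\Lambda$ with $a,b,c,d$ nonnegative integers. In the direction of $\mathbf v$, the short periodic trajectory on the golden L has holonomy vector $\mathbf v$ and the long periodic trajectory has holonomy vector $\phi\mathbf v$. The combinatorial periods of the corresponding short and long trajectories on the double pentagon (the periodic trajectories in the short and long cylinder, respectively, in direction $P\mathbf v$) are $2(a+b+c+d)$ and $2(a+2b+c+2d)$, respectively.
   Context: Let $\phi=(1+\sqrt5)/2$. The golden L is the translation surface obtained from the polygon $([0,\phi]\times[0,1])\cup([0,1]\times[0,\phi])$ by gluing by translation the sides $\{\phi\}\times[0,1]$ to $\{0\}\times[0,1]$, $\{1\}\times[1,\phi]$ to $\{0\}\times[1,\phi]$, $[1,\phi]\times\{1\}$ to $[1,\phi]\times\{0\}$, and $[0,1]\times\{\phi\}$ to $[0,1]\times\{0\}$. A cylinder is a maximal family of parallel (primitive) periodic trajectories. In each periodic direction (direction of a periodic trajectory) there are exactly two cylinders, a short one and a long one, with length ratio $\phi$. A short (long) trajectory is a periodic trajectory in the short (long) cylinder. $\Lambda$ is the set of holonomy vectors of short cylinders of the golden L lying in $\Sigma=\{(x,y):x>0,y\ge0\}$; every element of $\Lambda$ can be written uniquely as $(a+b\phi,c+d\phi)$ with $a,b,c,d$ nonnegative integers. The double pentagon is the translation surface obtained from a regular pentagon $Q$ with a horizontal side and diagonals of length $1$, and its image $-Q$ under the half-turn, by gluing each side of $Q$ by translation to the parallel side of $-Q$. The linear map $P=\begin{bmatrix}1&\cos(\pi/5)\\0&\sin(\pi/5)\end{bmatrix}$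 takes the golden L to the double pentagon (up to cutting and regluing by translations), taking short (long) cylinders to short (long) cylinders. The combinatorial period of a periodic trajectory on the double pentagon is the number of times it crosses the (glued) pentagon sides in one primitive period. *)

theory Defs
  imports "HOL-Analysis.Analysis"
begin

section \<open>Translation surfaces obtained by gluing polygons\<close>

text \<open>
  A surface is given by a compact region of the plane, a disjoint union of finitely many closed
  polygons, together with side pairings.  A pairing \<open>(a, b, w)\<close> glues the side from \<open>a\<close> to \<open>b\<close> to
  the side from \<open>a + w\<close> to \<open>b + w\<close> by the translation by \<open>w\<close>.  A pair of glued sides is listed
  once.
\<close>

type_synonym plane = "real \<times> real"

record glued_polygons =
  region :: "plane set"
  pairings :: "(plane \<times> plane \<times> plane) set"

definition glue :: "glued_polygons \<Rightarrow> (plane \<times> plane) set" where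
  "glue S = {(p, p + w) | p a b w. (a, b, w) \<in> pairings S \<and> p \<in> closed_segment a b}"

text \<open>A point of the surface is a class for the equivalence relation generated by the gluings.\<close>

definition pt :: "glued_polygons \<Rightarrow> plane \<Rightarrow> plane set" where
  "pt S p = ((glue S \<union> (glue S)\<inverse>)\<^sup>*) `` {p}"

definition surface :: "glued_polygons \<Rightarrow> plane set topology" where
  "surface S = topology (\<lambda>U. U \<subseteq> pt S ` region S \<and>
     openin (top_of_set (region S)) {p \<in> region S. pt S p \<in> U})"

lemma openin_surface:
  "openin (surface S) U \<longleftrightarrow>
     U \<subseteq> pt S ` region S \<and> openin (top_of_set (region S)) {p \<in> region S. pt S p \<in> U}"
proof -
  let ?L = "\<lambda>U. U \<subseteq> pt S ` region S \<and>
     openin (top_of_set (region S)) {p \<in> region S. pt S p \<in> U}"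
  have "?L (U \<inter> V)" if "?L U" "?L V" for U V
  proof -
    have "{p \<in> region S. pt S p \<in> U \<inter> V} =
        {p \<in> region S. pt S p \<in> U} \<inter> {p \<in> region S. pt S p \<in> V}"
      by auto
    then show ?thesis
      using that by (auto intro: openin_Int)
  qed
  moreover have "?L (\<Union>K)" if "\<forall>U\<in>K. ?L U" for K
  proof -
    have "{p \<in> region S. pt S p \<in> \<Union>K} = \<Union>((\<lambda>U. {p \<in> region S. pt S p \<in> U}) ` K)"
      by auto
    moreover have "openin (top_of_set (region S)) (\<Union>((\<lambda>U. {p \<in> region S. pt S p \<in> U}) ` K))"
      using that by (intro openin_Union) auto
    ultimately show ?thesis
      using that by auto
  qed
  ultimately have "istopology ?L"
    unfolding istopology_def by blast
  then show ?thesis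
    by (simp add: surface_def topology_inverse')
qed

definition side_points :: "glued_polygons \<Rightarrow> plane set set" where
  "side_points S = pt S ` (\<Union>(a, b, w)\<in>pairings S. closed_segment a b)"

definition vertex_points :: "glued_polygons \<Rightarrow> plane set set" where
  "vertex_points S = pt S ` (\<Union>(a, b, w)\<in>pairings S. {a, b})"

section \<open>Trajectories and cylinders\<close>

text \<open>
  \<open>trajectory S u \<gamma>\<close>: the curve \<open>\<gamma>\<close> on the surface is a trajectory with constant velocity \<open>u\<close>; an
  oriented trajectory in the direction of \<open>u\<close> has such a parametrization, unique up to a shift of
  time.  Around each time \<open>t\<close> it is straight: it arrives along a segment of the region ending at a
  representative \<open>p\<close> of \<open>\<gamma> t\<close>, and leaves along a segment starting at a representative \<open>q\<close>.  At a
  point where it crosses a side, \<open>q\<close> is the image of \<open>p\<close> under the gluing.  A trajectory does not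
  pass through vertices; on both surfaces below, all vertices are glued to a single cone point, of
  angle \<open>6 \<pi>\<close>.
\<close>

definition trajectory :: "glued_polygons \<Rightarrow> plane \<Rightarrow> (real \<Rightarrow> plane set) \<Rightarrow> bool" where
  "trajectory S u \<gamma> \<longleftrightarrow> u \<noteq> 0 \<and>
     (\<forall>t. \<gamma> t \<notin> vertex_points S \<and>
       (\<exists>p q. \<exists>\<epsilon>>0. \<gamma> t = pt S p \<and> \<gamma> t = pt S q \<and>
         (\<forall>s\<in>{0..\<epsilon>}. p - s *\<^sub>R u \<in> region S \<and> \<gamma> (t - s) = pt S (p - s *\<^sub>R u)) \<and>
         (\<forall>s\<in>{0..\<epsilon>}. q + s *\<^sub>R u \<in> region S \<and> \<gamma> (t + s) = pt S (q + s *\<^sub>R u))))"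

definition periods :: "(real \<Rightarrow> plane set) \<Rightarrow> real set" where
  "periods \<gamma> = {T. T > 0 \<and> (\<forall>t. \<gamma> (t + T) = \<gamma> t)}"

definition primitive_period :: "(real \<Rightarrow> plane set) \<Rightarrow> real" where
  "primitive_period \<gamma> = Inf (periods \<gamma>)"

definition periodic_trajectory :: "glued_polygons \<Rightarrow> plane \<Rightarrow> (real \<Rightarrow> plane set) \<Rightarrow> bool" where
  "periodic_trajectory S u \<gamma> \<longleftrightarrow> trajectory S u \<gamma> \<and> periods \<gamma> \<noteq> {}"

definition holonomy :: "plane \<Rightarrow> (real \<Rightarrow> plane set) \<Rightarrow> plane" where
  "holonomy u \<gamma> = primitive_period \<gamma> *\<^sub>R u"

text \<open>
  A maximal family of parallel periodic trajectories sweeps out a connected component of the set of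
  points lying on periodic trajectories in the given direction.
\<close>

definition cylinders :: "glued_polygons \<Rightarrow> plane \<Rightarrow> plane set set set" where
  "cylinders S u = connected_components_of
     (subtopology (surface S) (\<Union>\<gamma>\<in>{\<gamma>. periodic_trajectory S u \<gamma>}. range \<gamma>))"

text \<open>All trajectories in a cylinder have the same holonomy vector.\<close>

definition cylinder_holonomy :: "glued_polygons \<Rightarrow> plane \<Rightarrow> plane set set \<Rightarrow> plane" where
  "cylinder_holonomy S u C =
     (THE h. \<exists>\<gamma>. periodic_trajectory S u \<gamma> \<and> range \<gamma> \<subseteq> C \<and> holonomy u \<gamma> = h)"

definition cylinder_length :: "glued_polygons \<Rightarrow> plane \<Rightarrow> plane set set \<Rightarrow> real" where
  "cylinder_length S u C = norm (cylinder_holonomy S u C)"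

text \<open>
  On the surfaces below, each periodic direction has exactly two cylinders, of different lengths;
  the short one is the one that has a longer parallel cylinder.
\<close>

definition short_cylinder :: "glued_polygons \<Rightarrow> plane \<Rightarrow> plane set set \<Rightarrow> bool" where
  "short_cylinder S u C \<longleftrightarrow> C \<in> cylinders S u \<and>
     (\<exists>C'\<in>cylinders S u. cylinder_length S u C < cylinder_length S u C')"

definition long_cylinder :: "glued_polygons \<Rightarrow> plane \<Rightarrow> plane set set \<Rightarrow> bool" where
  "long_cylinder S u C \<longleftrightarrow> C \<in> cylinders S u \<and>
     (\<exists>C'\<in>cylinders S u. cylinder_length S u C' < cylinder_length S u C)"

definition short_trajectory :: "glued_polygons \<Rightarrow> plane \<Rightarrow> (real \<Rightarrow> plane set) \<Rightarrow> bool" where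
  "short_trajectory S u \<gamma> \<longleftrightarrow>
     periodic_trajectory S u \<gamma> \<and> (\<exists>C. short_cylinder S u C \<and> range \<gamma> \<subseteq> C)"

definition long_trajectory :: "glued_polygons \<Rightarrow> plane \<Rightarrow> (real \<Rightarrow> plane set) \<Rightarrow> bool" where
  "long_trajectory S u \<gamma> \<longleftrightarrow>
     periodic_trajectory S u \<gamma> \<and> (\<exists>C. long_cylinder S u C \<and> range \<gamma> \<subseteq> C)"

text \<open>
  A periodic trajectory avoids the vertices, hence does not run along a side, so each time at which
  it is on a side is a crossing.
\<close>

definition combinatorial_period :: "glued_polygons \<Rightarrow> (real \<Rightarrow> plane set) \<Rightarrow> nat" where
  "combinatorial_period S \<gamma> = card {t \<in> {0..<primitive_period \<gamma>}. \<gamma> t \<in> side_points S}"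

section \<open>The golden L and the double pentagon\<close>

definition phi :: real where
  "phi = (1 + sqrt 5) / 2"

definition golden_L :: glued_polygons where
  "golden_L =
    \<lparr> region = {0..phi} \<times> {0..1} \<union> {0..1} \<times> {0..phi},
      pairings =
       {((phi, 0), (phi, 1), (- phi, 0)),
        ((1, 1), (1, phi), (- 1, 0)),
        ((1, 1), (phi, 1), (0, - 1)),
        ((0, phi), (1, phi), (0, - phi))} \<rparr>"

definition Lambda_L :: "plane set" where
  "Lambda_L = {h. fst h > 0 \<and> snd h \<ge> 0 \<and>
     (\<exists>u C. short_cylinder golden_L u C \<and> cylinder_holonomy golden_L u C = h)}"

text \<open>
  The circumradius \<open>1 / (2 sin (2 \<pi> / 5))\<close> makes the diagonals have length \<open>1\<close>, and the bottom side
  is horizontal.  The centre is put at \<open>(0, 1)\<close> so that the pentagon lies in the open upper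
  half-plane and is disjoint from its image under the half-turn about the origin.
\<close>

definition pentagon_vertex :: "nat \<Rightarrow> plane" where
  "pentagon_vertex k =
     (0, 1) + (1 / (2 * sin (2 * pi / 5))) *\<^sub>R
       (cos (pi / 2 + 2 * pi * real k / 5), sin (pi / 2 + 2 * pi * real k / 5))"

definition pentagon :: "plane set" where
  "pentagon = convex hull (pentagon_vertex ` {..<5})"

text \<open>
  The half-turn takes the side from \<open>p\<close> to \<open>q\<close> to the side from \<open>- p\<close> to \<open>- q\<close>, which is the
  translate by \<open>- p - q\<close> of the former, with \<open>p\<close> going to \<open>- q\<close> and \<open>q\<close> to \<open>- p\<close>.
\<close>

definition double_pentagon :: glued_polygons where
  "double_pentagon =
    \<lparr> region = pentagon \<union> uminus ` pentagon,
      pairings =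
       (\<lambda>k. (pentagon_vertex k, pentagon_vertex (Suc k),
              - pentagon_vertex k - pentagon_vertex (Suc k))) ` {..<5} \<rparr>"

definition L_to_pentagon :: "plane \<Rightarrow> plane" where
  "L_to_pentagon v = (fst v + cos (pi / 5) * snd v, sin (pi / 5) * snd v)"

end

theory Submission
  imports Defs
begin

text \<open>
  The Veech group of the golden L contains the reflections \<open>(x, y) \<mapsto> (y, x)\<close> and \<open>(x, y) \<mapsto> (-x, y)\<close> and
  the shear \<open>(x, y) \<mapsto> (x - \<phi> y, y)\<close>.  They act on holonomy vectors by a Euclidean algorithm, so every
  periodic direction is the image of the horizontal one, in which the two cylinders have circumferences
  \<open>1\<close> and \<open>\<phi>\<close>.  Hence in the direction of \<open>v \<in> \<Lambda>\<close> the holonomy vectors are \<open>v\<close> and \<open>\<phi> v\<close>, and the map \<open>P\<close>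
  carries this over to the double pentagon.

  In the first quadrant a trajectory crosses each side of the double pentagon in a fixed direction.
  With \<open>n\<^sub>k\<close> crossings of the \<open>k\<close>-th side, the holonomy vector is a combination of the five gluing
  translations with coefficients \<open>\<plusminus> n\<^sub>k\<close>, and as many crossings lead from \<open>Q\<close> to \<open>-Q\<close> as back.  Since
  \<open>\<phi>\<close> is irrational, this determines all \<open>n\<^sub>k\<close>.
\<close>

section \<open>Points of a glued surface\<close>

text \<open>The surface is only a topological quotient, without charts, so nothing can be read off
  in local coordinates. Facts about it come from functions on the plane that the side pairings leave
  unchanged: these descend to classes, separate points and, combined with time, give first integrals
  of trajectories. Equivalences of surfaces are linear maps followed by translations of pieces. They
  are homeomorphisms that preserve trajectories, hence also cylinders, which are connected
  components.

  The Euclidean algorithm stops because in the open quadrant a closed trajectory of the golden L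
  must cross a horizontal side, and each such crossing accounts for height 1 or phi.

  The counts satisfy a = n0, c = n2, b = n3 - n2, d = n4 - n0 and n0 + n1 + n2 = n3 + n4, so the
  total is 2 (n3 + n4) = 2 (a + b + c + d). For the long vector phi v the coefficients are b, a + b,
  d, c + d, which yields 2 (a + 2 b + c + 2 d). A horizontal v is special, being parallel to a side
  of the pentagon; that side lies on a leaf that runs into the vertex.\<close>

lemma glue_iff: "(p, q) \<in> glue S \<longleftrightarrow> (\<exists>a b. (a, b, q - p) \<in> pairings S \<and> p \<in> closed_segment a b)"
proof
  assume "(p, q) \<in> glue S"
  then obtain a b w where "(a, b, w) \<in> pairings S" "p \<in> closed_segment a b" "q = p + w"
    unfolding glue_def by blast
  then show "\<exists>a b. (a, b, q - p) \<in> pairings S \<and> p \<in> closed_segment a b"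
    by (metis add_diff_cancel_left')
next
  assume "\<exists>a b. (a, b, q - p) \<in> pairings S \<and> p \<in> closed_segment a b"
  then obtain a b where "(a, b, q - p) \<in> pairings S" "p \<in> closed_segment a b"
    by blast
  moreover have "q = p + (q - p)"
    by simp
  ultimately show "(p, q) \<in> glue S"
    unfolding glue_def by blast
qed

lemma pt_eq_iff: "pt S p = pt S q \<longleftrightarrow> (p, q) \<in> (glue S \<union> (glue S)\<inverse>)\<^sup>*"
proof
  assume "pt S p = pt S q"
  then show "(p, q) \<in> (glue S \<union> (glue S)\<inverse>)\<^sup>*"
    by (metis Image_singleton_iff pt_def rtrancl.rtrancl_refl)
next
  have "sym ((glue S \<union> (glue S)\<inverse>)\<^sup>*)"
    by (intro sym_rtrancl sym_Un_converse)
  moreover assume "(p, q) \<in> (glue S \<union> (glue S)\<inverse>)\<^sup>*"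
  ultimately show "pt S p = pt S q"
    unfolding pt_def by (auto dest: symD intro: rtrancl_trans)
qed

lemma mem_pt_iff: "q \<in> pt S p \<longleftrightarrow> pt S p = pt S q"
  by (simp add: pt_eq_iff) (simp add: pt_def)

lemma pt_self [simp]: "p \<in> pt S p"
  by (simp add: mem_pt_iff)

lemma pt_glue:
  assumes "(a, b, w) \<in> pairings S" "p \<in> closed_segment a b"
  shows "pt S (p + w) = pt S p"
proof -
  have "(p, p + w) \<in> glue S"
    using assms unfolding glue_iff by (metis add_diff_cancel_left')
  then show ?thesis
    by (metis Un_iff pt_eq_iff r_into_rtrancl)
qed

text \<open>Induction over a chain of gluings, each step of which goes along a pairing or against
  it. Reasoning about chains is thereby replaced by the search for a suitable
  \<open>f\<close>.\<close>

lemma pt_invariant: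
  assumes "\<And>a b w p. (a, b, w) \<in> pairings S \<Longrightarrow> p \<in> closed_segment a b \<Longrightarrow> f (p + w) = f p"
    and "pt S p = pt S q"
  shows "f p = f q"
proof -
  have "(p, q) \<in> (glue S \<union> (glue S)\<inverse>)\<^sup>*"
    using assms(2) by (simp add: pt_eq_iff)
  then show ?thesis
  proof (induction rule: rtrancl_induct)
    case (step y z)
    have "f y = f z"
      using step(2)
    proof
      assume "(y, z) \<in> glue S"
      then show ?thesis using assms(1)[of _ _ "z - y" y] by (auto simp: glue_iff)
    next
      assume "(y, z) \<in> (glue S)\<inverse>"
      then show ?thesis using assms(1)[of _ _ "y - z" z] by (auto simp: glue_iff)
    qed
    with step show ?case by simp
  qed simp
qed

text \<open>An arbitrary representative makes this total; the value is meaningful for an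
  \<open>f\<close> that the pairings leave unchanged.\<close>

definition lift_pt :: "(plane \<Rightarrow> 'a) \<Rightarrow> plane set \<Rightarrow> 'a" where
  "lift_pt f P = f (SOME p. p \<in> P)"

lemma lift_pt:
  assumes "\<And>a b w p. (a, b, w) \<in> pairings S \<Longrightarrow> p \<in> closed_segment a b \<Longrightarrow> f (p + w) = f p"
  shows "lift_pt f (pt S p) = f p"
proof -
  have "(SOME q. q \<in> pt S p) \<in> pt S p"
    by (rule someI[of _ p]) simp
  then have *: "pt S (SOME q. q \<in> pt S p) = pt S p"
    using mem_pt_iff by blast
  show ?thesis
    unfolding lift_pt_def by (rule pt_invariant[OF _ *]) (rule assms)
qed

text \<open>Such a point lies on neither member of any pair of glued sides, so no chain of gluings
  can leave it.\<close>

lemma pt_singleton: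
  assumes "\<And>a b w. (a, b, w) \<in> pairings S \<Longrightarrow> p \<notin> closed_segment a b \<and> p - w \<notin> closed_segment a b"
  shows "pt S p = {p}"
proof -
  have "q = p" if "(p, q) \<in> (glue S \<union> (glue S)\<inverse>)\<^sup>*" for q
    using that
  proof (induction rule: rtrancl_induct)
    case (step y z)
    then have "(p, z) \<in> glue S \<or> (z, p) \<in> glue S"
      by simp
    then show ?case
      unfolding glue_iff using assms[of _ _ "z - p"] assms[of _ _ "p - z"] by auto
  qed simp
  then show ?thesis
    by (auto simp: mem_pt_iff pt_eq_iff)
qed

lemma pt_mem_side_points:
  assumes "pt S p \<in> side_points S"
  obtains a b w where "(a, b, w) \<in> pairings S" "p \<in> closed_segment a b \<or> p - w \<in> closed_segment a b"
proof (rule ccontr)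
  assume "\<not> thesis"
  with that have *: "p \<notin> closed_segment a b \<and> p - w \<notin> closed_segment a b"
    if "(a, b, w) \<in> pairings S" for a b w
    using that by blast
  from assms obtain a b w q where q: "(a, b, w) \<in> pairings S" "q \<in> closed_segment a b" "pt S p = pt S q"
    by (auto simp: side_points_def)
  then have "q = p"
    using pt_singleton[OF *] by (metis mem_pt_iff singletonD)
  with q * show False by blast
qed

text \<open>\<open>side_points\<close> is built from one side of each pair only, but the partner
  sides consist of the same classes.\<close>

lemma pt_not_side_point:
  assumes "pt S p \<notin> side_points S"
  shows "pt S p = {p}"
proof (rule pt_singleton)
  fix a b w assume ab: "(a, b, w) \<in> pairings S"
  then have side: "q \<in> closed_segment a b \<Longrightarrow> pt S q \<in> side_points S" for q
    by (auto simp: side_points_def)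
  show "p \<notin> closed_segment a b \<and> p - w \<notin> closed_segment a b"
    using assms side[of p] side[of "p - w"] pt_glue[OF ab, of "p - w"] by auto
qed

lemma vertex_pointI: "(a, b, w) \<in> pairings S \<Longrightarrow> pt S a \<in> vertex_points S"
  "(a, b, w) \<in> pairings S \<Longrightarrow> pt S b \<in> vertex_points S"
  unfolding vertex_points_def by (blast intro: imageI)+

lemma topspace_surface: "topspace (surface S) = pt S ` region S"
proof -
  have "openin (surface S) (pt S ` region S)"
    unfolding openin_surface by (auto cong: conj_cong)
  then show ?thesis
    by (metis openin_subset openin_surface openin_topspace subset_antisym)
qed

lemma quotient_map_pt: "quotient_map (top_of_set (region S)) (surface S) (pt S)"
  unfolding quotient_map_def by (auto simp: topspace_surface openin_surface)

lemma continuous_map_pt: "continuous_map (top_of_set (region S)) (surface S) (pt S)"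
  by (rule quotient_imp_continuous_map[OF quotient_map_pt])

section \<open>Germs of segments\<close>

text \<open>A ray meets a convex set in an interval of parameters. If this interval has points
  arbitrarily close to 0, it contains some open interval from 0 to \<open>r\<close>.\<close>

lemma convex_germ:
  fixes C :: "'a::real_vector set"
  assumes "convex C"
  shows "(\<forall>\<^sub>F s in at_right (0::real). q + s *\<^sub>R u \<in> C) \<or> (\<forall>\<^sub>F s in at_right 0. q + s *\<^sub>R u \<notin> C)"
proof (cases "\<forall>\<epsilon>>0. \<exists>s. 0 < s \<and> s < \<epsilon> \<and> q + s *\<^sub>R u \<in> C")
  case True
  then obtain r where r: "r > 0" "q + r *\<^sub>R u \<in> C"
    using zero_less_one by blast
  have "q + s *\<^sub>R u \<in> C" if "0 < s" "s < r" for s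
  proof -
    obtain s' where s': "0 < s'" "s' < s" "q + s' *\<^sub>R u \<in> C"
      using True \<open>0 < s\<close> by blast
    \<comment> \<open>The parameter \<open>s\<close> lies between \<open>s'\<close> and
      \<open>r\<close>, and \<open>l\<close> is its weight:
      \<open>s = s' + l * (r - s')\<close>.\<close>
    define l where "l = (s - s') / (r - s')"
    have "0 \<le> l" "l \<le> 1"
      using s' that by (auto simp: l_def)
    then have "(1 - l) *\<^sub>R (q + s' *\<^sub>R u) + l *\<^sub>R (q + r *\<^sub>R u) \<in> C"
      using assms s'(3) r(2) by (auto simp: convex_alt)
    moreover have "l * (r - s') = s - s'"
      using s' that by (simp add: l_def)
    then have "(1 - l) *\<^sub>R (q + s' *\<^sub>R u) + l *\<^sub>R (q + r *\<^sub>R u) = q + (s' + (s - s')) *\<^sub>R u"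
      by (simp only: flip: \<open>l * (r - s') = s - s'\<close>) (simp add: algebra_simps)
    ultimately show ?thesis by simp
  qed
  then show ?thesis
    using r(1) by (auto simp: eventually_at_right_field)
next
  case False
  then obtain \<epsilon> where "\<epsilon> > 0" "\<And>s. 0 < s \<Longrightarrow> s < \<epsilon> \<Longrightarrow> q + s *\<^sub>R u \<notin> C"
    by blast
  then have "\<forall>\<^sub>F s in at_right 0. q + s *\<^sub>R u \<notin> C"
    unfolding eventually_at_right_field by blast
  then show ?thesis ..
qed

lemma closed_germ:
  fixes C :: "'a::real_normed_vector set"
  assumes "closed C" "\<forall>\<^sub>F s in at_right (0::real). q + s *\<^sub>R u \<in> C"
  shows "q \<in> C"
proof -
  have "((\<lambda>s. q + s *\<^sub>R u) \<longlongrightarrow> q + 0 *\<^sub>R u) (at_right 0)"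
    by (intro tendsto_intros)
  then show ?thesis
    using Lim_in_closed_set[OF assms] by simp
qed

lemma eventually_at_right_0:
  "eventually P (at_right (0::real)) \<longleftrightarrow> (\<exists>\<epsilon>>0. \<forall>s. 0 < s \<longrightarrow> s < \<epsilon> \<longrightarrow> P s)"
  by (auto simp: eventually_at_right_field)

text \<open>The definition of \<open>trajectory\<close> uses closed intervals; in the filter form,
  several germ conditions combine without tracking a common radius.\<close>

lemma eventually_at_right_closed:
  "(\<forall>\<^sub>F s in at_right (0::real). P s) \<and> P 0 \<longleftrightarrow> (\<exists>\<epsilon>>0. \<forall>s\<in>{0..\<epsilon>}. P s)"
proof
  assume "(\<forall>\<^sub>F s in at_right (0::real). P s) \<and> P 0"
  then obtain \<epsilon> where "\<epsilon> > 0" "\<forall>s. 0 < s \<longrightarrow> s < \<epsilon> \<longrightarrow> P s" "P 0"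
    by (auto simp: eventually_at_right_0)
  then have "\<forall>s\<in>{0..\<epsilon>/2}. P s"
    by (auto simp: order_le_less)
  then show "\<exists>\<epsilon>>0. \<forall>s\<in>{0..\<epsilon>}. P s"
    using \<open>\<epsilon> > 0\<close> half_gt_zero by blast
qed (auto simp: eventually_at_right_0)

lemma trajectoryD:
  assumes "trajectory S u \<gamma>"
  obtains p q where "\<gamma> t = pt S p" "\<gamma> t = pt S q" "p \<in> region S" "q \<in> region S"
    "\<forall>\<^sub>F s in at_right 0. p - s *\<^sub>R u \<in> region S \<and> \<gamma> (t - s) = pt S (p - s *\<^sub>R u)"
    "\<forall>\<^sub>F s in at_right 0. q + s *\<^sub>R u \<in> region S \<and> \<gamma> (t + s) = pt S (q + s *\<^sub>R u)"
proof -
  obtain p q \<epsilon> where "\<epsilon> > 0" and *: "\<gamma> t = pt S p" "\<gamma> t = pt S q"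
    "\<forall>s\<in>{0..\<epsilon>}. p - s *\<^sub>R u \<in> region S \<and> \<gamma> (t - s) = pt S (p - s *\<^sub>R u)"
    "\<forall>s\<in>{0..\<epsilon>}. q + s *\<^sub>R u \<in> region S \<and> \<gamma> (t + s) = pt S (q + s *\<^sub>R u)"
    using assms unfolding trajectory_def by blast
  show thesis
  proof (rule that[of p q])
    show "p \<in> region S" "q \<in> region S"
      using bspec[OF *(3), of 0] bspec[OF *(4), of 0] \<open>\<epsilon> > 0\<close> by auto
  qed (use * \<open>\<epsilon> > 0\<close> in \<open>auto simp: eventually_at_right_0 intro!: exI[of _ \<epsilon>]\<close>)
qed

lemma trajectory_not_vertex: "trajectory S u \<gamma> \<Longrightarrow> \<gamma> t \<notin> vertex_points S"
  unfolding trajectory_def by blast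

lemma trajectoryI:
  assumes "u \<noteq> 0" "\<And>t. \<gamma> t \<notin> vertex_points S"
    and "\<And>t. \<exists>p q. \<gamma> t = pt S p \<and> \<gamma> t = pt S q \<and> p \<in> region S \<and> q \<in> region S \<and>
      (\<forall>\<^sub>F s in at_right 0. p - s *\<^sub>R u \<in> region S \<and> \<gamma> (t - s) = pt S (p - s *\<^sub>R u)) \<and>
      (\<forall>\<^sub>F s in at_right 0. q + s *\<^sub>R u \<in> region S \<and> \<gamma> (t + s) = pt S (q + s *\<^sub>R u))"
  shows "trajectory S u \<gamma>"
  unfolding trajectory_def
proof (intro conjI allI)
  fix t
  obtain p q where *: "\<gamma> t = pt S p" "\<gamma> t = pt S q" "p \<in> region S" "q \<in> region S"
    "\<forall>\<^sub>F s in at_right 0. p - s *\<^sub>R u \<in> region S \<and> \<gamma> (t - s) = pt S (p - s *\<^sub>R u)"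
    "\<forall>\<^sub>F s in at_right 0. q + s *\<^sub>R u \<in> region S \<and> \<gamma> (t + s) = pt S (q + s *\<^sub>R u)"
    using assms(3) by blast
  have "\<exists>\<epsilon>>0. \<forall>s\<in>{0..\<epsilon>}. (p - s *\<^sub>R u \<in> region S \<and> \<gamma> (t - s) = pt S (p - s *\<^sub>R u)) \<and>
      (q + s *\<^sub>R u \<in> region S \<and> \<gamma> (t + s) = pt S (q + s *\<^sub>R u))"
    by (rule eventually_at_right_closed[THEN iffD1]) (use * in \<open>simp add: eventually_conj_iff\<close>)
  then obtain \<epsilon> where "\<epsilon> > 0"
    "\<forall>s\<in>{0..\<epsilon>}. p - s *\<^sub>R u \<in> region S \<and> \<gamma> (t - s) = pt S (p - s *\<^sub>R u)"
    "\<forall>s\<in>{0..\<epsilon>}. q + s *\<^sub>R u \<in> region S \<and> \<gamma> (t + s) = pt S (q + s *\<^sub>R u)"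
    by blast
  with *(1,2) show "\<exists>p q. \<exists>\<epsilon>>0. \<gamma> t = pt S p \<and> \<gamma> t = pt S q \<and>
      (\<forall>s\<in>{0..\<epsilon>}. p - s *\<^sub>R u \<in> region S \<and> \<gamma> (t - s) = pt S (p - s *\<^sub>R u)) \<and>
      (\<forall>s\<in>{0..\<epsilon>}. q + s *\<^sub>R u \<in> region S \<and> \<gamma> (t + s) = pt S (q + s *\<^sub>R u))"
    by blast
qed (use assms in auto)

lemma eventually_at_split_real:
  "(\<forall>\<^sub>F s in at (t::real). P s) \<longleftrightarrow>
    (\<forall>\<^sub>F s in at_right 0. P (t - s)) \<and> (\<forall>\<^sub>F s in at_right 0. P (t + s))"
proof -
  have "(\<forall>\<^sub>F s in at_left t. P s) \<longleftrightarrow> (\<forall>\<^sub>F s in at_right (-t). P (- s))"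
    by (subst at_left_minus) (simp add: eventually_filtermap)
  also have "\<dots> \<longleftrightarrow> (\<forall>\<^sub>F s in at_right 0. P (t - s))"
    by (subst at_right_to_0) (simp add: eventually_filtermap)
  moreover have "(\<forall>\<^sub>F s in at_right t. P s) \<longleftrightarrow> (\<forall>\<^sub>F s in at_right 0. P (t + s))"
    by (subst at_right_to_0) (simp add: eventually_filtermap add.commute)
  ultimately show ?thesis
    by (simp add: eventually_at_split)
qed

text \<open>A first integral: by the two germs at each time the value is locally constant, and the
  real line is connected. Time is an argument of \<open>H\<close> so that a coordinate moving at
  constant speed can be compensated.\<close>

lemma trajectory_invariant:
  fixes H :: "plane set \<Rightarrow> real \<Rightarrow> 'a"
  assumes \<gamma>: "trajectory S u \<gamma>"
    and H: "\<And>p s t. p \<in> region S \<Longrightarrow> p + s *\<^sub>R u \<in> region S \<Longrightarrow> pt S p \<notin> vertex_points S \<Longrightarrow>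
      pt S (p + s *\<^sub>R u) \<notin> vertex_points S \<Longrightarrow> H (pt S (p + s *\<^sub>R u)) (t + s) = H (pt S p) t"
  shows "H (\<gamma> t) t = H (\<gamma> t') t'"
proof -
  have nv: "\<gamma> t \<notin> vertex_points S" for t
    using \<gamma> by (rule trajectory_not_vertex)
  have "\<forall>\<^sub>F s in at t. H (\<gamma> t) t = H (\<gamma> s) s" for t
  proof -
    obtain p q where *: "\<gamma> t = pt S p" "\<gamma> t = pt S q" "p \<in> region S" "q \<in> region S"
      "\<forall>\<^sub>F s in at_right 0. p - s *\<^sub>R u \<in> region S \<and> \<gamma> (t - s) = pt S (p - s *\<^sub>R u)"
      "\<forall>\<^sub>F s in at_right 0. q + s *\<^sub>R u \<in> region S \<and> \<gamma> (t + s) = pt S (q + s *\<^sub>R u)"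
      by (rule trajectoryD[OF \<gamma>])
    have "\<forall>\<^sub>F s in at_right 0. H (\<gamma> t) t = H (\<gamma> (t - s)) (t - s)"
      using *(5)
    proof eventually_elim
      case (elim s)
      then show ?case
        using H[of p "-s" t] *(1,3) nv[of t] nv[of "t - s"] by auto
    qed
    moreover have "\<forall>\<^sub>F s in at_right 0. H (\<gamma> t) t = H (\<gamma> (t + s)) (t + s)"
      using *(6)
    proof eventually_elim
      case (elim s)
      then show ?case
        using H[of q "s" t] *(2,4) nv[of t] nv[of "t + s"] by auto
    qed
    ultimately show ?thesis
      by (simp add: eventually_at_split_real)
  qed
  then show ?thesis
    using connected_local_const[of "UNIV::real set" t t' "\<lambda>t. H (\<gamma> t) t"] by auto
qed

section \<open>Affine equivalences\<close>

text \<open>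
  A piece \<open>(R, \<tau>)\<close> is moved by \<open>p \<mapsto> A p + \<tau>\<close>; the pieces of the image are glued up to the second surface.
\<close>

locale affine_equivalence =
  fixes S S' :: glued_polygons and A A' :: "plane \<Rightarrow> plane" and I :: "(plane set \<times> plane) set"
  assumes linear: "linear A" and linear': "linear A'"
    and A'_A [simp]: "A' (A x) = x" and A_A' [simp]: "A (A' x) = x"
    and finite: "finite I"
    and compact: "(R, \<tau>) \<in> I \<Longrightarrow> compact R"
    and convex: "(R, \<tau>) \<in> I \<Longrightarrow> convex R"
    and region: "region S = (\<Union>(R, \<tau>)\<in>I. R)"
    and region': "region S' = (\<Union>(R, \<tau>)\<in>I. (\<lambda>p. A p + \<tau>) ` R)"
    and pt_iff: "(R, \<tau>) \<in> I \<Longrightarrow> (R', \<tau>') \<in> I \<Longrightarrow> p \<in> R \<Longrightarrow> q \<in> R' \<Longrightarrow>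
      pt S p = pt S q \<longleftrightarrow> pt S' (A p + \<tau>) = pt S' (A q + \<tau>')"
    and vertex_iff: "(R, \<tau>) \<in> I \<Longrightarrow> p \<in> R \<Longrightarrow>
      pt S p \<in> vertex_points S \<longleftrightarrow> pt S' (A p + \<tau>) \<in> vertex_points S'"
begin

text \<open>The assumptions of the locale are symmetric: on a moved piece the inverse is
  \<open>A'\<close> with offset \<open>- A' \<tau>\<close>. Hence everything shown for
  \<open>F\<close> holds for its inverse as well.\<close>

lemma inverse: "affine_equivalence S' S A' A ((\<lambda>(R, \<tau>). ((\<lambda>p. A p + \<tau>) ` R, - A' \<tau>)) ` I)"
proof (rule affine_equivalence.intro)
  have *: "A' (A p + \<tau>) + - A' \<tau> = p" for p \<tau>
    by (simp add: linear_add[OF linear'])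
  let ?J = "(\<lambda>(R, \<tau>). ((\<lambda>p. A p + \<tau>) ` R, - A' \<tau>)) ` I"
  have J_cases: "\<exists>R0 \<tau>0. (R0, \<tau>0) \<in> I \<and> R = (\<lambda>p. A p + \<tau>0) ` R0 \<and> \<tau> = - A' \<tau>0"
    if "(R, \<tau>) \<in> ?J" for R \<tau>
  proof -
    from that obtain i where i: "(R, \<tau>) = (\<lambda>(R, \<tau>). ((\<lambda>p. A p + \<tau>) ` R, - A' \<tau>)) i" "i \<in> I"
      by (rule imageE)
    show ?thesis
      by (rule exI[of _ "fst i"], rule exI[of _ "snd i"]) (use i in \<open>auto simp: case_prod_beta\<close>)
  qed
  show "compact R" if J: "(R, \<tau>) \<in> ?J" for R \<tau>
  proof -
    obtain R0 \<tau>0 where R0: "(R0, \<tau>0) \<in> I" "R = (\<lambda>p. A p + \<tau>0) ` R0"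
      using J_cases[OF J] by blast
    have "compact ((+) \<tau>0 ` A ` R0)"
      by (intro compact_translation compact_continuous_image linear_continuous_on linear_conv_bounded_linear[THEN iffD1]
          linear compact[OF R0(1)])
    then show ?thesis
      by (simp add: R0(2) image_image add.commute)
  qed
  show "convex R" if J: "(R, \<tau>) \<in> ?J" for R \<tau>
  proof -
    obtain R0 \<tau>0 where R0: "(R0, \<tau>0) \<in> I" "R = (\<lambda>p. A p + \<tau>0) ` R0"
      using J_cases[OF J] by blast
    have "convex ((+) \<tau>0 ` A ` R0)"
      by (intro convex_translation convex_linear_image linear convex[OF R0(1)])
    then show ?thesis
      by (simp add: R0(2) image_image add.commute)
  qed
  show "region S' = (\<Union>(R, \<tau>)\<in>?J. R)"
    unfolding region' by (simp add: case_prod_beta)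
  have "(\<Union>(R, \<tau>)\<in>?J. (\<lambda>p. A' p + \<tau>) ` R) = (\<Union>(R, \<tau>)\<in>I. (\<lambda>p. A' (A p + \<tau>) + - A' \<tau>) ` R)"
    by (simp add: case_prod_beta image_image)
  then show "region S = (\<Union>(R, \<tau>)\<in>?J. (\<lambda>p. A' p + \<tau>) ` R)"
    unfolding region by (simp only: *) (simp add: case_prod_beta)
  show "pt S' p = pt S' q \<longleftrightarrow> pt S (A' p + \<tau>) = pt S (A' q + \<tau>')"
    if J: "(R, \<tau>) \<in> ?J" "(R', \<tau>') \<in> ?J" "p \<in> R" "q \<in> R'" for R \<tau> R' \<tau>' p q
  proof -
    obtain R0 \<tau>0 where o: "(R0, \<tau>0) \<in> I" "R = (\<lambda>p. A p + \<tau>0) ` R0" "\<tau> = - A' \<tau>0"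
      using J_cases[OF J(1)] by blast
    with J(3) obtain p0 where 0: "p0 \<in> R0" "p = A p0 + \<tau>0"
      by blast
    obtain R1 \<tau>1 where l: "(R1, \<tau>1) \<in> I" "R' = (\<lambda>p. A p + \<tau>1) ` R1" "\<tau>' = - A' \<tau>1"
      using J_cases[OF J(2)] by blast
    with J(4) obtain p1 where 1: "p1 \<in> R1" "q = A p1 + \<tau>1"
      by blast
    show ?thesis
      unfolding 0(2) 1(2) o(3) l(3) * using pt_iff[OF o(1) l(1) 0(1) 1(1)] by simp
  qed
  show "pt S' p \<in> vertex_points S' \<longleftrightarrow> pt S (A' p + \<tau>) \<in> vertex_points S"
    if J: "(R, \<tau>) \<in> ?J" "p \<in> R" for R \<tau> p
  proof -
    obtain R0 \<tau>0 where o: "(R0, \<tau>0) \<in> I" "R = (\<lambda>p. A p + \<tau>0) ` R0" "\<tau> = - A' \<tau>0"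
      using J_cases[OF J(1)] by blast
    with J(2) obtain p0 where 0: "p0 \<in> R0" "p = A p0 + \<tau>0"
      by blast
    show ?thesis
      unfolding 0(2) o(3) * using vertex_iff[OF o(1) 0(1)] by simp
  qed
qed (use linear linear' finite in simp_all)

text \<open>Several pieces and representatives may apply; the forward half of \<open>pt_iff\<close>
  makes the result independent of them.\<close>

definition F :: "plane set \<Rightarrow> plane set" where
  "F P = (SOME Q. \<exists>R \<tau> p. (R, \<tau>) \<in> I \<and> p \<in> R \<and> P = pt S p \<and> Q = pt S' (A p + \<tau>))"

lemma F_pt: "(R, \<tau>) \<in> I \<Longrightarrow> p \<in> R \<Longrightarrow> F (pt S p) = pt S' (A p + \<tau>)"
  unfolding F_def by (rule some_equality) (use pt_iff in blast)+

lemma image_in_region: "(R, \<tau>) \<in> I \<Longrightarrow> p \<in> R \<Longrightarrow> A p + \<tau> \<in> region S'"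
  unfolding region' by blast

lemma piece: assumes "p \<in> region S" obtains R \<tau> where "(R, \<tau>) \<in> I" "p \<in> R"
  using assms unfolding region by blast

text \<open>As \<open>pt\<close> is a quotient map, continuity may be tested on the region, which is
  covered by finitely many closed pieces; on overlaps the local formulas agree by
  \<open>pt_iff\<close>.\<close>

lemma continuous_F: "continuous_map (surface S) (surface S') F"
proof (rule continuous_compose_quotient_map[OF quotient_map_pt],
    rule pasting_lemma_closed[where I = I and T = fst and f = "\<lambda>(R, \<tau>) p. pt S' (A p + \<tau>)"])
  show "finite I" by (rule finite)
  show "closedin (top_of_set (region S)) (fst i)" if "i \<in> I" for i
  proof -
    obtain R \<tau> where Pair: "i = (R, \<tau>)"
      by (rule prod.exhaust)
    then show ?thesis
      using that compact[of R \<tau>] unfolding region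
      by (intro closed_subset) (auto intro: compact_imp_closed)
  qed
  show "continuous_map (subtopology (top_of_set (region S)) (fst i)) (surface S')
      (case i of (R, \<tau>) \<Rightarrow> \<lambda>p. pt S' (A p + \<tau>))" if "i \<in> I" for i
  proof -
    obtain R \<tau> where Pair: "i = (R, \<tau>)"
      by (rule prod.exhaust)
    have "continuous_on R (\<lambda>p. A p + \<tau>)"
      by (intro continuous_intros linear_continuous_on linear_conv_bounded_linear[THEN iffD1] linear)
    then have "continuous_map (top_of_set R) (top_of_set (region S')) (\<lambda>p. A p + \<tau>)"
      using image_in_region that Pair by (auto simp: continuous_map_subtopology_eu)
    then have "continuous_map (top_of_set R) (surface S') (pt S' \<circ> (\<lambda>p. A p + \<tau>))"
      by (rule continuous_map_compose[OF _ continuous_map_pt])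
    moreover have "region S \<inter> R = R"
      using Pair that unfolding region by blast
    ultimately show ?thesis
      by (simp add: Pair subtopology_subtopology o_def)
  qed
  show "(case i of (R, \<tau>) \<Rightarrow> \<lambda>p. pt S' (A p + \<tau>)) x = (case j of (R, \<tau>) \<Rightarrow> \<lambda>p. pt S' (A p + \<tau>)) x"
    if "i \<in> I" "j \<in> I" "x \<in> topspace (top_of_set (region S)) \<inter> fst i \<inter> fst j" for i j x
    using that pt_iff[of "fst i" "snd i" "fst j" "snd j" x x] by (simp add: case_prod_beta)
  show "\<exists>j. j \<in> I \<and> x \<in> fst j \<and> (F \<circ> pt S) x = (case j of (R, \<tau>) \<Rightarrow> \<lambda>p. pt S' (A p + \<tau>)) x"
    if x: "x \<in> topspace (top_of_set (region S))" for x
  proof -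
    obtain R \<tau> where "(R, \<tau>) \<in> I" "x \<in> R"
      using x by (metis topspace_euclidean_subtopology piece)
    then show ?thesis
      by (intro exI[of _ "(R, \<tau>)"]) (simp add: F_pt)
  qed
qed

text \<open>Each convex piece either contains a short initial part of the ray or avoids one.
  Finitely many pieces cannot all be avoided, and closedness adds the starting point.\<close>

lemma piece_germ:
  assumes "\<forall>\<^sub>F s in at_right 0. q + s *\<^sub>R w \<in> region S"
  obtains R \<tau> where "(R, \<tau>) \<in> I" "q \<in> R" "\<forall>\<^sub>F s in at_right 0. q + s *\<^sub>R w \<in> R"
proof (rule ccontr)
  assume "\<not> thesis"
  with that have no: "\<not> (\<forall>\<^sub>F s in at_right 0. q + s *\<^sub>R w \<in> R)" if "(R, \<tau>) \<in> I" for R \<tau>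
    using that closed_germ[OF compact_imp_closed[OF compact[OF that]], of q w] by blast
  have "\<forall>\<^sub>F s in at_right 0. \<forall>i\<in>I. q + s *\<^sub>R w \<notin> fst i"
  proof (rule eventually_ball_finite[OF finite], rule ballI)
    fix i assume "i \<in> I"
    then show "\<forall>\<^sub>F s in at_right 0. q + s *\<^sub>R w \<notin> fst i"
      using no[of "fst i" "snd i"] convex_germ[OF convex[of "fst i" "snd i"], of q w] by auto
  qed
  with assms have "\<forall>\<^sub>F s in at_right (0::real). False"
    by eventually_elim (auto simp: region)
  then show False
    by simp
qed

text \<open>On the piece that contains the germ, \<open>F\<close> comes from one affine map, so a
  segment with velocity \<open>w\<close> becomes one with velocity \<open>A w\<close>. The curve
  \<open>f\<close> is a trajectory followed forwards or backwards in time.\<close>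

lemma F_germ:
  assumes "P = pt S q" "\<forall>\<^sub>F s in at_right 0. q + s *\<^sub>R w \<in> region S \<and> f s = pt S (q + s *\<^sub>R w)"
  shows "\<exists>q'. F P = pt S' q' \<and> q' \<in> region S' \<and>
    (\<forall>\<^sub>F s in at_right 0. q' + s *\<^sub>R A w \<in> region S' \<and> F (f s) = pt S' (q' + s *\<^sub>R A w))"
proof -
  have "\<forall>\<^sub>F s in at_right 0. q + s *\<^sub>R w \<in> region S"
    using assms(2) by eventually_elim simp
  from piece_germ[OF this] obtain R \<tau> where R: "(R, \<tau>) \<in> I" "q \<in> R"
    "\<forall>\<^sub>F s in at_right 0. q + s *\<^sub>R w \<in> R"
    by blast
  have eq: "A (q + s *\<^sub>R w) + \<tau> = (A q + \<tau>) + s *\<^sub>R A w" for s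
    by (simp add: linear_add[OF linear] linear_scale[OF linear])
  have "\<forall>\<^sub>F s in at_right 0. (A q + \<tau>) + s *\<^sub>R A w \<in> region S' \<and> F (f s) = pt S' ((A q + \<tau>) + s *\<^sub>R A w)"
    using assms(2) R(3) unfolding eq[symmetric]
    by eventually_elim (use R(1) image_in_region F_pt in auto)
  then show ?thesis
    using R F_pt image_in_region assms(1) by blast
qed

lemma F_vertex: "p \<in> region S \<Longrightarrow> F (pt S p) \<in> vertex_points S' \<longleftrightarrow> pt S p \<in> vertex_points S"
  using vertex_iff F_pt by (metis piece)

lemma trajectory_F:
  assumes "trajectory S u \<gamma>"
  shows "trajectory S' (A u) (F \<circ> \<gamma>)"
proof (rule trajectoryI)
  have "u \<noteq> 0"
    using assms by (simp add: trajectory_def)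
  then show "A u \<noteq> 0"
    using A'_A[of u] linear_0[OF linear'] by metis
next
  fix t
  obtain p q where *: "\<gamma> t = pt S p" "\<gamma> t = pt S q" "p \<in> region S" "q \<in> region S"
    "\<forall>\<^sub>F s in at_right 0. p - s *\<^sub>R u \<in> region S \<and> \<gamma> (t - s) = pt S (p - s *\<^sub>R u)"
    "\<forall>\<^sub>F s in at_right 0. q + s *\<^sub>R u \<in> region S \<and> \<gamma> (t + s) = pt S (q + s *\<^sub>R u)"
    by (rule trajectoryD[OF assms])
  show "(F \<circ> \<gamma>) t \<notin> vertex_points S'"
    using F_vertex[OF *(3)] *(1) trajectory_not_vertex[OF assms, of t] by simp
  \<comment> \<open>The arriving segment is a departing one for the velocity
    \<open>- u\<close>.\<close>
  have "\<forall>\<^sub>F s in at_right 0. p + s *\<^sub>R (- u) \<in> region S \<and> \<gamma> (t - s) = pt S (p + s *\<^sub>R (- u))"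
    using *(5) by simp
  from F_germ[OF *(1) this] F_germ[OF *(2,6)]
  show "\<exists>p q. (F \<circ> \<gamma>) t = pt S' p \<and> (F \<circ> \<gamma>) t = pt S' q \<and> p \<in> region S' \<and> q \<in> region S' \<and>
      (\<forall>\<^sub>F s in at_right 0. p - s *\<^sub>R A u \<in> region S' \<and> (F \<circ> \<gamma>) (t - s) = pt S' (p - s *\<^sub>R A u)) \<and>
      (\<forall>\<^sub>F s in at_right 0. q + s *\<^sub>R A u \<in> region S' \<and> (F \<circ> \<gamma>) (t + s) = pt S' (q + s *\<^sub>R A u))"
    by (simp add: linear_neg[OF linear]) blast
qed

end

section \<open>Transport of periods, periodic trajectories and cylinders\<close>

lemma periods_transfer:
  assumes "\<And>t t'. f (\<gamma> t) = f (\<gamma> t') \<longleftrightarrow> \<gamma> t = \<gamma> t'"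
  shows "periods (f \<circ> \<gamma>) = periods \<gamma>" "primitive_period (f \<circ> \<gamma>) = primitive_period \<gamma>"
  using assms by (simp_all add: periods_def primitive_period_def)

definition periodic_points :: "glued_polygons \<Rightarrow> plane \<Rightarrow> plane set set" where
  "periodic_points S u = (\<Union>\<gamma>\<in>{\<gamma>. periodic_trajectory S u \<gamma>}. range \<gamma>)"

lemma trajectory_in_surface:
  assumes "trajectory S u \<gamma>"
  shows "\<gamma> t \<in> topspace (surface S)"
proof -
  obtain p q where "\<gamma> t = pt S p" "p \<in> region S"
    by (rule trajectoryD[OF assms])
  then show ?thesis
    unfolding topspace_surface by blast
qed

context affine_equivalence
begin

interpretation inv: affine_equivalence S' S A' A "(\<lambda>(R, \<tau>). ((\<lambda>p. A p + \<tau>) ` R, - A' \<tau>)) ` I"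
  by (rule inverse)

definition G :: "plane set \<Rightarrow> plane set" where
  "G = inv.F"

lemma G_pt: "(R, \<tau>) \<in> I \<Longrightarrow> p \<in> R \<Longrightarrow> G (pt S' (A p + \<tau>)) = pt S p"
proof -
  assume *: "(R, \<tau>) \<in> I" "p \<in> R"
  then have "G (pt S' (A p + \<tau>)) = pt S (A' (A p + \<tau>) + - A' \<tau>)"
    unfolding G_def by (intro inv.F_pt[of "(\<lambda>p. A p + \<tau>) ` R"]) (auto intro: rev_image_eqI)
  then show ?thesis
    by (simp add: linear_add[OF linear'])
qed

lemma trajectory_G: "trajectory S' (A u) \<gamma> \<Longrightarrow> trajectory S u (G \<circ> \<gamma>)"
  using inv.trajectory_F[of "A u"] unfolding G_def by simp

lemma G_F: "P \<in> topspace (surface S) \<Longrightarrow> G (F P) = P"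
  unfolding topspace_surface using F_pt G_pt by (auto elim!: piece)

lemma F_G: "P \<in> topspace (surface S') \<Longrightarrow> F (G P) = P"
  unfolding topspace_surface region' using F_pt G_pt by auto

lemma homeomorphic_maps_F: "homeomorphic_maps (surface S) (surface S') F G"
  unfolding homeomorphic_maps_def using continuous_F inv.continuous_F G_F F_G by (simp add: G_def)

lemma G_eq_iff: "P \<in> topspace (surface S') \<Longrightarrow> Q \<in> topspace (surface S') \<Longrightarrow> G P = G Q \<longleftrightarrow> P = Q"
  by (metis F_G)

lemma F_eq_iff: "P \<in> topspace (surface S) \<Longrightarrow> Q \<in> topspace (surface S) \<Longrightarrow> F P = F Q \<longleftrightarrow> P = Q"
  by (metis G_F)

lemma periods_F:
  assumes "trajectory S u \<gamma>"
  shows "periods (F \<circ> \<gamma>) = periods \<gamma>" "primitive_period (F \<circ> \<gamma>) = primitive_period \<gamma>"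
  using periods_transfer[of F \<gamma>] F_eq_iff trajectory_in_surface[OF assms] by auto

lemma periods_G:
  assumes "trajectory S' u \<gamma>"
  shows "periods (G \<circ> \<gamma>) = periods \<gamma>" "primitive_period (G \<circ> \<gamma>) = primitive_period \<gamma>"
  using periods_transfer[of G \<gamma>] G_eq_iff trajectory_in_surface[OF assms] by auto

lemma periodic_trajectory_F: "periodic_trajectory S u \<gamma> \<Longrightarrow> periodic_trajectory S' (A u) (F \<circ> \<gamma>)"
  unfolding periodic_trajectory_def using trajectory_F periods_F by metis

lemma periodic_trajectory_G: "periodic_trajectory S' (A u) \<gamma> \<Longrightarrow> periodic_trajectory S u (G \<circ> \<gamma>)"
  unfolding periodic_trajectory_def using trajectory_G periods_G by metis

lemma periodic_points_F: "periodic_points S' (A u) = F ` periodic_points S u"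
proof
  show "F ` periodic_points S u \<subseteq> periodic_points S' (A u)"
    unfolding periodic_points_def using periodic_trajectory_F by fastforce
next
  show "periodic_points S' (A u) \<subseteq> F ` periodic_points S u"
  proof
    fix P assume "P \<in> periodic_points S' (A u)"
    then obtain \<gamma> t where \<gamma>: "periodic_trajectory S' (A u) \<gamma>" "P = \<gamma> t"
      unfolding periodic_points_def by blast
    have "F ((G \<circ> \<gamma>) t) = P"
      using F_G trajectory_in_surface \<gamma> unfolding periodic_trajectory_def by fastforce
    then show "P \<in> F ` periodic_points S u"
      using periodic_trajectory_G[OF \<gamma>(1)] unfolding periodic_points_def by blast
  qed
qed

text \<open>Cylinders are connected components, and \<open>F\<close> restricts to a homeomorphism
  between the sets of periodic points.\<close>

lemma cylinders_F: "cylinders S' (A u) = (`) F ` cylinders S u"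
proof -
  have "periodic_points S u \<subseteq> topspace (surface S)"
    unfolding periodic_points_def periodic_trajectory_def using trajectory_in_surface by blast
  moreover have "homeomorphic_map (surface S) (surface S') F"
    using homeomorphic_maps_F by (auto simp: homeomorphic_map_maps)
  moreover have "F ` (topspace (surface S) \<inter> periodic_points S u) = topspace (surface S') \<inter> periodic_points S' (A u)"
    using calculation by (auto simp: periodic_points_F homeomorphic_imp_surjective_map[symmetric])
  ultimately have "homeomorphic_map (subtopology (surface S) (periodic_points S u))
      (subtopology (surface S') (periodic_points S' (A u))) F"
    by (intro homeomorphic_map_subtopologies_alt) (auto simp: periodic_points_F F_eq_iff subset_iff)
  from homeomorphic_map_connected_components_of[OF this] show ?thesis
    unfolding cylinders_def periodic_points_def .
qed

end

text \<open>\<open>C\<close> is the short cylinder and \<open>C'\<close> the long one. As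
  \<open>primitive_period\<close> is an infimum, membership in \<open>periods\<close> is demanded
  separately. The existence of a trajectory in each cylinder gives meaning to the definite
  description in \<open>cylinder_holonomy\<close>.\<close>

definition two_cylinders :: "glued_polygons \<Rightarrow> plane \<Rightarrow> real \<Rightarrow> bool" where
  "two_cylinders S u T \<longleftrightarrow> T > 0 \<and> (\<exists>C C'. cylinders S u = {C, C'} \<and>
     (\<exists>\<gamma>. periodic_trajectory S u \<gamma> \<and> range \<gamma> \<subseteq> C) \<and>
     (\<exists>\<gamma>. periodic_trajectory S u \<gamma> \<and> range \<gamma> \<subseteq> C') \<and>
     (\<forall>\<gamma>. periodic_trajectory S u \<gamma> \<and> range \<gamma> \<subseteq> C \<longrightarrow> T \<in> periods \<gamma> \<and> primitive_period \<gamma> = T) \<and>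
     (\<forall>\<gamma>. periodic_trajectory S u \<gamma> \<and> range \<gamma> \<subseteq> C' \<longrightarrow> phi * T \<in> periods \<gamma> \<and> primitive_period \<gamma> = phi * T))"

lemma cylinders_subset: "C \<in> cylinders S u \<Longrightarrow> C \<subseteq> topspace (surface S)"
  unfolding cylinders_def by (drule connected_components_of_subset) (auto simp: topspace_subtopology)

lemma (in affine_equivalence) two_cylinders_F:
  assumes "two_cylinders S u T"
  shows "two_cylinders S' (A u) T"
proof -
  obtain C C' where C: "T > 0" "cylinders S u = {C, C'}"
    "\<exists>\<gamma>. periodic_trajectory S u \<gamma> \<and> range \<gamma> \<subseteq> C" "\<exists>\<gamma>. periodic_trajectory S u \<gamma> \<and> range \<gamma> \<subseteq> C'"
    "\<And>\<gamma>. periodic_trajectory S u \<gamma> \<and> range \<gamma> \<subseteq> C \<Longrightarrow> T \<in> periods \<gamma> \<and> primitive_period \<gamma> = T"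
    "\<And>\<gamma>. periodic_trajectory S u \<gamma> \<and> range \<gamma> \<subseteq> C' \<Longrightarrow> phi * T \<in> periods \<gamma> \<and> primitive_period \<gamma> = phi * T"
    using assms unfolding two_cylinders_def by blast
  \<comment> \<open>A trajectory in an image cylinder is pulled back by \<open>G\<close> with its
    periods, so the universal claims reduce to those for \<open>C\<close> and
    \<open>C'\<close>.\<close>
  have pull: "periodic_trajectory S u (G \<circ> \<gamma>) \<and> range (G \<circ> \<gamma>) \<subseteq> K \<and> periods (G \<circ> \<gamma>) = periods \<gamma> \<and>
      primitive_period (G \<circ> \<gamma>) = primitive_period \<gamma>"
    if "periodic_trajectory S' (A u) \<gamma> \<and> range \<gamma> \<subseteq> F ` K" "K \<in> {C, C'}" for \<gamma> K
  proof -
    have "K \<subseteq> topspace (surface S)"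
      using that(2) cylinders_subset unfolding C(2)[symmetric] by blast
    then have "G ` F ` K \<subseteq> K"
      using G_F by (auto simp: subset_iff)
    moreover have "range (G \<circ> \<gamma>) \<subseteq> G ` F ` K"
      unfolding image_comp[symmetric] using that(1) by (intro image_mono) simp
    ultimately have "range (G \<circ> \<gamma>) \<subseteq> K"
      by (rule order_trans[rotated])
    moreover have "trajectory S' (A u) \<gamma>"
      using that(1) unfolding periodic_trajectory_def by simp
    ultimately show ?thesis
      using that(1) periodic_trajectory_G periods_G by simp
  qed
  have fwd: "\<exists>\<gamma>. periodic_trajectory S' (A u) \<gamma> \<and> range \<gamma> \<subseteq> F ` K"
    if "\<exists>\<gamma>. periodic_trajectory S u \<gamma> \<and> range \<gamma> \<subseteq> K" for K
    using that periodic_trajectory_F by (metis image_comp image_mono)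
  show ?thesis
    unfolding two_cylinders_def
  proof (rule conjI[OF C(1)], rule exI[of _ "F ` C"], rule exI[of _ "F ` C'"], intro conjI fwd C(3,4))
    show "cylinders S' (A u) = {F ` C, F ` C'}"
      by (simp add: cylinders_F C(2))
    show "\<forall>\<gamma>. periodic_trajectory S' (A u) \<gamma> \<and> range \<gamma> \<subseteq> F ` C \<longrightarrow> T \<in> periods \<gamma> \<and> primitive_period \<gamma> = T"
      using pull[of _ C] C(5) by (metis insertCI)
    show "\<forall>\<gamma>. periodic_trajectory S' (A u) \<gamma> \<and> range \<gamma> \<subseteq> F ` C' \<longrightarrow>
        phi * T \<in> periods \<gamma> \<and> primitive_period \<gamma> = phi * T"
      using pull[of _ C'] C(6) by (metis insertCI)
  qed
qed

lemma phi_gt_1: "phi > 1"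
proof -
  have "sqrt 5 > sqrt 1" by (rule real_sqrt_less_mono) simp
  then show ?thesis by (simp add: phi_def)
qed

text \<open>All trajectories in a cylinder share one period, which settles the definite description
  in \<open>cylinder_holonomy\<close>; then \<open>phi > 1\<close> makes \<open>C\<close> the only
  short and \<open>C'\<close> the only long cylinder.\<close>

lemma two_cylindersD:
  assumes "two_cylinders S u T"
  shows "\<exists>\<gamma>. short_trajectory S u \<gamma>" "\<exists>\<gamma>. long_trajectory S u \<gamma>"
    "short_trajectory S u \<gamma> \<Longrightarrow> T \<in> periods \<gamma> \<and> primitive_period \<gamma> = T"
    "long_trajectory S u \<gamma> \<Longrightarrow> phi * T \<in> periods \<gamma> \<and> primitive_period \<gamma> = phi * T"
    "short_cylinder S u K \<Longrightarrow> cylinder_holonomy S u K = T *\<^sub>R u"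
proof -
  obtain C C' \<gamma>1 \<gamma>2 where C: "T > 0" "cylinders S u = {C, C'}"
    "periodic_trajectory S u \<gamma>1 \<and> range \<gamma>1 \<subseteq> C" "periodic_trajectory S u \<gamma>2 \<and> range \<gamma>2 \<subseteq> C'"
    "\<And>\<gamma>. periodic_trajectory S u \<gamma> \<and> range \<gamma> \<subseteq> C \<Longrightarrow> T \<in> periods \<gamma> \<and> primitive_period \<gamma> = T"
    "\<And>\<gamma>. periodic_trajectory S u \<gamma> \<and> range \<gamma> \<subseteq> C' \<Longrightarrow> phi * T \<in> periods \<gamma> \<and> primitive_period \<gamma> = phi * T"
    using assms unfolding two_cylinders_def by blast
  have u: "u \<noteq> 0"
    using C(3) unfolding periodic_trajectory_def trajectory_def by blast
  have h: "cylinder_holonomy S u C = T *\<^sub>R u"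
    unfolding cylinder_holonomy_def holonomy_def by (rule the_equality) (use C(3,5) in auto)
  have h': "cylinder_holonomy S u C' = (phi * T) *\<^sub>R u"
    unfolding cylinder_holonomy_def holonomy_def by (rule the_equality) (use C(4,6) in auto)
  have lt: "cylinder_length S u C < cylinder_length S u C'"
    unfolding cylinder_length_def h h' using C(1) u phi_gt_1 by (simp add: mult.assoc)
  have short: "short_cylinder S u K \<longleftrightarrow> K = C" for K
    unfolding short_cylinder_def C(2) using lt by auto
  have long: "long_cylinder S u K \<longleftrightarrow> K = C'" for K
    unfolding long_cylinder_def C(2) using lt by auto
  show "\<exists>\<gamma>. short_trajectory S u \<gamma>" "\<exists>\<gamma>. long_trajectory S u \<gamma>"
    unfolding short_trajectory_def long_trajectory_def short long using C(3,4) by blast+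
  show "short_trajectory S u \<gamma> \<Longrightarrow> T \<in> periods \<gamma> \<and> primitive_period \<gamma> = T"
    "long_trajectory S u \<gamma> \<Longrightarrow> phi * T \<in> periods \<gamma> \<and> primitive_period \<gamma> = phi * T"
    unfolding short_trajectory_def long_trajectory_def short long using C(5,6) by blast+
  show "short_cylinder S u K \<Longrightarrow> cylinder_holonomy S u K = T *\<^sub>R u"
    unfolding short using h by simp
qed

text \<open>The piecewise map as a relation: a point has an image for each piece that contains it.
  Well-definedness on the surface becomes a condition on overlaps of pieces.\<close>

definition moved :: "(plane \<Rightarrow> plane) \<Rightarrow> (plane set \<times> plane) set \<Rightarrow> plane \<Rightarrow> plane set" where
  "moved A I p = (\<Union>(R, \<tau>)\<in>I. if p \<in> R then {A p + \<tau>} else {})"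

lemma moved_empty: "moved A {} p = {}"
  and moved_insert: "moved A (insert (R, \<tau>) I) p = (if p \<in> R then insert (A p + \<tau>) (moved A I p) else moved A I p)"
  by (simp_all add: moved_def)

lemma mem_moved_insert:
  "p' \<in> moved A (insert (R, \<tau>) I) p \<longleftrightarrow> p \<in> R \<and> p' = A p + \<tau> \<or> p' \<in> moved A I p"
  by (simp add: moved_insert)

lemma mem_moved: "p' \<in> moved A I p \<longleftrightarrow> (\<exists>R \<tau>. (R, \<tau>) \<in> I \<and> p \<in> R \<and> p' = A p + \<tau>)"
proof
  assume "p' \<in> moved A I p"
  then obtain i where "i \<in> I" "p' \<in> (case i of (R, \<tau>) \<Rightarrow> if p \<in> R then {A p + \<tau>} else {})"
    unfolding moved_def by blast
  then show "\<exists>R \<tau>. (R, \<tau>) \<in> I \<and> p \<in> R \<and> p' = A p + \<tau>"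
    by (intro exI[of _ "fst i"] exI[of _ "snd i"]) (simp add: case_prod_beta split: if_splits)
next
  assume "\<exists>R \<tau>. (R, \<tau>) \<in> I \<and> p \<in> R \<and> p' = A p + \<tau>"
  then obtain R \<tau> where "(R, \<tau>) \<in> I" "p \<in> R" "p' = A p + \<tau>"
    by blast
  then show "p' \<in> moved A I p"
    unfolding moved_def by (intro UN_I[of "(R, \<tau>)"]) simp_all
qed

lemma movedI: "(R, \<tau>) \<in> I \<Longrightarrow> p \<in> R \<Longrightarrow> A p + \<tau> \<in> moved A I p"
  unfolding mem_moved by blast

text \<open>Both conditions on \<open>M\<close> concern single gluing steps instead of chains. They
  make the class of an image independent of the image and unchanged by the pairings, so
  \<open>pt_invariant\<close> applies.\<close>

lemma pt_eq_transfer: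
  fixes M :: "plane \<Rightarrow> plane \<Rightarrow> bool"
  assumes overlap: "\<And>p p' p''. M p p' \<Longrightarrow> M p p'' \<Longrightarrow> pt S' p' = pt S' p''"
    and sides: "\<And>a b w p. (a, b, w) \<in> pairings S \<Longrightarrow> p \<in> closed_segment a b \<Longrightarrow>
      \<exists>p' q'. M p p' \<and> M (p + w) q' \<and> pt S' p' = pt S' q'"
    and "M p p'" "M q q'" "pt S p = pt S q"
  shows "pt S' p' = pt S' q'"
proof -
  define f where "f p = (SOME P. \<exists>p'. M p p' \<and> P = pt S' p')" for p
  have f: "f p = pt S' p'" if "M p p'" for p p'
    unfolding f_def by (rule some_equality) (use that overlap in blast)+
  have "f p = f q"
  proof (rule pt_invariant[OF _ assms(5)])
    fix a b w p assume "(a, b, w) \<in> pairings S" "p \<in> closed_segment a b"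
    from sides[OF this] obtain p' q' where *: "M p p'" "M (p + w) q'" "pt S' p' = pt S' q'"
      by blast
    show "f (p + w) = f p"
      unfolding f[OF *(1)] f[OF *(2)] *(3) ..
  qed
  then show ?thesis
    unfolding f[OF assms(3)] f[OF assms(4)] .
qed

text \<open>The two directions of \<open>pt_iff\<close> are \<open>pt_eq_transfer\<close> for the
  relation and for its converse. With a single class of vertices on each surface, the vertex
  condition is an instance of them.\<close>

lemma affine_equivalenceI:
  assumes "linear A" "linear A'" "\<And>x. A' (A x) = x" "\<And>x. A (A' x) = x" "finite I"
    and "\<And>R \<tau>. (R, \<tau>) \<in> I \<Longrightarrow> compact R" "\<And>R \<tau>. (R, \<tau>) \<in> I \<Longrightarrow> convex R"
    and region: "\<And>p. p \<in> region S \<longleftrightarrow> (\<exists>p'. p' \<in> moved A I p)"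
    and region': "\<And>p'. p' \<in> region S' \<longleftrightarrow> (\<exists>p. p' \<in> moved A I p)"
    and overlap: "\<And>p p' p''. p' \<in> moved A I p \<Longrightarrow> p'' \<in> moved A I p \<Longrightarrow> pt S' p' = pt S' p''"
    and overlap': "\<And>p q p'. p' \<in> moved A I p \<Longrightarrow> p' \<in> moved A I q \<Longrightarrow> pt S p = pt S q"
    and sides: "\<And>a b w p. (a, b, w) \<in> pairings S \<Longrightarrow> p \<in> closed_segment a b \<Longrightarrow>
      \<exists>p' q'. p' \<in> moved A I p \<and> q' \<in> moved A I (p + w) \<and> pt S' p' = pt S' q'"
    and sides': "\<And>a b w p'. (a, b, w) \<in> pairings S' \<Longrightarrow> p' \<in> closed_segment a b \<Longrightarrow>
      \<exists>p q. p' \<in> moved A I p \<and> p' + w \<in> moved A I q \<and> pt S p = pt S q"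
    and vertices: "vertex_points S = {pt S x}" "vertex_points S' = {pt S' x'}" "x' \<in> moved A I x"
  shows "affine_equivalence S S' A A' I"
proof (rule affine_equivalence.intro)
  have trans: "pt S' p' = pt S' q'" if "p' \<in> moved A I p" "q' \<in> moved A I q" "pt S p = pt S q" for p p' q q'
    using overlap sides that by (rule pt_eq_transfer[where M = "\<lambda>p p'. p' \<in> moved A I p"])
  have trans': "pt S p = pt S q" if "p' \<in> moved A I p" "q' \<in> moved A I q" "pt S' p' = pt S' q'" for p p' q q'
    using overlap' sides' that by (rule pt_eq_transfer[where M = "\<lambda>p' p. p' \<in> moved A I p"])
  show iff: "pt S p = pt S q \<longleftrightarrow> pt S' (A p + \<tau>) = pt S' (A q + \<tau>')"
    if R: "(R, \<tau>) \<in> I" "(R', \<tau>') \<in> I" "p \<in> R" "q \<in> R'" for R \<tau> R' \<tau>' p q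
    using trans[OF movedI[OF R(1,3)] movedI[OF R(2,4)]] trans'[OF movedI[OF R(1,3)] movedI[OF R(2,4)]]
    by blast
  have "p \<in> region S \<longleftrightarrow> p \<in> (\<Union>(R, \<tau>)\<in>I. R)" for p
    unfolding region mem_moved by blast
  then show "region S = (\<Union>(R, \<tau>)\<in>I. R)"
    by (rule set_eqI)
  have "p' \<in> region S' \<longleftrightarrow> p' \<in> (\<Union>(R, \<tau>)\<in>I. (\<lambda>p. A p + \<tau>) ` R)" for p'
    unfolding region' mem_moved by blast
  then show "region S' = (\<Union>(R, \<tau>)\<in>I. (\<lambda>p. A p + \<tau>) ` R)"
    by (rule set_eqI)
  show "pt S p \<in> vertex_points S \<longleftrightarrow> pt S' (A p + \<tau>) \<in> vertex_points S'"
    if "(R, \<tau>) \<in> I" "p \<in> R" for R \<tau> p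
    unfolding vertices(1,2)
    using trans[OF movedI[OF that] vertices(3)] trans'[OF movedI[OF that] vertices(3)] by blast
qed (use assms(1-7) in simp_all)

text \<open>The involutions below permute their pieces, so one direction of the compatibility suffices.\<close>

lemma affine_involution:
  assumes "linear A" "\<And>x. A (A x) = x" "finite I"
    and "\<And>R \<tau>. (R, \<tau>) \<in> I \<Longrightarrow> compact R" "\<And>R \<tau>. (R, \<tau>) \<in> I \<Longrightarrow> convex R"
    and region: "region S = (\<Union>(R, \<tau>)\<in>I. R)"
    and inv: "\<And>p p'. p' \<in> moved A I p \<Longrightarrow> p \<in> moved A I p'"
    and overlap: "\<And>p p' p''. p' \<in> moved A I p \<Longrightarrow> p'' \<in> moved A I p \<Longrightarrow> pt S p' = pt S p''"
    and sides: "\<And>a b w p. (a, b, w) \<in> pairings S \<Longrightarrow> p \<in> closed_segment a b \<Longrightarrow>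
      \<exists>p'\<in>moved A I p. \<exists>q'\<in>moved A I (p + w). pt S p' = pt S q'"
    and vertices: "vertex_points S = {pt S x}" "x' \<in> moved A I x" "pt S x' = pt S x"
  shows "affine_equivalence S S A A I"
proof (rule affine_equivalenceI[where x = x and x' = x'])
  show region_iff: "p \<in> region S \<longleftrightarrow> (\<exists>p'. p' \<in> moved A I p)" for p
    unfolding region mem_moved by blast
  show "p' \<in> region S \<longleftrightarrow> (\<exists>p. p' \<in> moved A I p)" for p'
    unfolding region_iff using inv by blast
  show "vertex_points S = {pt S x'}"
    unfolding vertices ..
  show "\<exists>p q. p' \<in> moved A I p \<and> p' + w \<in> moved A I q \<and> pt S p = pt S q"
    if "(a, b, w) \<in> pairings S" "p' \<in> closed_segment a b" for a b w p'
    using sides[OF that] inv by blast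
  show "\<exists>p' q'. p' \<in> moved A I p \<and> q' \<in> moved A I (p + w) \<and> pt S p' = pt S q'"
    if "(a, b, w) \<in> pairings S" "p \<in> closed_segment a b" for a b w p
    using sides[OF that] by blast
  show "pt S p = pt S q" if "p' \<in> moved A I p" "p' \<in> moved A I q" for p q p'
    using overlap[OF inv[OF that(1)] inv[OF that(2)]] .
qed (fact assms)+

section \<open>Counting the crossings of a trajectory with the sides\<close>

text \<open>Subtracting the jumps made so far leaves a locally constant function. By
  \<open>left\<close> the value \<open>h t\<close> precedes the jump at \<open>t\<close>, so a jump
  at \<open>a\<close> counts and a jump at \<open>b\<close> does not.\<close>

lemma sum_of_jumps:
  fixes h :: "real \<Rightarrow> 'a::real_vector"
  assumes ab: "a \<le> b" and K: "finite K" "K \<subseteq> {a..<b}"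
    and left: "\<And>t. t \<in> {a..b} \<Longrightarrow> \<forall>\<^sub>F s in at_right 0. h (t - s) = h t"
    and right: "\<And>t. t \<in> {a..b} \<Longrightarrow> \<forall>\<^sub>F s in at_right 0. h (t + s) = h t + J t"
    and J: "\<And>t. t \<in> {a..<b} - K \<Longrightarrow> J t = 0"
  shows "h b = h a + sum J K"
proof -
  define H where "H t = h t - sum J (K \<inter> {..<t})" for t
  have "H a = H b"
  proof (rule connected_local_const[of "{a..b}"])
    show "\<forall>t\<in>{a..b}. \<forall>\<^sub>F s in at t within {a..b}. H t = H s"
    proof
      fix t assume t: "t \<in> {a..b}"
      have "finite (K - {t})" using K by simp
      \<comment> \<open>Within distance \<open>d\<close> of \<open>t\<close> there is no other jump
        time.\<close>
      then obtain d where d: "d > 0" "\<And>k. k \<in> K - {t} \<Longrightarrow> d \<le> dist t k"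
        using finite_set_avoid[of "K - {t}" t] by auto
      have small: "\<forall>\<^sub>F s in at_right 0. 0 < s \<and> s < d"
        using d(1) by (auto simp: eventually_at_right_0)
      have "\<forall>\<^sub>F s in at_right 0. H t = H (t - s)"
        using left[OF t] small
      proof eventually_elim
        case (elim s)
        then have "K \<inter> {..<t - s} = K \<inter> {..<t}"
          using d(2) by (force simp: dist_real_def)
        with elim show ?case by (simp add: H_def)
      qed
      moreover have "\<forall>\<^sub>F s in at_right 0. t + s \<in> {a..b} \<longrightarrow> H t = H (t + s)"
        using right[OF t] small
      proof eventually_elim
        case (elim s)
        show ?case
        proof
          assume s: "t + s \<in> {a..b}"
          have "K \<inter> {..<t + s} = K \<inter> {..<t} \<union> K \<inter> {t}"
            using d(2) elim by (force simp: dist_real_def)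
          then have "sum J (K \<inter> {..<t + s}) = sum J (K \<inter> {..<t}) + sum J (K \<inter> {t})"
            using K(1) by (simp only:) (subst sum.union_disjoint; auto)
          moreover have "sum J (K \<inter> {t}) = J t"
            using J[of t] s t elim by (cases "t \<in> K") auto
          ultimately show "H t = H (t + s)"
            using elim by (simp add: H_def)
        qed
      qed
      ultimately have "\<forall>\<^sub>F s in at t. s \<in> {a..b} \<longrightarrow> H t = H s"
        unfolding eventually_at_split_real by (auto elim: eventually_mono)
      then show "\<forall>\<^sub>F s in at t within {a..b}. H t = H s"
        unfolding eventually_at_filter by eventually_elim simp
    qed
  qed (use ab in auto)
  moreover have "K \<inter> {..<a} = {}" "K \<inter> {..<b} = K"
    using K(2) by auto
  ultimately show ?thesis
    by (simp add: H_def algebra_simps)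
qed

text \<open>By \<open>convex_germ\<close>, a ray that does not leave a side at once runs along it,
  which forces \<open>u\<close> to be parallel to the side; \<open>par\<close> deals with such
  sides. Both sides of each pair must be avoided, because \<open>side_points\<close> consists of
  classes.\<close>

lemma eventually_off_sides:
  assumes fin: "finite (pairings S)" and u: "u \<noteq> 0"
    and par: "\<And>a b w. (a, b, w) \<in> pairings S \<Longrightarrow>
      (\<exists>c. u = c *\<^sub>R (b - a)) \<Longrightarrow> \<forall>\<^sub>F s in at_right 0. pt S (q + s *\<^sub>R u) \<notin> pt S ` closed_segment a b"
  shows "\<forall>\<^sub>F s in at_right 0. pt S (q + s *\<^sub>R u) \<notin> side_points S"
proof -
  have seg: "\<forall>\<^sub>F s in at_right 0. q + s *\<^sub>R u \<notin> closed_segment a' b'"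
    if ab: "(a, b, w) \<in> pairings S" and ab': "b' - a' = b - a"
      and gl: "\<And>p. p \<in> closed_segment a' b' \<Longrightarrow> pt S p \<in> pt S ` closed_segment a b" for a b w a' b'
  proof (rule ccontr)
    assume "\<not> ?thesis"
    then have in_seg: "\<forall>\<^sub>F s in at_right 0. q + s *\<^sub>R u \<in> closed_segment a' b'"
      using convex_germ[OF convex_closed_segment, of q u a' b'] by auto
    then obtain e where e: "e > 0" "\<And>s. 0 < s \<Longrightarrow> s < e \<Longrightarrow> q + s *\<^sub>R u \<in> closed_segment a' b'"
      by (auto simp: eventually_at_right_0)
    \<comment> \<open>Two points of the ray lie on the segment; their difference is a multiple of
      \<open>u\<close> and also of the side vector.\<close>
    obtain x where x: "q + (e / 2) *\<^sub>R u = (1 - x) *\<^sub>R a' + x *\<^sub>R b'"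
      using e(2)[of "e / 2"] e(1) unfolding in_segment by auto
    obtain y where y: "q + (e / 4) *\<^sub>R u = (1 - y) *\<^sub>R a' + y *\<^sub>R b'"
      using e(2)[of "e / 4"] e(1) unfolding in_segment by auto
    have "(e / 4) *\<^sub>R u = (q + (e / 2) *\<^sub>R u) - (q + (e / 4) *\<^sub>R u)"
      by (simp flip: scaleR_diff_left)
    also have "\<dots> = (x - y) *\<^sub>R (b' - a')"
      unfolding x y by (simp add: algebra_simps)
    finally have "(4 / e) *\<^sub>R ((e / 4) *\<^sub>R u) = (4 / e) *\<^sub>R ((x - y) *\<^sub>R (b - a))"
      unfolding ab' by simp
    then have "u = (4 / e * (x - y)) *\<^sub>R (b - a)"
      using e(1) by simp
    then have "\<forall>\<^sub>F s in at_right 0. pt S (q + s *\<^sub>R u) \<notin> pt S ` closed_segment a b"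
      using par[OF ab] by blast
    with in_seg have "\<forall>\<^sub>F s in at_right (0::real). False"
      by eventually_elim (use gl in blast)
    then show False by simp
  qed
  have "\<forall>\<^sub>F s in at_right 0. \<forall>i\<in>pairings S. case i of (a, b, w) \<Rightarrow>
      q + s *\<^sub>R u \<notin> closed_segment a b \<and> q + s *\<^sub>R u - w \<notin> closed_segment a b"
  proof (rule eventually_ball_finite[OF fin], rule ballI)
    fix i assume i: "i \<in> pairings S"
    obtain a b w where abw: "i = (a, b, w)"
      using prod_cases3 by blast
    have "\<forall>\<^sub>F s in at_right 0. q + s *\<^sub>R u \<notin> closed_segment a b"
      using i unfolding abw by (intro seg[of a b w]) auto
    moreover have "\<forall>\<^sub>F s in at_right 0. q + s *\<^sub>R u \<notin> closed_segment (w + a) (w + b)"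
    proof (rule seg)
      show "(a, b, w) \<in> pairings S" using i abw by simp
      fix p assume "p \<in> closed_segment (w + a) (w + b)"
      then obtain p' where "p' \<in> closed_segment a b" "p = w + p'"
        unfolding closed_segment_translation_eq[symmetric]
        by (metis closed_segment_translation imageE)
      then show "pt S p \<in> pt S ` closed_segment a b"
        using pt_glue[of a b w S p'] i abw by (auto simp: add.commute)
    qed simp
    then have "\<forall>\<^sub>F s in at_right 0. q + s *\<^sub>R u - w \<notin> closed_segment a b"
    proof eventually_elim
      case (elim s)
      then show ?case
        using closed_segment_translation_eq[of w "q + s *\<^sub>R u - w" a b] by simp
    qed
    ultimately show "\<forall>\<^sub>F s in at_right 0. case i of (a, b, w) \<Rightarrow>
        q + s *\<^sub>R u \<notin> closed_segment a b \<and> q + s *\<^sub>R u - w \<notin> closed_segment a b"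
      unfolding abw by (simp add: eventually_conj_iff)
  qed
  then show ?thesis
    by eventually_elim (auto elim!: pt_mem_side_points)
qed

text \<open>A function that grows at rate \<open>c\<close> along the flow returns to its initial
  value after a period, so its growth is undone by the jumps from the arriving representative
  \<open>p t\<close> to the departing one \<open>q t\<close>. As \<open>g\<close> is constrained
  only along segments inside the region, it may be chosen separately on each component of the
  region.\<close>

lemma crossing_sum:
  fixes g :: "plane \<Rightarrow> 'a::real_vector"
  assumes \<gamma>: "trajectory S u \<gamma>" and T: "T \<in> periods \<gamma>" and fin: "finite (pairings S)"
    and par: "\<And>a b w t. (a, b, w) \<in> pairings S \<Longrightarrow> (\<exists>c. u = c *\<^sub>R (b - a)) \<Longrightarrow>
      \<gamma> t \<notin> pt S ` closed_segment a b"
    and g: "\<And>x s. 0 < s \<Longrightarrow> (\<And>r. 0 \<le> r \<Longrightarrow> r \<le> s \<Longrightarrow> x + r *\<^sub>R u \<in> region S) \<Longrightarrow>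
      g (x + s *\<^sub>R u) = g x + s *\<^sub>R c"
  obtains p q where "\<forall>t. pt S (p t) = \<gamma> t \<and> pt S (q t) = \<gamma> t \<and> p t \<in> region S \<and> q t \<in> region S \<and>
      (\<forall>\<^sub>F s in at_right 0. p t - s *\<^sub>R u \<in> region S) \<and> (\<forall>\<^sub>F s in at_right 0. q t + s *\<^sub>R u \<in> region S)"
    "finite {t \<in> {0..<T}. \<gamma> t \<in> side_points S}"
    "T *\<^sub>R c = (\<Sum>t | t \<in> {0..<T} \<and> \<gamma> t \<in> side_points S. g (p t) - g (q t))"
proof -
  define In where "In t p \<longleftrightarrow> pt S p = \<gamma> t \<and> p \<in> region S \<and>
    (\<forall>\<^sub>F s in at_right 0. p - s *\<^sub>R u \<in> region S \<and> \<gamma> (t - s) = pt S (p - s *\<^sub>R u))" for t p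
  define Out where "Out t p \<longleftrightarrow> pt S p = \<gamma> t \<and> p \<in> region S \<and>
    (\<forall>\<^sub>F s in at_right 0. p + s *\<^sub>R u \<in> region S \<and> \<gamma> (t + s) = pt S (p + s *\<^sub>R u))" for t p
  have ex: "(\<exists>p. In t p) \<and> (\<exists>q. Out t q)" for t
  proof -
    obtain p q where "\<gamma> t = pt S p" "\<gamma> t = pt S q" "p \<in> region S" "q \<in> region S"
      "\<forall>\<^sub>F s in at_right 0. p - s *\<^sub>R u \<in> region S \<and> \<gamma> (t - s) = pt S (p - s *\<^sub>R u)"
      "\<forall>\<^sub>F s in at_right 0. q + s *\<^sub>R u \<in> region S \<and> \<gamma> (t + s) = pt S (q + s *\<^sub>R u)"
      by (rule trajectoryD[OF \<gamma>])
    then have "In t p" "Out t q"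
      by (simp_all add: In_def Out_def)
    then show ?thesis by blast
  qed
  define p where "p t = (SOME p. In t p)" for t
  define q where "q t = (SOME q. Out t q)" for t
  have In: "In t (p t)" and Out: "Out t (q t)" for t
    unfolding p_def q_def using ex[of t] by (blast intro: someI_ex)+
  have T0: "T > 0" and per: "\<gamma> (t + T) = \<gamma> t" for t
    using T by (auto simp: periods_def)
  \<comment> \<open>Periodicity makes the two predicates equal, so the choice in \<open>p\<close>
    returns the same point at times 0 and \<open>T\<close>.\<close>
  have "In T = In 0"
    using per[of 0] per[of "- s" for s] by (simp add: In_def[abs_def])
  then have pT: "p T = p 0"
    by (simp add: p_def)
  have u: "u \<noteq> 0"
    using \<gamma> by (simp add: trajectory_def)
  have off_left: "\<forall>\<^sub>F s in at_right 0. \<gamma> (t - s) = pt S (p t - s *\<^sub>R u) \<and> \<gamma> (t - s) \<notin> side_points S" for t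
  proof -
    have 1: "\<forall>\<^sub>F s in at_right 0. \<gamma> (t - s) = pt S (p t - s *\<^sub>R u)"
      using In[of t] unfolding In_def by (auto elim: eventually_mono)
    have "\<forall>\<^sub>F s in at_right 0. pt S (p t + s *\<^sub>R (- u)) \<notin> side_points S"
    proof (rule eventually_off_sides[OF fin])
      fix a b w assume ab: "(a, b, w) \<in> pairings S" "\<exists>c. - u = c *\<^sub>R (b - a)"
      then obtain c where "- u = c *\<^sub>R (b - a)" by blast
      then have "u = (- c) *\<^sub>R (b - a)"
        by (metis minus_equation_iff scaleR_minus_left)
      then have "\<gamma> t \<notin> pt S ` closed_segment a b" for t
        using par[OF ab(1)] by blast
      then show "\<forall>\<^sub>F s in at_right 0. pt S (p t + s *\<^sub>R - u) \<notin> pt S ` closed_segment a b"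
        using 1 by (auto elim!: eventually_mono)
    qed (use u in simp)
    with 1 show ?thesis
      by eventually_elim auto
  qed
  have off_right: "\<forall>\<^sub>F s in at_right 0. \<gamma> (t + s) = pt S (q t + s *\<^sub>R u) \<and> \<gamma> (t + s) \<notin> side_points S" for t
  proof -
    have 1: "\<forall>\<^sub>F s in at_right 0. \<gamma> (t + s) = pt S (q t + s *\<^sub>R u)"
      using Out[of t] unfolding Out_def by (auto elim: eventually_mono)
    have "\<forall>\<^sub>F s in at_right 0. pt S (q t + s *\<^sub>R u) \<notin> side_points S"
    proof (rule eventually_off_sides[OF fin])
      fix a b w assume ab: "(a, b, w) \<in> pairings S" "\<exists>c. u = c *\<^sub>R (b - a)"
      then have "\<gamma> t \<notin> pt S ` closed_segment a b" for t
        using par by blast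
      then show "\<forall>\<^sub>F s in at_right 0. pt S (q t + s *\<^sub>R u) \<notin> pt S ` closed_segment a b"
        using 1 by (auto elim!: eventually_mono)
    qed (use u in simp)
    with 1 show ?thesis
      by eventually_elim simp
  qed
  \<comment> \<open>Off the sides a class has one element, so the arriving and the departing
    representative coincide.\<close>
  have single: "p t = x \<and> q t = x" if "\<gamma> t \<notin> side_points S" "\<gamma> t = pt S x" for t x
  proof -
    have "p t \<in> pt S x" "q t \<in> pt S x"
      using In[of t] Out[of t] that(2) unfolding In_def Out_def mem_pt_iff by simp_all
    then show ?thesis
      using pt_not_side_point[of S x] that by simp
  qed
  have p_left: "\<forall>\<^sub>F s in at_right 0. p (t - s) = p t - s *\<^sub>R u" for t
    using off_left[of t] by eventually_elim (use single in blast)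
  have p_right: "\<forall>\<^sub>F s in at_right 0. p (t + s) = q t + s *\<^sub>R u" for t
    using off_right[of t] by eventually_elim (use single in blast)
  have reg_left: "\<exists>\<epsilon>>0. \<forall>s\<in>{0..\<epsilon>}. p t - s *\<^sub>R u \<in> region S" for t
    using In[of t] unfolding In_def by (subst eventually_at_right_closed[symmetric]) (auto elim: eventually_mono)
  have reg_right: "\<exists>\<epsilon>>0. \<forall>s\<in>{0..\<epsilon>}. q t + s *\<^sub>R u \<in> region S" for t
    using Out[of t] unfolding Out_def by (subst eventually_at_right_closed[symmetric]) (auto elim: eventually_mono)
  let ?K = "{t. t \<in> {0..<T} \<and> \<gamma> t \<in> side_points S}"
  \<comment> \<open>Crossing times do not accumulate, because both germs at any time avoid the
    sides.\<close>
  have finK: "finite ?K"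
  proof -
    have "finite ({0..T} \<inter> {t. \<gamma> t \<in> side_points S})"
    proof (rule finite_not_islimpt_in_compact)
      fix t
      have "\<forall>\<^sub>F s in at_right 0. \<gamma> (t - s) \<notin> side_points S"
        using off_left[of t] by eventually_elim (rule conjunct2)
      moreover have "\<forall>\<^sub>F s in at_right 0. \<gamma> (t + s) \<notin> side_points S"
        using off_right[of t] by eventually_elim (rule conjunct2)
      ultimately have "\<forall>\<^sub>F s in at t. s \<notin> {t. \<gamma> t \<in> side_points S}"
        unfolding eventually_at_split_real by simp
      then show "\<not> t islimpt {t. \<gamma> t \<in> side_points S}"
        by (simp add: islimpt_iff_eventually)
    qed simp
    then show ?thesis
      by (rule rev_finite_subset) auto
  qed
  \<comment> \<open>Between crossings \<open>g (p t)\<close> grows at rate \<open>c\<close>, so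
    \<open>h\<close> changes by jumps only.\<close>
  define h where "h t = g (p t) - t *\<^sub>R c" for t
  have "h T = h 0 + (\<Sum>t\<in>?K. g (q t) - g (p t))"
  proof (rule sum_of_jumps)
    fix t
    obtain \<epsilon> where \<epsilon>: "\<epsilon> > 0" "\<And>s. s \<in> {0..\<epsilon>} \<Longrightarrow> p t - s *\<^sub>R u \<in> region S"
      using reg_left[of t] by blast
    have "\<forall>\<^sub>F s in at_right 0. 0 < s \<and> s < \<epsilon>"
      using \<epsilon>(1) by (auto simp: eventually_at_right_0)
    with p_left[of t] show "\<forall>\<^sub>F s in at_right 0. h (t - s) = h t"
    proof eventually_elim
      case (elim s)
      have "g (p t - s *\<^sub>R u + s *\<^sub>R u) = g (p t - s *\<^sub>R u) + s *\<^sub>R c"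
      proof (rule g)
        fix r assume "0 \<le> r" "r \<le> s"
        then have "p t - (s - r) *\<^sub>R u \<in> region S"
          using elim by (intro \<epsilon>(2)) auto
        then show "p t - s *\<^sub>R u + r *\<^sub>R u \<in> region S"
          by (simp add: algebra_simps)
      qed (use elim in simp)
      then have "g (p (t - s)) = g (p t) - s *\<^sub>R c"
        unfolding elim(1) by simp
      then show ?case
        by (simp add: h_def algebra_simps)
    qed
    obtain \<epsilon> where \<epsilon>: "\<epsilon> > 0" "\<And>s. s \<in> {0..\<epsilon>} \<Longrightarrow> q t + s *\<^sub>R u \<in> region S"
      using reg_right[of t] by blast
    have "\<forall>\<^sub>F s in at_right 0. 0 < s \<and> s < \<epsilon>"
      using \<epsilon>(1) by (auto simp: eventually_at_right_0)
    with p_right[of t] show "\<forall>\<^sub>F s in at_right 0. h (t + s) = h t + (g (q t) - g (p t))"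
    proof eventually_elim
      case (elim s)
      have "g (q t + s *\<^sub>R u) = g (q t) + s *\<^sub>R c"
        using elim \<epsilon>(2) by (intro g) auto
      then have "g (p (t + s)) = g (q t) + s *\<^sub>R c"
        unfolding elim(1) .
      then show ?case
        by (simp add: h_def algebra_simps)
    qed
  next
    fix t assume "t \<in> {0..<T} - ?K"
    then have "\<gamma> t \<notin> side_points S"
      by simp
    moreover have "\<gamma> t = pt S (p t)"
      using In[of t] unfolding In_def by (metis (no_types))
    ultimately have "p t = q t"
      using single[of t "p t"] by metis
    then show "g (q t) - g (p t) = 0" by simp
  qed (use T0 finK in auto)
  then have "T *\<^sub>R c = - (\<Sum>t\<in>?K. g (q t) - g (p t))"
    by (simp add: h_def pT minus_equation_iff[of "T *\<^sub>R c"] equation_minus_iff[of "T *\<^sub>R c"])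
  also have "\<dots> = (\<Sum>t\<in>?K. g (p t) - g (q t))"
    by (simp flip: sum_negf)
  finally have sum: "T *\<^sub>R c = (\<Sum>t\<in>?K. g (p t) - g (q t))" .
  have eL: "\<forall>\<^sub>F s in at_right 0. p t - s *\<^sub>R u \<in> region S" for t
    using In[of t] unfolding In_def by (auto elim: eventually_mono)
  have eR: "\<forall>\<^sub>F s in at_right 0. q t + s *\<^sub>R u \<in> region S" for t
    using Out[of t] unfolding Out_def by (auto elim: eventually_mono)
  show thesis
    by (rule that[of p q, OF _ finK sum]) (use In Out eL eR in \<open>simp add: In_def Out_def\<close>)
qed

section \<open>The golden L\<close>

lemma phi_sq: "phi * phi = phi + 1"
  by (simp add: phi_def field_simps)

text \<open>It gives \<open>2 - phi > 1 / 3\<close>, which fixes the decrease per step of the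
  Euclidean algorithm.\<close>

lemma phi_lt: "phi < 5 / 3"
proof -
  have "sqrt 5 < 7 / 3"
    by (rule real_less_lsqrt) (simp_all add: power2_eq_square)
  then show ?thesis by (simp add: phi_def)
qed

abbreviation pt_L :: "plane \<Rightarrow> plane set" where "pt_L \<equiv> pt golden_L"
abbreviation pt_D :: "plane \<Rightarrow> plane set" where "pt_D \<equiv> pt double_pentagon"

lemma closed_segment_vertical:
  "a \<le> b \<Longrightarrow> (x, y) \<in> closed_segment (c, a) (c, b) \<longleftrightarrow> x = c \<and> a \<le> y \<and> y \<le> (b::real)"
  using closed_segment_eq_real_ivl[of a b] by (auto simp: in_segment algebra_simps)

lemma closed_segment_horizontal:
  "a \<le> b \<Longrightarrow> (x, y) \<in> closed_segment (a, c) (b, c) \<longleftrightarrow> y = c \<and> a \<le> x \<and> x \<le> (b::real)"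
  using closed_segment_eq_real_ivl[of a b] by (auto simp: in_segment algebra_simps)

lemma region_L: "(x, y) \<in> region golden_L \<longleftrightarrow> 0 \<le> x \<and> 0 \<le> y \<and> (x \<le> phi \<and> y \<le> 1 \<or> x \<le> 1 \<and> y \<le> phi)"
  by (auto simp: golden_L_def)

lemma pairings_L: "pairings golden_L = {((phi, 0), (phi, 1), (- phi, 0)), ((1, 1), (1, phi), (- 1, 0)),
    ((1, 1), (phi, 1), (0, - 1)), ((0, phi), (1, phi), (0, - phi))}"
  by (simp add: golden_L_def)

lemma side_L_cases:
  assumes "(a, b, w) \<in> pairings golden_L" "p \<in> closed_segment a b"
  obtains (right) y where "p = (phi, y)" "0 \<le> y" "y \<le> 1" "w = (- phi, 0)"
  | (upper_right) y where "p = (1, y)" "1 \<le> y" "y \<le> phi" "w = (- 1, 0)"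
  | (right_top) x where "p = (x, 1)" "1 \<le> x" "x \<le> phi" "w = (0, - 1)"
  | (top) x where "p = (x, phi)" "0 \<le> x" "x \<le> 1" "w = (0, - phi)"
  using assms phi_gt_1 by (cases p) (auto simp: pairings_L closed_segment_vertical closed_segment_horizontal)

lemma glue_L:
  "0 \<le> y \<Longrightarrow> y \<le> 1 \<Longrightarrow> pt_L (phi, y) = pt_L (0, y)"
  "1 \<le> y \<Longrightarrow> y \<le> phi \<Longrightarrow> pt_L (1, y) = pt_L (0, y)"
  "1 \<le> x \<Longrightarrow> x \<le> phi \<Longrightarrow> pt_L (x, 1) = pt_L (x, 0)"
  "0 \<le> x \<Longrightarrow> x \<le> 1 \<Longrightarrow> pt_L (x, phi) = pt_L (x, 0)"
  using pt_glue[of "(phi, 0)" "(phi, 1)" "(- phi, 0)" golden_L "(phi, y)"]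
    pt_glue[of "(1, 1)" "(1, phi)" "(- 1, 0)" golden_L "(1, y)"]
    pt_glue[of "(1, 1)" "(phi, 1)" "(0, - 1)" golden_L "(x, 1)"]
    pt_glue[of "(0, phi)" "(1, phi)" "(0, - phi)" golden_L "(x, phi)"] phi_gt_1
  by (simp_all add: pairings_L closed_segment_vertical closed_segment_horizontal)

lemma glue_L_vertices:
  "pt_L (1, 0) = pt_L (0, 0)" "pt_L (phi, 0) = pt_L (0, 0)"
  "pt_L (0, 1) = pt_L (0, 0)" "pt_L (1, 1) = pt_L (0, 0)"
  "pt_L (phi, 1) = pt_L (0, 0)" "pt_L (0, phi) = pt_L (0, 0)"
  "pt_L (1, phi) = pt_L (0, 0)"
  using glue_L(1)[of 0] glue_L(1)[of 1] glue_L(2)[of 1] glue_L(2)[of phi] glue_L(3)[of 1] glue_L(3)[of phi]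
    glue_L(4)[of 0] glue_L(4)[of 1] phi_gt_1 by simp_all

lemma vertex_points_L: "vertex_points golden_L = {pt_L (0, 0)}"
  unfolding vertex_points_def pairings_L by (auto simp: glue_L_vertices)

lemma lift_pt_L:
  assumes "\<And>y. 0 \<le> y \<Longrightarrow> y \<le> 1 \<Longrightarrow> f (0, y) = f (phi, y)" "\<And>y. 1 \<le> y \<Longrightarrow> y \<le> phi \<Longrightarrow> f (0, y) = f (1, y)"
    "\<And>x. 1 \<le> x \<Longrightarrow> x \<le> phi \<Longrightarrow> f (x, 0) = f (x, 1)" "\<And>x. 0 \<le> x \<Longrightarrow> x \<le> 1 \<Longrightarrow> f (x, 0) = f (x, phi)"
  shows "lift_pt f (pt_L p) = f p"
proof (rule lift_pt)
  fix a b w p assume "(a, b, w) \<in> pairings golden_L" "p \<in> closed_segment a b"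
  then show "f (p + w) = f p"
    by (cases rule: side_L_cases) (use assms in simp_all)
qed

lemma affine_involution_L:
  assumes "linear A" "\<And>x. A (A x) = x" "finite I"
    and "\<And>R \<tau>. (R, \<tau>) \<in> I \<Longrightarrow> compact R" "\<And>R \<tau>. (R, \<tau>) \<in> I \<Longrightarrow> convex R"
    and "region golden_L = (\<Union>(R, \<tau>)\<in>I. R)"
    and "\<And>p p'. p' \<in> moved A I p \<Longrightarrow> p \<in> moved A I p'"
    and "\<And>p p' p''. p' \<in> moved A I p \<Longrightarrow> p'' \<in> moved A I p \<Longrightarrow> pt_L p' = pt_L p''"
    and "\<And>y. 0 \<le> y \<Longrightarrow> y \<le> 1 \<Longrightarrow>
      \<exists>p'\<in>moved A I (phi, y). \<exists>q'\<in>moved A I (0, y). pt_L p' = pt_L q'"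
    and "\<And>y. 1 \<le> y \<Longrightarrow> y \<le> phi \<Longrightarrow>
      \<exists>p'\<in>moved A I (1, y). \<exists>q'\<in>moved A I (0, y). pt_L p' = pt_L q'"
    and "\<And>x. 1 \<le> x \<Longrightarrow> x \<le> phi \<Longrightarrow>
      \<exists>p'\<in>moved A I (x, 1). \<exists>q'\<in>moved A I (x, 0). pt_L p' = pt_L q'"
    and "\<And>x. 0 \<le> x \<Longrightarrow> x \<le> 1 \<Longrightarrow>
      \<exists>p'\<in>moved A I (x, phi). \<exists>q'\<in>moved A I (x, 0). pt_L p' = pt_L q'"
    and "\<exists>x'\<in>moved A I (0, 0). pt_L x' = pt_L (0, 0)"
  shows "affine_equivalence golden_L golden_L A A I"
proof -
  have sides: "\<exists>p'\<in>moved A I p. \<exists>q'\<in>moved A I (p + w). pt_L p' = pt_L q'"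
    if "(a, b, w) \<in> pairings golden_L" "p \<in> closed_segment a b" for a b w p
    using that by (cases rule: side_L_cases) (simp_all add: assms(9-12) del: bex_simps)
  obtain x' where "x' \<in> moved A I (0, 0)" "pt_L x' = pt_L (0, 0)"
    using assms(13) by blast
  with assms(1-8) sides vertex_points_L show ?thesis
    by (rule affine_involution)
qed

section \<open>Three affine involutions of the golden L\<close>

definition swap_map :: "plane \<Rightarrow> plane" where "swap_map p = (snd p, fst p)"
definition reflect_map :: "plane \<Rightarrow> plane" where "reflect_map p = (- fst p, snd p)"
text \<open>Preceded by \<open>(x, y) \<mapsto> (x, - y)\<close>, this is the shear
  \<open>(x, y) \<mapsto> (x - phi * y, y)\<close>. The added reflection turns the shear into an
  involution, for which the one-sided criterion is available.\<close>

definition twist_map :: "plane \<Rightarrow> plane" where "twist_map p = (fst p + phi * snd p, - snd p)"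

lemma compact_convex_box:
  "compact ({a..b} \<times> {c..d} :: plane set)" "convex ({a..b} \<times> {c..d} :: plane set)"
  by (auto intro: compact_Times convex_Times)

lemma region_L_boxes: "region golden_L = {0..phi} \<times> {0..1} \<union> {0..1} \<times> {0..phi}"
  by (simp add: golden_L_def)

lemma swap_L: "affine_equivalence golden_L golden_L swap_map swap_map
    {({0..phi} \<times> {0..1}, 0), ({0..1} \<times> {0..phi}, 0)}" (is "affine_equivalence _ _ _ _ ?I")
proof (rule affine_involution_L)
  show "linear swap_map"
    by (rule linearI) (simp_all add: swap_map_def)
  show "compact R" "convex R" if "(R, \<tau>) \<in> ?I" for R \<tau>
    using that compact_convex_box by auto
  show "region golden_L = (\<Union>(R, \<tau>)\<in>?I. R)"
    by (simp add: region_L_boxes)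
qed (use phi_gt_1 in \<open>auto simp: swap_map_def zero_prod_def moved_empty moved_insert glue_L
      split: if_splits del: equalityI\<close>)

text \<open>The two rectangles are the vertical cylinders. Each is reflected in its own vertical
  axis, whence the offsets 1 and \<open>1 + phi\<close>.\<close>

lemma reflect_L: "affine_equivalence golden_L golden_L reflect_map reflect_map
    {({0..1} \<times> {0..phi}, (1, 0)), ({1..phi} \<times> {0..1}, (1 + phi, 0))}" (is "affine_equivalence _ _ _ _ ?I")
proof (rule affine_involution_L)
  show "linear reflect_map"
    by (rule linearI) (simp_all add: reflect_map_def algebra_simps)
  show "compact R" "convex R" if "(R, \<tau>) \<in> ?I" for R \<tau>
    using that compact_convex_box by auto
  show "region golden_L = (\<Union>(R, \<tau>)\<in>?I. R)"
    using phi_gt_1 by (auto simp: region_L_boxes)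
qed (use phi_gt_1 in \<open>auto simp: reflect_map_def zero_prod_def moved_empty moved_insert
      glue_L glue_L_vertices split: if_splits del: equalityI\<close>)

text \<open>Each horizontal cylinder is turned upside down and sheared by exactly one full twist:
  its height times \<open>phi\<close> is its circumference, as \<open>phi * 1 = phi\<close> and
  \<open>phi * (phi - 1) = 1\<close>. It is cut where the sheared abscissa reaches the
  circumference, and the part beyond is moved back by that length.\<close>

definition twist_pieces :: "(plane set \<times> plane) set" where
  "twist_pieces =
    {({0..phi} \<times> {0..1} \<inter> {(x, y). x + phi * y \<le> phi}, (0, 1)),
     ({0..phi} \<times> {0..1} \<inter> {(x, y). phi \<le> x + phi * y}, (- phi, 1)),
     ({0..1} \<times> {1..phi} \<inter> {(x, y). x + phi * y \<le> 1 + phi}, (- phi, 1 + phi)),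
     ({0..1} \<times> {1..phi} \<inter> {(x, y). 1 + phi \<le> x + phi * y}, (- phi - 1, 1 + phi))}"

lemma halfspaces:
  "closed {(x, y). a * x + b * y \<le> (c::real)}" "convex {(x, y). a * x + b * y \<le> (c::real)}"
  "closed {(x, y). (c::real) \<le> a * x + b * y}" "convex {(x, y). (c::real) \<le> a * x + b * y}"
  using closed_halfspace_le[where a = "(a, b)" and b = c] convex_halfspace_le[where a = "(a, b)" and b = c]
    closed_halfspace_ge[where a = "(a, b)" and b = c] convex_halfspace_ge[where a = "(a, b)" and b = c]
  by (simp_all add: inner_prod_def case_prod_unfold)

lemma moved_twist: "q \<in> moved twist_map twist_pieces (x, y) \<longleftrightarrow>
    0 \<le> x \<and> x \<le> phi \<and> 0 \<le> y \<and> y \<le> 1 \<and> x + phi * y \<le> phi \<and> q = (x + phi * y, 1 - y) \<or>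
    0 \<le> x \<and> x \<le> phi \<and> 0 \<le> y \<and> y \<le> 1 \<and> phi \<le> x + phi * y \<and> q = (x + phi * y - phi, 1 - y) \<or>
    0 \<le> x \<and> x \<le> 1 \<and> 1 \<le> y \<and> y \<le> phi \<and> x + phi * y \<le> 1 + phi \<and> q = (x + phi * y - phi, 1 + phi - y) \<or>
    0 \<le> x \<and> x \<le> 1 \<and> 1 \<le> y \<and> y \<le> phi \<and> 1 + phi \<le> x + phi * y \<and>
      q = (x + phi * y - phi - 1, 1 + phi - y)"
proof -
  have "q \<in> moved twist_map twist_pieces (x, y) \<longleftrightarrow>
    (0 \<le> x \<and> x \<le> phi \<and> 0 \<le> y \<and> y \<le> 1 \<and> x + phi * y \<le> phi) \<and> q = twist_map (x, y) + (0, 1) \<or>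
    (0 \<le> x \<and> x \<le> phi \<and> 0 \<le> y \<and> y \<le> 1 \<and> phi \<le> x + phi * y) \<and> q = twist_map (x, y) + (- phi, 1) \<or>
    (0 \<le> x \<and> x \<le> 1 \<and> 1 \<le> y \<and> y \<le> phi \<and> x + phi * y \<le> 1 + phi) \<and> q = twist_map (x, y) + (- phi, 1 + phi) \<or>
    (0 \<le> x \<and> x \<le> 1 \<and> 1 \<le> y \<and> y \<le> phi \<and> 1 + phi \<le> x + phi * y) \<and>
      q = twist_map (x, y) + (- phi - 1, 1 + phi)"
    by (simp add: twist_pieces_def mem_moved_insert moved_empty conj_assoc)
  then show ?thesis
    by (simp add: twist_map_def algebra_simps)
qed

lemma twist_L: "affine_equivalence golden_L golden_L twist_map twist_map twist_pieces"
proof (rule affine_involution_L)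
  show "linear twist_map"
    by (rule linearI) (simp_all add: twist_map_def algebra_simps)
  show "twist_map (twist_map x) = x" for x
    by (simp add: twist_map_def)
  show "finite twist_pieces"
    by (simp add: twist_pieces_def)
  show "compact R" "convex R" if "(R, \<tau>) \<in> twist_pieces" for R \<tau>
    using that compact_convex_box halfspaces[where a = 1 and b = phi]
    by (auto simp: twist_pieces_def intro!: convex_Int compact_Int_closed)
  show "region golden_L = (\<Union>(R, \<tau>)\<in>twist_pieces. R)"
    using phi_gt_1 by (auto simp: region_L_boxes twist_pieces_def)
  show "p \<in> moved twist_map twist_pieces p'" if "p' \<in> moved twist_map twist_pieces p" for p p'
  proof -
    obtain x y X Y where xy: "p = (x, y)" "p' = (X, Y)" by fastforce
    \<comment> \<open>With these bounds for the product \<open>phi * y\<close>, the remaining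
      conditions are linear.\<close>
    have mono: "0 \<le> y \<Longrightarrow> 0 \<le> phi * y" "y \<le> 1 \<Longrightarrow> phi * y \<le> phi" "1 \<le> y \<Longrightarrow> phi \<le> phi * y"
      "y \<le> phi \<Longrightarrow> phi * y \<le> phi + 1"
      using phi_gt_1 phi_sq mult_left_mono[of y phi phi] by auto
    then have mono': "x \<le> phi \<Longrightarrow> y \<le> 1 \<Longrightarrow> x + phi * y \<le> phi * 2" "0 \<le> x \<Longrightarrow> 1 \<le> y \<Longrightarrow> phi \<le> x + phi * y"
      by auto
    show ?thesis
      using that unfolding xy moved_twist
      by (elim disjE conjE Pair_inject; hypsubst; insert mono mono' phi_gt_1 phi_sq; simp add: algebra_simps)
  qed
next
  fix p p' p''
  assume p: "p' \<in> moved twist_map twist_pieces p" "p'' \<in> moved twist_map twist_pieces p"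
  obtain x y where xy: "p = (x, y)" by fastforce
  \<comment> \<open>Pieces of the same cylinder meet on the cutting line, where their images are
    glued left to right. Pieces of different cylinders meet on \<open>y = 1\<close>, which goes to
    the bottom \<open>y = 0\<close> from below and to the top \<open>y = phi\<close> from
    above.\<close>
  let ?T1 = "0 \<le> x \<and> x \<le> phi \<and> 0 \<le> y \<and> y \<le> 1 \<and> x + phi * y \<le> phi"
  let ?T2 = "0 \<le> x \<and> x \<le> phi \<and> 0 \<le> y \<and> y \<le> 1 \<and> phi \<le> x + phi * y"
  let ?T3 = "0 \<le> x \<and> x \<le> 1 \<and> 1 \<le> y \<and> y \<le> phi \<and> x + phi * y \<le> 1 + phi"
  let ?T4 = "0 \<le> x \<and> x \<le> 1 \<and> 1 \<le> y \<and> y \<le> phi \<and> 1 + phi \<le> x + phi * y"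
  define P1 where "P1 = pt_L (x + phi * y, 1 - y)"
  define P2 where "P2 = pt_L (x + phi * y - phi, 1 - y)"
  define P3 where "P3 = pt_L (x + phi * y - phi, 1 + phi - y)"
  define P4 where "P4 = pt_L (x + phi * y - phi - 1, 1 + phi - y)"
  have eq: "x = u - phi * y" if "x + phi * y = u" for u
    using that by simp
  have 12: "P1 = P2" if "?T1" "?T2"
    using that glue_L(1)[of "1 - y"] eq[of phi] by (simp add: P1_def P2_def)
  have 34: "P3 = P4" if "?T3" "?T4"
  proof -
    have e: "x + phi * y - phi = 1"
      using that by simp
    have "1 \<le> 1 + phi - y" "1 + phi - y \<le> phi"
      using that by auto
    from glue_L(2)[OF this] show ?thesis
      unfolding P3_def P4_def e by simp
  qed
  have 13: "P1 = P3" if "?T1" "?T3"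
  proof -
    have "y = 1" using that by simp
    then show ?thesis
      using that by (auto simp: P1_def P3_def glue_L_vertices)
  qed
  have 14: "P1 = P4" if "?T1" "?T4"
  proof -
    have "y = 1" using that by simp
    then show ?thesis
      using that by (auto simp: P1_def)
  qed
  have 23: "P2 = P3" if "?T2" "?T3"
  proof -
    have "y = 1" using that by simp
    then show ?thesis
      using that by (auto simp: P2_def P3_def glue_L)
  qed
  have 24: "P2 = P4" if "?T2" "?T4"
  proof -
    have "y = 1" using that by simp
    then show ?thesis
      using that by (auto simp: P2_def P4_def glue_L_vertices)
  qed
  have "?T1 \<and> pt_L q = P1 \<or> ?T2 \<and> pt_L q = P2 \<or> ?T3 \<and> pt_L q = P3 \<or> ?T4 \<and> pt_L q = P4"
    if "q \<in> moved twist_map twist_pieces p" for q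
    using that unfolding P1_def P2_def P3_def P4_def xy moved_twist by blast
  from this[OF p(1)] this[OF p(2)] show "pt_L p' = pt_L p''"
    using 12 13 14 23 24 34 by (elim disjE) simp_all
next
  fix y :: real assume y: "0 \<le> y" "y \<le> 1"
  have "(phi * y, 1 - y) \<in> moved twist_map twist_pieces (phi, y)"
    "(phi * y, 1 - y) \<in> moved twist_map twist_pieces (0, y)"
    using y phi_gt_1 unfolding moved_twist by auto
  then show "\<exists>p'\<in>moved twist_map twist_pieces (phi, y). \<exists>q'\<in>moved twist_map twist_pieces (0, y).
      pt_L p' = pt_L q'" by blast
next
  fix y :: real assume y: "1 \<le> y" "y \<le> phi"
  have "phi \<le> phi * y" "phi * y \<le> 1 + phi"
    using y phi_gt_1 phi_sq mult_left_mono[of y phi phi] by auto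
  then have "(phi * y - phi, 1 + phi - y) \<in> moved twist_map twist_pieces (1, y)"
    "(phi * y - phi, 1 + phi - y) \<in> moved twist_map twist_pieces (0, y)"
    using y phi_gt_1 unfolding moved_twist by auto
  then show "\<exists>p'\<in>moved twist_map twist_pieces (1, y). \<exists>q'\<in>moved twist_map twist_pieces (0, y).
      pt_L p' = pt_L q'" by blast
next
  fix x :: real assume x: "1 \<le> x" "x \<le> phi"
  then have "(x, 0) \<in> moved twist_map twist_pieces (x, 1)" "(x, 1) \<in> moved twist_map twist_pieces (x, 0)"
    using phi_gt_1 unfolding moved_twist by auto
  then show "\<exists>p'\<in>moved twist_map twist_pieces (x, 1). \<exists>q'\<in>moved twist_map twist_pieces (x, 0).
      pt_L p' = pt_L q'" using glue_L(3)[OF x] by metis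
next
  fix x :: real assume x: "0 \<le> x" "x \<le> 1"
  then have "(x, 1) \<in> moved twist_map twist_pieces (x, phi)" "(x, 1) \<in> moved twist_map twist_pieces (x, 0)"
    using phi_gt_1 phi_sq unfolding moved_twist by auto
  then show "\<exists>p'\<in>moved twist_map twist_pieces (x, phi). \<exists>q'\<in>moved twist_map twist_pieces (x, 0).
      pt_L p' = pt_L q'" by blast
next
  have "(0, 1) \<in> moved twist_map twist_pieces (0, 0)"
    using phi_gt_1 unfolding moved_twist by auto
  then show "\<exists>x'\<in>moved twist_map twist_pieces (0, 0). pt_L x' = pt_L (0, 0)"
    using glue_L_vertices by metis
qed

section \<open>The horizontal direction\<close>

text \<open>
  The golden L has two horizontal cylinders, of heights \<open>lo < y < hi\<close> and circumference \<open>l\<close>.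
\<close>

definition strip :: "real \<Rightarrow> real \<Rightarrow> real \<Rightarrow> bool" where
  "strip lo hi l \<longleftrightarrow> lo = 0 \<and> hi = 1 \<and> l = phi \<or> lo = 1 \<and> hi = phi \<and> l = 1"

text \<open>Height and angular coordinate on a cylinder. The circle absorbs the gluing of the two
  ends, and \<open>None\<close> outside the open strip makes the function compatible with all four
  pairings.\<close>

definition angle :: "real \<Rightarrow> real \<Rightarrow> real \<Rightarrow> plane \<Rightarrow> (real \<times> complex) option" where
  "angle lo hi l p = (if lo < snd p \<and> snd p < hi then Some (snd p, cis (2 * pi * (fst p / l))) else None)"

definition cyl :: "real \<Rightarrow> real \<Rightarrow> plane set set" where
  "cyl lo hi = pt_L ` {p \<in> region golden_L. lo < snd p \<and> snd p < hi}"

lemma strip_facts: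
  assumes "strip lo hi l"
  shows "l > 0" "lo < hi" "lo < y \<Longrightarrow> y < hi \<Longrightarrow> (x, y) \<in> region golden_L \<longleftrightarrow> 0 \<le> x \<and> x \<le> l"
    "lo < y \<Longrightarrow> y < hi \<Longrightarrow> pt_L (l, y) = pt_L (0, y)"
  using assms phi_gt_1 glue_L unfolding strip_def by (auto simp: region_L)

lemma cis_eq_cisD:
  assumes "cis (2 * pi * a) = cis (2 * pi * b)"
  shows "a - b \<in> \<int>"
proof -
  have "cis (2 * pi * (a - b)) = cis (2 * pi * a) / cis (2 * pi * b)"
    by (simp add: cis_divide right_diff_distrib)
  then have "exp (\<i> * complex_of_real (2 * pi * (a - b))) = 1"
    unfolding cis_conv_exp[symmetric] by (simp add: assms)
  then obtain n :: int where "2 * pi * (a - b) = of_int (2 * n) * pi"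
    by (auto simp: exp_eq_1)
  then have "a - b = of_int n"
    by simp
  then show ?thesis
    by simp
qed

lemma lift_angle:
  assumes "strip lo hi l"
  shows "lift_pt (angle lo hi l) (pt_L p) = angle lo hi l p"
  using assms phi_gt_1 unfolding strip_def
  by (elim disjE; elim conjE; hypsubst) (rule lift_pt_L; auto simp: angle_def)+

text \<open>Two abscissas between 0 and \<open>l\<close> with the same angle differ by 0 or by
  \<open>l\<close>, and in the latter case they are the glued ends.\<close>

lemma angle_inj:
  assumes s: "strip lo hi l" and pq: "p \<in> region golden_L" "q \<in> region golden_L"
    "angle lo hi l p = Some yz" "angle lo hi l q = Some yz"
  shows "pt_L p = pt_L q"
proof -
  obtain x y x' y' where xy: "p = (x, y)" "q = (x', y')"
    by fastforce
  have y: "y' = y" "lo < y" "y < hi" and cis: "cis (2 * pi * (x / l)) = cis (2 * pi * (x' / l))"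
    using pq(3,4) unfolding xy by (auto simp: angle_def split: if_splits)
  have x: "0 \<le> x" "x \<le> l" "0 \<le> x'" "x' \<le> l" and l: "l > 0"
    using pq(1,2) strip_facts[OF s] y unfolding xy by auto
  obtain n :: int where n: "x / l - x' / l = of_int n"
    using cis_eq_cisD[OF cis] Ints_cases by blast
  then have xx: "x = x' + of_int n * l"
    using l by (simp add: field_simps)
  have "\<bar>x / l - x' / l\<bar> \<le> 1"
    using x l by (simp add: abs_le_iff divide_le_eq flip: diff_divide_distrib)
  then have "n = 0 \<or> n = 1 \<or> n = -1"
    unfolding n by linarith
  then have "x = x' \<or> x = l \<and> x' = 0 \<or> x = 0 \<and> x' = l"
    using xx x by auto
  then show ?thesis
    using strip_facts(4)[OF s y(2,3)] unfolding xy y(1) by auto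
qed

lemma angle_eq_None: "angle lo hi l p = None \<longleftrightarrow> \<not> (lo < snd p \<and> snd p < hi)"
  by (simp add: angle_def)

lemma angle_shift: "angle lo hi l (x + s, y) = map_option (\<lambda>(y, z). (y, z * cis (2 * pi * (s / l)))) (angle lo hi l (x, y))"
  by (simp add: angle_def cis_mult algebra_simps add_divide_distrib)

lemma cyl_iff:
  assumes "strip lo hi l" "p \<in> region golden_L"
  shows "pt_L p \<in> cyl lo hi \<longleftrightarrow> lo < snd p \<and> snd p < hi"
proof
  assume "pt_L p \<in> cyl lo hi"
  then obtain q where q: "pt_L p = pt_L q" "lo < snd q" "snd q < hi"
    unfolding cyl_def by blast
  then have "angle lo hi l p = angle lo hi l q"
    by (metis lift_angle[OF assms(1)])
  then show "lo < snd p \<and> snd p < hi"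
    using q angle_eq_None by metis
qed (use assms in \<open>auto simp: cyl_def\<close>)

lemma cyl_iff_angle:
  assumes "strip lo hi l" "P \<in> topspace (surface golden_L)"
  shows "P \<in> cyl lo hi \<longleftrightarrow> lift_pt (angle lo hi l) P \<noteq> None"
proof -
  obtain p where p: "P = pt_L p" "p \<in> region golden_L"
    using assms(2) unfolding topspace_surface by blast
  show ?thesis
    unfolding p(1) lift_angle[OF assms(1)] angle_eq_None cyl_iff[OF assms(1) p(2)] by blast
qed

text \<open>The flow rotates the angle at the constant rate \<open>r / l\<close>. The angle rotated
  back by the elapsed time is the first integral \<open>H\<close>.\<close>

lemma strip_flow:
  assumes s: "strip lo hi l" and \<gamma>: "trajectory golden_L (r, 0) \<gamma>"
  shows "lift_pt (angle lo hi l) (\<gamma> t) =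
    map_option (\<lambda>(y, z). (y, z * cis (2 * pi * (r * t / l)))) (lift_pt (angle lo hi l) (\<gamma> 0))"
proof -
  define H where "H P t = map_option (\<lambda>(y, z). (y, z * cis (2 * pi * (- r * t / l)))) (lift_pt (angle lo hi l) P)" for P t
  have H: "H (\<gamma> t) t = H (\<gamma> 0) 0"
  proof (rule trajectory_invariant[OF \<gamma>])
    fix p :: plane and s' t :: real
    obtain x y where xy: "p = (x, y)" by fastforce
    have "H (pt_L (p + s' *\<^sub>R (r, 0))) (t + s') =
        map_option (\<lambda>(y, z). (y, z * cis (2 * pi * (- r * (t + s') / l)))) (angle lo hi l (x + s' * r, y))"
      by (simp add: H_def lift_angle[OF s] xy)
    also have "\<dots> = map_option (\<lambda>(y, z). (y, z * cis (2 * pi * (- r * t / l)))) (angle lo hi l (x, y))"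
    proof -
      have "cis (2 * pi * (s' * r / l)) * cis (2 * pi * (- r * (t + s') / l)) = cis (2 * pi * (- r * t / l))"
        using strip_facts(1)[OF s] unfolding cis_mult by (intro arg_cong[where f = cis]) (simp add: field_simps)
      then show ?thesis
        unfolding angle_shift option.map_comp
        by (intro option.map_cong0) (auto simp: mult.assoc)
    qed
    finally show "H (pt_L (p + s' *\<^sub>R (r, 0))) (t + s') = H (pt_L p) t"
      by (simp add: H_def lift_angle[OF s] xy)
  qed
  have "lift_pt (angle lo hi l) (\<gamma> t) = map_option (\<lambda>(y, z). (y, z * cis (2 * pi * (r * t / l)))) (H (\<gamma> t) t)"
    unfolding H_def option.map_comp by (rule sym, rule option.map_ident_strong) (auto simp: cis_mult)
  also have "\<dots> = map_option (\<lambda>(y, z). (y, z * cis (2 * pi * (r * t / l)))) (lift_pt (angle lo hi l) (\<gamma> 0))"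
    unfolding H by (simp add: H_def option.map_comp case_prod_unfold comp_def)
  finally show ?thesis .
qed

lemma strip_range:
  assumes s: "strip lo hi l" and \<gamma>: "trajectory golden_L (r, 0) \<gamma>" and t: "\<gamma> t \<in> cyl lo hi"
  shows "range \<gamma> \<subseteq> cyl lo hi"
proof -
  note cyl = cyl_iff_angle[OF s trajectory_in_surface[OF \<gamma>]]
  have "\<gamma> t' \<in> cyl lo hi" for t'
    using t strip_flow[OF s \<gamma>, of t] strip_flow[OF s \<gamma>, of t'] unfolding cyl by auto
  then show ?thesis by blast
qed

text \<open>The angle determines the point and turns at rate \<open>r / l\<close>, so the point
  returns exactly when \<open>r * T / l\<close> is an integer.\<close>

lemma strip_period:
  assumes s: "strip lo hi l" and r: "r > 0" and \<gamma>: "trajectory golden_L (r, 0) \<gamma>" and C: "range \<gamma> \<subseteq> cyl lo hi"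
  shows "l / r \<in> periods \<gamma>" "primitive_period \<gamma> = l / r"
proof -
  have l: "l > 0" by (rule strip_facts(1)[OF s])
  note cyl = cyl_iff_angle[OF s trajectory_in_surface[OF \<gamma>]]
  obtain y z where yz: "lift_pt (angle lo hi l) (\<gamma> 0) = Some (y, z)"
  proof -
    have "\<gamma> 0 \<in> cyl lo hi"
      using C by blast
    then show ?thesis
      using that unfolding cyl by (metis option.exhaust surj_pair)
  qed
  then have flow: "lift_pt (angle lo hi l) (\<gamma> t) = Some (y, z * cis (2 * pi * (r * t / l)))" for t
    using strip_flow[OF s \<gamma>, of t] by simp
  have "\<gamma> 0 \<in> topspace (surface golden_L)"
    by (rule trajectory_in_surface[OF \<gamma>])
  then have z: "z \<noteq> 0"
    using yz lift_angle[OF s] unfolding topspace_surface by (auto simp: angle_def split: if_splits)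
  have inj: "\<gamma> t = \<gamma> t'" if "lift_pt (angle lo hi l) (\<gamma> t) = lift_pt (angle lo hi l) (\<gamma> t')" for t t'
  proof -
    obtain p where p: "\<gamma> t = pt_L p" "p \<in> region golden_L"
      using trajectory_in_surface[OF \<gamma>, of t] unfolding topspace_surface by blast
    obtain q where q: "\<gamma> t' = pt_L q" "q \<in> region golden_L"
      using trajectory_in_surface[OF \<gamma>, of t'] unfolding topspace_surface by blast
    show ?thesis
      using that flow[of t] angle_inj[OF s p(2) q(2)] unfolding p(1) q(1) lift_angle[OF s] by metis
  qed
  have "\<gamma> (t + l / r) = \<gamma> t" for t
  proof (rule inj)
    have "r * (t + l / r) / l = r * t / l + 1"
      using l r by (simp add: field_simps)
    then have "cis (2 * pi * (r * (t + l / r) / l)) = cis (2 * pi * (r * t / l)) * cis (2 * pi)"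
      by (simp add: cis_mult algebra_simps)
    then show "lift_pt (angle lo hi l) (\<gamma> (t + l / r)) = lift_pt (angle lo hi l) (\<gamma> t)"
      unfolding flow by simp
  qed
  then show per: "l / r \<in> periods \<gamma>"
    using l r by (simp add: periods_def)
  have "l / r \<le> T" if T: "T \<in> periods \<gamma>" for T
  proof -
    have "\<gamma> (0 + T) = \<gamma> 0" "T > 0"
      using T unfolding periods_def by blast+
    then have "cis (2 * pi * (r * T / l)) = cis (2 * pi * 0)"
      using flow[of T] flow[of 0] z by simp
    then have "r * T / l \<in> \<int>"
      using cis_eq_cisD by fastforce
    then obtain n :: int where n: "r * T / l = of_int n"
      using Ints_cases by blast
    moreover have "r * T / l > 0"
      using r l \<open>T > 0\<close> by simp
    ultimately have "n \<ge> 1"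
      by simp
    then have "r * T / l \<ge> 1"
      using n by simp
    then show ?thesis
      using r l by (simp add: field_simps)
  qed
  then show "primitive_period \<gamma> = l / r"
    unfolding primitive_period_def using per by (intro cInf_eq_minimum)
qed

lemma cyl_not_vertex:
  assumes "strip lo hi l"
  shows "pt_L (0, 0) \<notin> cyl lo hi"
  using cyl_iff[OF assms, of "(0, 0)"] assms phi_gt_1 by (auto simp: strip_def region_L)

text \<open>The trajectory is written down explicitly, its abscissa moving at speed \<open>r\<close>
  modulo \<open>l\<close>.\<close>

lemma strip_trajectory:
  assumes s: "strip lo hi l" and r: "r > 0" and P: "P \<in> cyl lo hi"
  obtains \<gamma> where "periodic_trajectory golden_L (r, 0) \<gamma>" "\<gamma> 0 = P" "range \<gamma> \<subseteq> cyl lo hi"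
proof -
  have l: "l > 0" by (rule strip_facts(1)[OF s])
  obtain x0 y where P: "P = pt_L (x0, y)" "(x0, y) \<in> region golden_L" "lo < y" "y < hi"
    using P unfolding cyl_def by auto
  define x where "x t = l * frac ((x0 + r * t) / l)" for t
  define \<gamma> where "\<gamma> t = pt_L (x t, y)" for t
  have x: "0 \<le> x t" "x t < l" for t
    using l frac_lt_1 by (auto simp: x_def)
  have x_region: "(x t, y) \<in> region golden_L" for t
    using x[of t] strip_facts(3)[OF s P(3,4)] by auto
  have ang: "angle lo hi l (x t, y) = Some (y, cis (2 * pi * ((x0 + r * t) / l)))" for t
  proof -
    have "2 * pi * frac ((x0 + r * t) / l) = 2 * pi * ((x0 + r * t) / l) - 2 * pi * of_int \<lfloor>(x0 + r * t) / l\<rfloor>"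
      by (simp add: frac_def right_diff_distrib)
    moreover have "cis (2 * pi * of_int \<lfloor>(x0 + r * t) / l\<rfloor>) = 1"
      by (simp add: cis_multiple_2pi)
    ultimately have "cis (2 * pi * frac ((x0 + r * t) / l)) = cis (2 * pi * ((x0 + r * t) / l))"
      by (simp only: flip: cis_divide) simp
    then show ?thesis
      using P l by (simp add: angle_def x_def)
  qed
  \<comment> \<open>Classes are compared through their angles, so \<open>x'\<close> may be any
    abscissa representing the point at time \<open>t\<close>, in particular either end of the
    strip.\<close>
  have eq: "\<gamma> (t + s') = pt_L ((x', y) + s' *\<^sub>R (r, 0))"
    if "angle lo hi l (x', y) = angle lo hi l (x t, y)" "0 \<le> x' + s' * r" "x' + s' * r \<le> l" for t s' x'
  proof -
    have reg: "(x' + s' * r, y) \<in> region golden_L"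
      using that strip_facts(3)[OF s P(3,4)] by auto
    have "angle lo hi l (x' + s' * r, y) = Some (y, cis (2 * pi * ((x0 + r * (t + s')) / l)))"
      unfolding angle_shift that(1) ang by (simp add: cis_mult add_divide_distrib algebra_simps)
    from angle_inj[OF s x_region reg ang this] show ?thesis
      by (simp add: \<gamma>_def)
  qed
  have in_cyl: "\<gamma> t \<in> cyl lo hi" for t
    unfolding \<gamma>_def using cyl_iff[OF s x_region] P by auto
  have traj: "trajectory golden_L (r, 0) \<gamma>"
  proof (rule trajectoryI)
    show "(r, 0) \<noteq> (0 :: plane)" using r by (simp add: zero_prod_def)
    show "\<gamma> t \<notin> vertex_points golden_L" for t
      using in_cyl[of t] cyl_not_vertex[OF s] unfolding vertex_points_L by (metis singletonD)
    fix t
    \<comment> \<open>At the seam the arriving segment ends at \<open>l\<close>, whereas the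
      departing one starts at 0.\<close>
    define x' where "x' = (if x t = 0 then l else x t)"
    have x': "0 < x'" "x' \<le> l" "angle lo hi l (x', y) = angle lo hi l (x t, y)"
      using x[of t] l P by (auto simp: x'_def angle_def)
    have "\<gamma> (t + 0) = pt_L ((x', y) + 0 *\<^sub>R (r, 0))"
      using x' by (intro eq) auto
    then have 1: "\<gamma> t = pt_L (x', y)"
      by (simp add: zero_prod_def)
    have reg: "(x' + s, y) \<in> region golden_L" if "0 \<le> x' + s" "x' + s \<le> l" for s
      using that strip_facts(3)[OF s P(3,4)] by auto
    have left: "\<forall>\<^sub>F s in at_right 0. (x', y) - s *\<^sub>R (r, 0) \<in> region golden_L \<and> \<gamma> (t - s) = pt_L ((x', y) - s *\<^sub>R (r, 0))"
      unfolding eventually_at_right_0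
    proof (intro exI[of _ "x' / r"] conjI allI impI)
      fix s' assume "0 < s'" "s' < x' / r"
      then have *: "0 \<le> x' + (- s') * r" "x' + (- s') * r \<le> l"
        using r x' by (simp_all add: field_simps) (smt (verit) mult_pos_pos)
      show "(x', y) - s' *\<^sub>R (r, 0) \<in> region golden_L"
        using reg[OF *] by simp
      show "\<gamma> (t - s') = pt_L ((x', y) - s' *\<^sub>R (r, 0))"
        using eq[OF x'(3) *] by simp
    qed (use x' r in simp)
    have right: "\<forall>\<^sub>F s in at_right 0. (x t, y) + s *\<^sub>R (r, 0) \<in> region golden_L \<and> \<gamma> (t + s) = pt_L ((x t, y) + s *\<^sub>R (r, 0))"
      unfolding eventually_at_right_0
    proof (intro exI[of _ "(l - x t) / r"] conjI allI impI)
      fix s' assume "0 < s'" "s' < (l - x t) / r"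
      then have *: "0 \<le> x t + s' * r" "x t + s' * r \<le> l"
        using r x[of t] by (simp_all add: field_simps)
      show "(x t, y) + s' *\<^sub>R (r, 0) \<in> region golden_L"
        using * strip_facts(3)[OF s P(3,4)] by simp
      show "\<gamma> (t + s') = pt_L ((x t, y) + s' *\<^sub>R (r, 0))"
        using eq[OF refl *] by simp
    qed (use x[of t] r in simp)
    show "\<exists>p q. \<gamma> t = pt_L p \<and> \<gamma> t = pt_L q \<and> p \<in> region golden_L \<and> q \<in> region golden_L \<and>
      (\<forall>\<^sub>F s in at_right 0. p - s *\<^sub>R (r, 0) \<in> region golden_L \<and> \<gamma> (t - s) = pt_L (p - s *\<^sub>R (r, 0))) \<and>
      (\<forall>\<^sub>F s in at_right 0. q + s *\<^sub>R (r, 0) \<in> region golden_L \<and> \<gamma> (t + s) = pt_L (q + s *\<^sub>R (r, 0)))"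
      using 1 left right x_region[of t] reg[of 0] x' \<gamma>_def[of t]
      by (intro exI[of _ "(x', y)"] exI[of _ "(x t, y)"]) simp
  qed
  have C: "range \<gamma> \<subseteq> cyl lo hi"
    using in_cyl by blast
  have "\<gamma> 0 = P"
  proof -
    have "angle lo hi l (x0, y) = Some (y, cis (2 * pi * ((x0 + r * 0) / l)))"
      using P by (simp add: angle_def)
    from angle_inj[OF s x_region P(2) ang this] show ?thesis
      by (simp add: \<gamma>_def P(1))
  qed
  moreover have "periodic_trajectory golden_L (r, 0) \<gamma>"
    unfolding periodic_trajectory_def using traj strip_period(1)[OF s r traj C] by blast
  ultimately show thesis
    using C that by blast
qed

text \<open>The abscissa on the horizontal boundary lines away from the vertices. On these lines the
  pairings move only vertices horizontally, so the abscissa survives the gluing.\<close>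

definition level :: "plane \<Rightarrow> real option" where
  "level p = (if snd p \<in> {0, 1, phi} \<and> fst p \<notin> {0, 1, phi} then Some (fst p) else None)"

text \<open>The remaining horizontal leaves run into the vertex.\<close>

lemma horizontal_levels:
  assumes \<gamma>: "trajectory golden_L (r, 0) \<gamma>"
    and p: "\<gamma> t = pt_L p" "p \<in> region golden_L" "snd p \<in> {0, 1, phi}"
  shows False
proof -
  have r: "r \<noteq> 0"
    using \<gamma> by (auto simp: trajectory_def zero_prod_def)
  have lift: "lift_pt level (pt_L p) = level p" for p
    by (rule lift_pt_L) (use phi_gt_1 in \<open>auto simp: level_def\<close>)
  have vertex: "pt_L p = pt_L (0, 0)"
    if "p \<in> region golden_L" "snd p \<in> {0, 1, phi}" "fst p \<in> {0, 1, phi}" for p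
    using that phi_gt_1 by (cases p) (auto simp: glue_L_vertices region_L)
  define H where "H P t = map_option (\<lambda>x. x - r * t) (lift_pt level P)" for P t
  have H: "H (\<gamma> t) t = H (\<gamma> t') t'" for t t'
  proof (rule trajectory_invariant[OF \<gamma>])
    fix p :: plane and s t :: real
    assume *: "p \<in> region golden_L" "p + s *\<^sub>R (r, 0) \<in> region golden_L"
      "pt_L p \<notin> vertex_points golden_L" "pt_L (p + s *\<^sub>R (r, 0)) \<notin> vertex_points golden_L"
    have "snd p \<in> {0, 1, phi} \<longrightarrow> fst p \<notin> {0, 1, phi} \<and> fst (p + s *\<^sub>R (r, 0)) \<notin> {0, 1, phi}"
      using vertex[OF *(1)] vertex[OF *(2)] *(3,4) unfolding vertex_points_L by auto
    then have "level (p + s *\<^sub>R (r, 0)) = map_option (\<lambda>x. x + s * r) (level p)"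
      unfolding level_def by (cases "snd p \<in> {0, 1, phi}"; simp only: snd_add snd_scaleR snd_conv mult_zero_right add_0_right
          simp_thms if_True if_False option.map fst_add fst_scaleR fst_conv real_scaleR_def)
    then have "map_option (\<lambda>x. x - r * (t + s)) (level (p + s *\<^sub>R (r, 0))) = map_option (\<lambda>x. x - r * t) (level p)"
      by (simp add: option.map_comp comp_def algebra_simps)
    then show "H (pt_L (p + s *\<^sub>R (r, 0))) (t + s) = H (pt_L p) t"
      unfolding H_def lift .
  qed
  have "fst p \<notin> {0, 1, phi}"
    using vertex[OF p(2,3)] trajectory_not_vertex[OF \<gamma>, of t] unfolding p(1) vertex_points_L by blast
  then have "lift_pt level (\<gamma> t) = Some (fst p)"
    using p(3) unfolding p(1) lift by (simp add: level_def)
  then have "H (\<gamma> t') t' = Some (fst p - r * t)" for t'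
    using H[of t t'] by (simp add: H_def)
  then have x: "lift_pt level (\<gamma> t') = Some (fst p - r * t + r * t')" for t'
    by (auto simp: H_def) (metis add.commute diff_add_cancel)
  \<comment> \<open>The abscissa would have to change linearly for all time; at \<open>t'\<close> it
    would be \<open>2 * phi\<close>, outside the L.\<close>
  define t' where "t' = (2 * phi - fst p + r * t) / r"
  obtain q where q: "\<gamma> t' = pt_L q" "q \<in> region golden_L"
    using trajectory_in_surface[OF \<gamma>, of t'] unfolding topspace_surface by blast
  have "level q = Some (2 * phi)"
    using x[of t'] r unfolding q(1) lift by (simp add: t'_def)
  then have "fst q = 2 * phi"
    by (auto simp: level_def split: if_splits)
  then show False
    using q(2) phi_gt_1 by (cases q) (auto simp: region_L)
qed

section \<open>The two horizontal cylinders as connected components\<close>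

lemma strips: "strip 0 1 phi" "strip 1 phi 1"
  by (simp_all add: strip_def)

lemma horizontal_range:
  assumes \<gamma>: "trajectory golden_L (r, 0) \<gamma>"
  shows "range \<gamma> \<subseteq> cyl 1 phi \<or> range \<gamma> \<subseteq> cyl 0 1"
proof -
  obtain p where p: "\<gamma> 0 = pt_L p" "p \<in> region golden_L"
    using trajectory_in_surface[OF \<gamma>, of 0] unfolding topspace_surface by blast
  have "\<not> snd p \<in> {0, 1, phi}"
    using horizontal_levels[OF \<gamma> p] by blast
  then have "0 < snd p \<and> snd p < 1 \<or> 1 < snd p \<and> snd p < phi"
    using p(2) phi_gt_1 by (cases p) (auto simp: region_L)
  then have "\<gamma> 0 \<in> cyl 0 1 \<or> \<gamma> 0 \<in> cyl 1 phi"
    unfolding p(1) using cyl_iff[OF strips(1) p(2)] cyl_iff[OF strips(2) p(2)] by blast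
  then show ?thesis
    using strip_range[OF strips(1) \<gamma>] strip_range[OF strips(2) \<gamma>] by blast
qed

lemma openin_cyl:
  assumes "strip lo hi l"
  shows "openin (surface golden_L) (cyl lo hi)"
proof -
  have "{p \<in> region golden_L. pt_L p \<in> cyl lo hi} = region golden_L \<inter> snd -` {lo<..<hi}"
    using cyl_iff[OF assms] by auto
  moreover have "open (snd -` {lo<..<hi} :: plane set)"
    by (intro open_vimage continuous_intros open_greaterThanLessThan)
  ultimately show ?thesis
    unfolding openin_surface by (auto simp: cyl_def openin_open)
qed

lemma connectedin_cyl:
  assumes "strip lo hi l"
  shows "connectedin (surface golden_L) (cyl lo hi)"
proof -
  have "{p \<in> region golden_L. lo < snd p \<and> snd p < hi} = {0..l} \<times> {lo<..<hi}"
    using strip_facts(3)[OF assms] by auto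
  then have "connected {p \<in> region golden_L. lo < snd p \<and> snd p < hi}"
    by (simp add: connected_Times)
  then show ?thesis
    unfolding cyl_def
    by (intro connectedin_continuous_map_image[OF continuous_map_pt]) (auto simp: connectedin_subtopology)
qed

lemma cyl_nonempty:
  assumes s: "strip lo hi l"
  shows "cyl lo hi \<noteq> {}"
proof -
  have "lo < (lo + hi) / 2" "(lo + hi) / 2 < hi"
    using strip_facts(2)[OF s] by auto
  moreover from this have "(0, (lo + hi) / 2) \<in> region golden_L"
    using strip_facts(1)[OF s] strip_facts(3)[OF s] by auto
  ultimately have "pt_L (0, (lo + hi) / 2) \<in> cyl lo hi"
    by (simp add: cyl_iff[OF s])
  then show ?thesis by blast
qed

text \<open>Both sets are clopen, so each component lies in one of them and equals it by
  maximality.\<close>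

lemma connected_components_two:
  assumes open': "openin X A" "openin X B" and conn: "connectedin X A" "connectedin X B"
    and ne: "A \<noteq> {}" "B \<noteq> {}" and disj: "A \<inter> B = {}" and X: "topspace X = A \<union> B"
  shows "connected_components_of X = {A, B}"
proof -
  have "topspace X - A = B" "topspace X - B = A"
    using disj X by blast+
  then have "closedin X A" "closedin X B"
    using open' X unfolding closedin_def by auto
  then have comp: "K \<in> {A, B}" if K: "K \<in> connected_components_of X" for K
  proof -
    have cK: "connectedin X K" and K0: "K \<noteq> {}" "K \<subseteq> A \<union> B"
      using connectedin_connected_components_of[OF K] nonempty_connected_components_of[OF K]
        connected_components_of_subset[OF K] X by simp_all
    have "K \<subseteq> A \<or> disjnt K A" "K \<subseteq> B \<or> disjnt K B"
      using connectedin_clopen_cases[OF cK] open' \<open>closedin X A\<close> \<open>closedin X B\<close> by blast+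
    then have "K \<subseteq> A \<and> \<not> disjnt K A \<or> K \<subseteq> B \<and> \<not> disjnt K B"
      using K0 unfolding disjnt_def by blast
    then show ?thesis
      using connected_components_of_maximal[OF K] conn by blast
  qed
  have union: "\<Union>(connected_components_of X) = A \<union> B"
    using Union_connected_components_of[of X] X by simp
  obtain a b where ab: "a \<in> A" "b \<in> B"
    using ne by blast
  obtain K K' where K: "K \<in> connected_components_of X" "a \<in> K" "K' \<in> connected_components_of X" "b \<in> K'"
    using union ab by (metis UnCI UnionE)
  have "K = A" "K' = B"
    using comp[OF K(1)] comp[OF K(3)] K(2,4) ab disj by auto
  then show ?thesis
    using comp K by auto
qed

text \<open>The upper strip has circumference 1 and is the short cylinder; the lower one has
  circumference \<open>phi\<close>. At speed \<open>r\<close> they are traversed in times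
  \<open>1 / r\<close> and \<open>phi / r\<close>.\<close>

lemma two_cylinders_horizontal:
  assumes r: "r > 0"
  shows "two_cylinders golden_L (r, 0) (1 / r)"
proof -
  let ?u = "(r, 0)"
  have pp: "periodic_points golden_L ?u = cyl 1 phi \<union> cyl 0 1"
  proof
    show "periodic_points golden_L ?u \<subseteq> cyl 1 phi \<union> cyl 0 1"
      unfolding periodic_points_def periodic_trajectory_def using horizontal_range by blast
    have "P \<in> periodic_points golden_L ?u" if P: "strip lo hi l" "P \<in> cyl lo hi" for lo hi l P
    proof -
      obtain \<gamma> where "periodic_trajectory golden_L ?u \<gamma>" "\<gamma> 0 = P"
        by (rule strip_trajectory[OF P(1) r P(2)])
      then show ?thesis
        unfolding periodic_points_def by blast
    qed
    then show "cyl 1 phi \<union> cyl 0 1 \<subseteq> periodic_points golden_L ?u"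
      using strips by blast
  qed
  have disj: "cyl 1 phi \<inter> cyl 0 1 = {}"
  proof -
    have "P \<notin> cyl 0 1" if P: "P \<in> cyl 1 phi" for P
    proof -
      obtain p where p: "P = pt_L p" "p \<in> region golden_L" "1 < snd p"
        using P unfolding cyl_def by blast
      then show ?thesis
        using cyl_iff[OF strips(1) p(2)] by simp
    qed
    then show ?thesis by blast
  qed
  have sub: "cyl lo hi \<subseteq> topspace (surface golden_L)" for lo hi
    unfolding cyl_def topspace_surface by blast
  let ?X = "subtopology (surface golden_L) (cyl 1 phi \<union> cyl 0 1)"
  have op: "openin ?X (cyl lo hi)" if "strip lo hi l" "cyl lo hi \<subseteq> cyl 1 phi \<union> cyl 0 1" for lo hi l
    using openin_subtopology_Int[OF openin_cyl[OF that(1)], of "cyl 1 phi \<union> cyl 0 1"] that(2)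
    by (simp add: inf.absorb1)
  have "cylinders golden_L ?u = {cyl 1 phi, cyl 0 1}"
    unfolding cylinders_def periodic_points_def[symmetric] pp
  proof (rule connected_components_two)
    show "topspace ?X = cyl 1 phi \<union> cyl 0 1"
      using sub by auto
  qed (use disj op strips cyl_nonempty connectedin_cyl in \<open>auto simp: connectedin_subtopology\<close>)
  moreover have "\<exists>\<gamma>. periodic_trajectory golden_L ?u \<gamma> \<and> range \<gamma> \<subseteq> cyl lo hi" if "strip lo hi l" for lo hi l
    using cyl_nonempty[OF that] strip_trajectory[OF that r] by (metis ex_in_conv)
  moreover have "l / r \<in> periods \<gamma> \<and> primitive_period \<gamma> = l / r"
    if "strip lo hi l" "periodic_trajectory golden_L ?u \<gamma> \<and> range \<gamma> \<subseteq> cyl lo hi" for lo hi l \<gamma>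
    using strip_period[OF that(1) r] that(2) unfolding periodic_trajectory_def by blast
  ultimately show ?thesis
    unfolding two_cylinders_def
    using r strips by (intro conjI exI[of _ "cyl 1 phi"] exI[of _ "cyl 0 1"]) auto
qed

section \<open>Periodic directions\<close>

text \<open>\<open>crossing_sum\<close> for the height: crossing a vertical side contributes 0 and
  crossing a horizontal side contributes its height, 1 or \<open>phi\<close>. The sum is positive,
  so some contribution is at least 1.\<close>

lemma vertical_gain:
  assumes \<gamma>: "trajectory golden_L u \<gamma>" and T: "T \<in> periods \<gamma>" and u: "fst u > 0" "snd u > 0"
  shows "T * snd u \<ge> 1"
proof -
  have T0: "T > 0" using T by (simp add: periods_def)
  have par: "\<gamma> t \<notin> pt_L ` closed_segment a b"
    if "(a, b, w) \<in> pairings golden_L" "\<exists>c. u = c *\<^sub>R (b - a)" for a b w t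
    using that u unfolding pairings_L by auto
  have fin: "finite (pairings golden_L)"
    by (simp add: pairings_L)
  have g: "snd (z + s *\<^sub>R u) = snd z + s *\<^sub>R snd u" for z s
    by simp
  obtain p q where all: "\<forall>t. pt_L (p t) = \<gamma> t \<and> pt_L (q t) = \<gamma> t \<and>
      p t \<in> region golden_L \<and> q t \<in> region golden_L \<and>
      (\<forall>\<^sub>F s in at_right 0. p t - s *\<^sub>R u \<in> region golden_L) \<and> (\<forall>\<^sub>F s in at_right 0. q t + s *\<^sub>R u \<in> region golden_L)"
    and finK: "finite {t \<in> {0..<T}. \<gamma> t \<in> side_points golden_L}"
    and sum0: "T *\<^sub>R snd u = (\<Sum>t | t \<in> {0..<T} \<and> \<gamma> t \<in> side_points golden_L. snd (p t) - snd (q t))"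
    by (rule crossing_sum[OF \<gamma> T fin par g])
  have pq: "pt_L (p t) = \<gamma> t" "pt_L (q t) = \<gamma> t" "p t \<in> region golden_L" "q t \<in> region golden_L"
    "\<forall>\<^sub>F s in at_right 0. p t - s *\<^sub>R u \<in> region golden_L" "\<forall>\<^sub>F s in at_right 0. q t + s *\<^sub>R u \<in> region golden_L"
    for t
    using all by blast+
  define vert where "vert z \<longleftrightarrow> fst z \<in> {0, 1, phi} \<and> snd z \<in> {0, 1, phi}" for z :: plane
  \<comment> \<open>The height with the top sides lowered to 0, so that it respects the gluing.
    Vertices would violate this, as (0, 1) and (0, 0) are glued; they get a value of their
    own.\<close>
  define f where "f z = (if vert z then -1 else if snd z = phi \<or> snd z = 1 \<and> fst z > 1 then 0 else snd z)" for z
  have lift: "lift_pt f (pt_L z) = f z" for z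
    by (rule lift_pt_L) (use phi_gt_1 in \<open>auto simp: f_def vert_def\<close>)
  have nonvert: "\<not> vert z" if "pt_L z = \<gamma> t" "z \<in> region golden_L" for z t
  proof
    assume "vert z"
    then have "pt_L z = pt_L (0, 0)"
      using that(2) phi_gt_1 by (cases z) (auto simp: vert_def glue_L_vertices region_L)
    then show False
      using trajectory_not_vertex[OF \<gamma>, of t] that(1) unfolding vertex_points_L by simp
  qed
  \<comment> \<open>An upward motion cannot start on a top side, so \<open>f\<close> is the true
    height at the departing point. At the arriving point it is the true height, or 0 on a top side,
    whose height is at least 1.\<close>
  have jump: "snd (p t) - snd (q t) = 0 \<or> snd (p t) - snd (q t) \<ge> 1" for t
  proof -
    have "lift_pt f (pt_L (p t)) = lift_pt f (pt_L (q t))"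
      unfolding pq(1,2) ..
    then have fpq: "f (p t) = f (q t)"
      unfolding lift .
    have "\<forall>\<^sub>F s in at_right (0::real). 0 < s"
      by (auto simp: eventually_at_right_0 intro: exI[of _ 1])
    with pq(6)[of t] have "\<forall>\<^sub>F s in at_right (0::real). \<not> (snd (q t) = phi \<or> snd (q t) = 1 \<and> fst (q t) > 1)"
    proof eventually_elim
      case (elim s)
      obtain x y where xy: "q t = (x, y)" by fastforce
      obtain x' y' where u': "u = (x', y')" by fastforce
      have "s * x' > 0" "s * y' > 0"
        using elim(2) u unfolding u' by simp_all
      with elim(1) show ?case
        unfolding xy u' using phi_gt_1 by (auto simp: region_L)
    qed
    then have "\<not> (snd (q t) = phi \<or> snd (q t) = 1 \<and> fst (q t) > 1)"
      by simp
    then have "f (q t) = snd (q t)"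
      using nonvert[OF pq(2,4)] by (simp add: f_def)
    then show ?thesis
      using fpq nonvert[OF pq(1,3)] phi_gt_1 by (auto simp: f_def split: if_splits)
  qed
  let ?K = "{t. t \<in> {0..<T} \<and> \<gamma> t \<in> side_points golden_L}"
  have sum: "T * snd u = (\<Sum>t\<in>?K. snd (p t) - snd (q t))"
    using sum0 by simp
  moreover have "T * snd u > 0"
    using T0 u by simp
  ultimately obtain t where t: "t \<in> ?K" "snd (p t) - snd (q t) \<noteq> 0"
    by (metis (mono_tags, lifting) less_irrefl sum.neutral)
  then have "1 \<le> snd (p t) - snd (q t)"
    using jump by blast
  also have "\<dots> \<le> (\<Sum>t\<in>?K. snd (p t) - snd (q t))"
    by (rule member_le_sum[OF t(1)]) (use jump finK in \<open>smt (verit)\<close>)+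
  finally show ?thesis
    using sum by simp
qed

section \<open>Reduction of periodic directions to the horizontal one\<close>

definition periodic_with :: "plane \<Rightarrow> real \<Rightarrow> bool" where
  "periodic_with u T \<longleftrightarrow> (\<exists>\<gamma>. trajectory golden_L u \<gamma> \<and> T \<in> periods \<gamma>)"

text \<open>All rescalings of the velocity are included so that the short period can be normalised
  to 1 in the end.\<close>

definition two_cylinder_direction :: "plane \<Rightarrow> bool" where
  "two_cylinder_direction u \<longleftrightarrow> (\<exists>T>0. \<forall>k>0. two_cylinders golden_L (k *\<^sub>R u) (T / k))"

lemma periodic_with_image:
  assumes "affine_equivalence golden_L golden_L A A' I" "periodic_with u T"
  shows "periodic_with (A u) T"
proof -
  interpret affine_equivalence golden_L golden_L A A' I by fact
  obtain \<gamma> where "trajectory golden_L u \<gamma>" "T \<in> periods \<gamma>"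
    using assms(2) unfolding periodic_with_def by blast
  then show ?thesis
    unfolding periodic_with_def using trajectory_F periods_F by blast
qed

lemma two_cylinder_direction_image:
  assumes "affine_equivalence golden_L golden_L A A' I" "two_cylinder_direction u"
  shows "two_cylinder_direction (A u)"
proof -
  interpret affine_equivalence golden_L golden_L A A' I by fact
  obtain T where T: "T > 0" "\<And>k. k > 0 \<Longrightarrow> two_cylinders golden_L (k *\<^sub>R u) (T / k)"
    using assms(2) unfolding two_cylinder_direction_def by blast
  have "two_cylinders golden_L (k *\<^sub>R A u) (T / k)" if "k > 0" for k
    using two_cylinders_F[OF T(2)[OF that]] by (simp add: linear_scale[OF linear])
  then show ?thesis
    unfolding two_cylinder_direction_def using T(1) by blast
qed

lemma two_cylinder_direction_horizontal:
  assumes "r > 0"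
  shows "two_cylinder_direction (r, 0)"
proof -
  have "two_cylinders golden_L (k *\<^sub>R (r, 0)) ((1 / r) / k)" if "k > 0" for k
    using two_cylinders_horizontal[of "k * r"] that assms by (simp add: mult.commute)
  then show ?thesis
    unfolding two_cylinder_direction_def using assms by (intro exI[of _ "1 / r"]) simp
qed

text \<open>
  A Euclidean algorithm: the Veech group contains the shear \<open>(x, y) \<mapsto> (x - \<phi> y, y)\<close>, and for
  \<open>0 < y \<le> x\<close> it shortens \<open>\<bar>x\<bar> + \<bar>y\<bar>\<close> by at least \<open>(2 - \<phi>) y\<close>, where \<open>y\<close> is bounded below.
\<close>

lemma periodic_two_cylinders:
  assumes "periodic_with u T" "T * (\<bar>fst u\<bar> + \<bar>snd u\<bar>) < real n / 3"
  shows "two_cylinder_direction u"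
  using assms
proof (induction n arbitrary: u)
  case 0
  then show ?case
    by (auto simp: periodic_with_def periods_def mult_less_0_iff)
next
  case (Suc n)
  have T0: "T > 0"
    using Suc.prems(1) by (auto simp: periodic_with_def periods_def)
  \<comment> \<open>The claim for one direction. The reflections in the axes and the diagonal
    preserve \<open>\<bar>x\<bar> + \<bar>y\<bar>\<close>, so it suffices to treat
    \<open>0 \<le> y \<le> x\<close>.\<close>
  define Q where "Q u \<longleftrightarrow> (periodic_with u T \<longrightarrow> T * (\<bar>fst u\<bar> + \<bar>snd u\<bar>) < real (Suc n) / 3 \<longrightarrow> two_cylinder_direction u)" for u
  have swap: "Q u" if "Q (snd u, fst u)" for u
    using that periodic_with_image[OF swap_L, of u T] two_cylinder_direction_image[OF swap_L, of "(snd u, fst u)"]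
    unfolding Q_def swap_map_def by (simp add: add.commute)
  have reflect: "Q u" if "Q (- fst u, snd u)" for u
    using that periodic_with_image[OF reflect_L, of u T] two_cylinder_direction_image[OF reflect_L, of "(- fst u, snd u)"]
    unfolding Q_def reflect_map_def by simp
  have reflect': "Q u" if "Q (fst u, - snd u)" for u
    using that swap[of u] swap[of "(- snd u, fst u)"] reflect[of "(snd u, fst u)"] by simp
  have 0: "Q (x, y)" if xy: "0 \<le> y" "y \<le> x" for x y
    unfolding Q_def
  proof (intro impI)
    assume per: "periodic_with (x, y) T" and small: "T * (\<bar>fst (x, y)\<bar> + \<bar>snd (x, y)\<bar>) < real (Suc n) / 3"
    show "two_cylinder_direction (x, y)"
    proof (cases "y = 0")
      case True
      have "(x, y) \<noteq> 0"
        using per unfolding periodic_with_def trajectory_def by blast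
      then show ?thesis
        using xy True two_cylinder_direction_horizontal[of x] by (simp add: zero_prod_def)
    next
      case False
      then have "T * y \<ge> 1"
        using vertical_gain[of "(x, y)" _ T] per xy unfolding periodic_with_def by auto
      \<comment> \<open>If \<open>x - phi * y\<close> is negative, the bound follows from
        \<open>phi < 5 / 3\<close> together with \<open>y \<le> x\<close>. The total then drops by
        \<open>T * y / 3\<close>, which is at least \<open>1 / 3\<close>: one unit of the
        induction.\<close>
      have "\<bar>x - phi * y\<bar> \<le> x - y / 3"
      proof -
        have "phi * y \<le> 5 / 3 * y" "y \<le> phi * y"
          using phi_lt phi_gt_1 xy mult_right_mono[of phi "5 / 3" y] mult_right_mono[of 1 phi y] by simp_all
        then show ?thesis
          using xy by (auto simp: abs_le_iff)
      qed
      then have "T * (\<bar>x - phi * y\<bar> + \<bar>y\<bar>) \<le> T * (x + y - y / 3)"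
        using T0 xy by (intro mult_left_mono) auto
      also have "\<dots> = T * (x + y) - (T * y) / 3"
        by (simp add: algebra_simps)
      also have "\<dots> < real n / 3"
        using small xy \<open>T * y \<ge> 1\<close> by simp
      finally have less: "T * (\<bar>fst (x - phi * y, y)\<bar> + \<bar>snd (x - phi * y, y)\<bar>) < real n / 3"
        by simp
      \<comment> \<open>The reflection in the horizontal axis, obtained as a conjugate by
        \<open>swap_map\<close>, cancels the one built into \<open>twist_map\<close>.\<close>
      have flip: "periodic_with (a, - b) T" if "periodic_with (a, b) T" for a b
        using periodic_with_image[OF swap_L periodic_with_image[OF reflect_L periodic_with_image[OF swap_L that]]]
        by (simp add: swap_map_def reflect_map_def)
      have flip': "two_cylinder_direction (a, - b)" if "two_cylinder_direction (a, b)" for a b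
        using two_cylinder_direction_image[OF swap_L two_cylinder_direction_image[OF reflect_L
            two_cylinder_direction_image[OF swap_L that]]]
        by (simp add: swap_map_def reflect_map_def)
      have "periodic_with (x - phi * y, y) T"
        using periodic_with_image[OF twist_L flip[OF per]] by (simp add: twist_map_def)
      then have "two_cylinder_direction (x - phi * y, y)"
        using less by (rule Suc.IH)
      from two_cylinder_direction_image[OF twist_L this] have "two_cylinder_direction (x, - y)"
        by (simp add: twist_map_def)
      from flip'[OF this] show ?thesis
        by simp
    qed
  qed
  have 1: "Q (x, y)" if "0 \<le> x" "0 \<le> y" for x y
    using that 0[of x y] 0[of y x] swap[of "(x, y)"] by (cases "y \<le> x") auto
  have 2: "Q (x, y)" if "0 \<le> y" for x y
    using that 1[of x y] 1[of "- x" y] reflect[of "(x, y)"] by (cases "0 \<le> x") auto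
  have "Q (x, y)" for x y
    using 2[of y x] 2[of "- y" x] reflect'[of "(x, y)"] by (cases "0 \<le> y") auto
  then have "Q u"
    by (metis surj_pair)
  then show ?case
    using Suc.prems by (simp add: Q_def)
qed

text \<open>A short holonomy vector is \<open>v = T0 *\<^sub>R u\<close> with \<open>T0\<close> the
  short period for velocity \<open>u\<close>, so with velocity \<open>v\<close> the short period is
  1.\<close>

lemma Lambda_two_cylinders:
  assumes "v \<in> Lambda_L"
  shows "two_cylinders golden_L v 1"
proof -
  obtain u C where C: "short_cylinder golden_L u C" "cylinder_holonomy golden_L u C = v"
    using assms unfolding Lambda_L_def by blast
  then have C': "C \<in> cylinders golden_L u"
    unfolding short_cylinder_def by simp
  have "C \<noteq> {}" "C \<subseteq> periodic_points golden_L u"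
    using nonempty_connected_components_of[OF C'[unfolded cylinders_def]]
      connected_components_of_subset[OF C'[unfolded cylinders_def]]
    by (auto simp: periodic_points_def)
  then obtain \<gamma> where "periodic_trajectory golden_L u \<gamma>"
    unfolding periodic_points_def by blast
  then obtain T where "periodic_with u T"
    unfolding periodic_with_def periodic_trajectory_def by blast
  moreover obtain n where "3 * (T * (\<bar>fst u\<bar> + \<bar>snd u\<bar>)) < real n"
    using reals_Archimedean2 by blast
  ultimately have "two_cylinder_direction u"
    by (intro periodic_two_cylinders[of u T n]) auto
  then obtain T0 where T0: "T0 > 0" "\<And>k. k > 0 \<Longrightarrow> two_cylinders golden_L (k *\<^sub>R u) (T0 / k)"
    unfolding two_cylinder_direction_def by blast
  have "two_cylinders golden_L u T0"
    using T0(2)[of 1] by simp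
  then have "v = T0 *\<^sub>R u"
    using two_cylindersD(5)[OF _ C(1)] C(2) by simp
  then show ?thesis
    using T0(2)[of T0] T0(1) by simp
qed

section \<open>The double pentagon\<close>

lemma phi_phi: "phi * (phi * z) = phi * z + z"
  using phi_sq by (metis distrib_right mult.assoc mult_1)

text \<open>For the angle pi/5 the cosine of the triple angle is minus that of the double angle. The
  resulting cubic has the root -1, and the remaining quadratic has \<open>phi / 2\<close> as its
  positive root.\<close>

lemma cos_pi_5: "cos (pi / 5) = phi / 2"
proof -
  define C where "C = cos (pi / 5)"
  have "cos (3 * (pi / 5)) = cos (pi - 2 * (pi / 5))"
    by (intro arg_cong[where f = cos]) simp
  then have "4 * C ^ 3 - 3 * C = - (2 * C\<^sup>2 - 1)"
    unfolding cos_treble_cos cos_pi_minus cos_double_cos C_def .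
  then have "(C + 1) * (4 * C * C - 2 * C - 1) = 0"
    by (simp add: algebra_simps power2_eq_square power3_eq_cube)
  moreover have C: "C > 0"
    unfolding C_def by (rule cos_gt_zero) (use pi_gt_zero in linarith)+
  ultimately have "4 * C * C - 2 * C - 1 = 0"
    by simp
  then have "(2 * C - phi) * (2 * C + phi - 1) = 0"
    using phi_sq by (simp add: algebra_simps)
  then show ?thesis
    using C phi_gt_1 unfolding C_def by auto
qed

definition s5 :: real where "s5 = sin (pi / 5)"

lemma s5_pos: "s5 > 0"
  unfolding s5_def by (rule sin_gt_zero) (use pi_gt_zero in auto)

lemma s5_lt_1: "s5 < 1"
proof -
  have "s5\<^sup>2 + (phi / 2)\<^sup>2 = 1"
    unfolding s5_def cos_pi_5[symmetric] by (rule sin_cos_squared_add)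
  then have "s5\<^sup>2 < 1\<^sup>2"
    using phi_gt_1 by simp (smt (verit) zero_less_power zero_less_divide_iff)
  then show ?thesis
    by (rule power2_less_imp_less) simp
qed

lemma s5_sq: "s5 * s5 = (3 - phi) / 4"
proof -
  have "s5\<^sup>2 + (phi / 2)\<^sup>2 = 1"
    unfolding s5_def cos_pi_5[symmetric] by (rule sin_cos_squared_add)
  then show ?thesis
    using phi_sq by (simp add: power2_eq_square field_simps)
qed

lemma sin_2pi_5: "sin (2 * pi / 5) = phi * s5"
  using sin_double[of "pi / 5"] by (simp add: cos_pi_5 s5_def)

lemma cos_2pi_5: "cos (2 * pi / 5) = (phi - 1) / 2"
  using cos_double_cos[of "pi / 5"] phi_sq by (simp add: cos_pi_5 power2_eq_square field_simps)

text \<open>The reciprocal of \<open>2 * phi * s5\<close> written as a multiple of \<open>s5\<close>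
  with a coefficient linear in \<open>phi\<close>, by means of \<open>s5_sq\<close>. Later
  computations thus need no division by \<open>s5\<close>.\<close>

lemma circumradius: "1 / (2 * sin (2 * pi / 5)) = 2 * (2 * phi - 1) / 5 * s5"
proof -
  have "2 * (phi * s5) * (2 * (2 * phi - 1) / 5 * s5) = 4 / 5 * (phi * (2 * phi - 1)) * (s5 * s5)"
    by (simp add: algebra_simps)
  also have "\<dots> = 1"
    unfolding s5_sq by (simp add: phi_phi phi_sq field_simps)
  finally show ?thesis
    unfolding sin_2pi_5 using phi_gt_1 s5_pos by (simp add: field_simps)
qed

section \<open>Coordinates of Q and -Q in the plane of the golden L\<close>

definition pentagon_to_L :: "plane \<Rightarrow> plane" where
  "pentagon_to_L w = (fst w - phi / 2 * (snd w / s5), snd w / s5)"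

lemma L_to_pentagon_eq: "L_to_pentagon v = (fst v + phi / 2 * snd v, s5 * snd v)"
  by (simp add: L_to_pentagon_def cos_pi_5 s5_def)

lemma linear_L_to_pentagon: "linear L_to_pentagon"
  by (rule linearI) (simp_all add: L_to_pentagon_eq algebra_simps)

lemma linear_pentagon_to_L: "linear pentagon_to_L"
  by (rule linearI) (simp_all add: pentagon_to_L_def algebra_simps add_divide_distrib)

lemma pentagon_to_L_inverse: "pentagon_to_L (L_to_pentagon v) = v" "L_to_pentagon (pentagon_to_L w) = w"
  using s5_pos by (simp_all add: pentagon_to_L_def L_to_pentagon_eq)

text \<open>The bottom side of Q comes from the segment between (1, 0) and (phi, 0). The shift
  centres it at abscissa 0 and puts it at distance \<open>(phi + 2) / 5 * s5\<close> below the
  centre (0, 1), which is the circumradius times cos(pi/5). Then \<open>shift_B\<close> is forced by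
  the half-turn, as in \<open>to_B_eq\<close>.\<close>

definition shift_A :: plane where "shift_A = (- (phi + 1) / 2, 1 - (phi + 2) / 5 * s5)"
definition shift_B :: plane where "shift_B = - shift_A - L_to_pentagon (1, 1)"

text \<open>
  The affine pentagon with vertices \<open>(0, \<phi>), (0, 1), (1, 0), (\<phi>, 0), (1, 1)\<close> lies in the golden L and
  is taken to \<open>Q\<close> by \<open>to_A\<close>; its image under the half-turn about \<open>(1/2, 1/2)\<close> is taken to \<open>-Q\<close> by \<open>to_B\<close>.
\<close>

definition to_A :: "plane \<Rightarrow> plane" where "to_A p = L_to_pentagon p + shift_A"
definition to_B :: "plane \<Rightarrow> plane" where "to_B p = L_to_pentagon p + shift_B"

text \<open>The order is that of \<open>pentagon_vertex\<close>, and the first corner is repeated at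
  index 5, so that \<open>Suc k\<close> needs no reduction modulo 5.\<close>

definition corner :: "nat \<Rightarrow> plane" where
  "corner k = [(0, phi), (0, 1), (1, 0), (phi, 0), (1, 1), (0, phi)] ! k"

lemma corner_simps: "corner 0 = (0, phi)" "corner 1 = (0, 1)" "corner (Suc 0) = (0, 1)" "corner 2 = (1, 0)"
  "corner 3 = (phi, 0)" "corner 4 = (1, 1)" "corner 5 = (0, phi)"
  by (simp_all add: corner_def numeral_eq_Suc)

lemma to_B_eq: "to_B p = - to_A ((1, 1) - p)"
  by (simp add: to_A_def to_B_def shift_B_def linear_diff[OF linear_L_to_pentagon])

lemma pentagon_vertex_eq:
  assumes "k \<le> 5"
  shows "pentagon_vertex k = to_A (corner k)"
proof -
  define r where "r = 2 * (2 * phi - 1) / 5 * s5"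
  have v: "pentagon_vertex k = (- (r * sin (2 * pi * real k / 5)), 1 + r * cos (2 * pi * real k / 5))" for k
    unfolding pentagon_vertex_def circumradius r_def[symmetric] by (simp add: sin_add cos_add)
  \<comment> \<open>Abscissas of the vertices involve the radius only through these two products, in
    which \<open>s5\<close> cancels.\<close>
  have r1: "r * (phi * s5) = 1 / 2" "r * s5 = (phi - 1) / 2"
  proof -
    show "r * (phi * s5) = 1 / 2"
      using circumradius s5_pos phi_gt_1 unfolding sin_2pi_5 r_def[symmetric] by (simp add: field_simps)
    then have "(phi - 1) * (r * (phi * s5)) = (phi - 1) * (1 / 2)"
      by simp
    moreover have "(phi - 1) * (r * (phi * s5)) = (phi * phi - phi) * (r * s5)"
      by (simp add: algebra_simps)
    ultimately show "r * s5 = (phi - 1) / 2"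
      using phi_sq by simp
  qed
  have a2: "2 * pi * 2 / 5 = pi - pi / 5" and a3: "2 * pi * 3 / 5 = pi + pi / 5"
    and a4: "2 * pi * 4 / 5 = 2 * pi - 2 * pi / 5"
    by simp_all
  have trig: "sin (2 * pi * 2 / 5) = s5" "cos (2 * pi * 2 / 5) = - (phi / 2)"
    "sin (2 * pi * 3 / 5) = - s5" "cos (2 * pi * 3 / 5) = - (phi / 2)"
    "sin (2 * pi * 4 / 5) = - (phi * s5)" "cos (2 * pi * 4 / 5) = (phi - 1) / 2"
    unfolding a2 a3 a4 sin_diff cos_diff sin_add cos_add
    by (simp_all add: cos_pi_5 s5_def[symmetric] sin_2pi_5 cos_2pi_5)
  have "sin (2 * pi * 0 / 5) = 0" "cos (2 * pi * 0 / 5) = 1" "sin (2 * pi * 1 / 5) = phi * s5"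
    "cos (2 * pi * 1 / 5) = (phi - 1) / 2" "sin (2 * pi * 5 / 5) = 0" "cos (2 * pi * 5 / 5) = 1"
    using sin_2pi_5 cos_2pi_5 by simp_all
  note trig = trig this
  have y0: "1 + r = s5 * phi + (1 - (phi + 2) / 5 * s5)"
    and y1: "1 + r * ((phi - 1) / 2) = s5 + (1 - (phi + 2) / 5 * s5)"
    and y2: "1 + r * - (phi / 2) = 1 - (phi + 2) / 5 * s5"
    by (simp_all add: r_def phi_phi phi_sq field_simps)
  have "pentagon_vertex 0 = to_A (corner 0)" "pentagon_vertex 1 = to_A (corner 1)"
    unfolding v of_nat_0 of_nat_1 trig using y0 y1 phi_sq r1
    by (simp_all add: corner_simps to_A_def L_to_pentagon_eq shift_A_def field_simps)
  moreover have "pentagon_vertex 2 = to_A (corner 2)" "pentagon_vertex 3 = to_A (corner 3)"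
    "pentagon_vertex 4 = to_A (corner 4)" "pentagon_vertex 5 = to_A (corner 5)"
    unfolding v of_nat_numeral trig using y0 y1 y2 phi_sq r1
    by (simp_all add: corner_simps to_A_def L_to_pentagon_eq shift_A_def field_simps)
  moreover have "k = 0 \<or> k = 1 \<or> k = 2 \<or> k = 3 \<or> k = 4 \<or> k = 5"
    using assms by auto
  ultimately show ?thesis by blast
qed

lemma pentagon_vertex_simps:
  "pentagon_vertex 0 = to_A (0, phi)" "pentagon_vertex 1 = to_A (0, 1)" "pentagon_vertex 2 = to_A (1, 0)"
  "pentagon_vertex 3 = to_A (phi, 0)" "pentagon_vertex 4 = to_A (1, 1)" "pentagon_vertex 5 = to_A (0, phi)"
  using pentagon_vertex_eq[of 0] pentagon_vertex_eq[of 1] pentagon_vertex_eq[of 2] pentagon_vertex_eq[of 3]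
    pentagon_vertex_eq[of 4] pentagon_vertex_eq[of 5] by (simp_all add: corner_simps)

text \<open>One half-plane for each side of the affine pentagon.\<close>

definition set_A :: "plane set" where
  "set_A = {(x, y). 0 \<le> x \<and> 0 \<le> y \<and> 1 \<le> x + y \<and> phi * x + y \<le> phi + 1 \<and> x + phi * y \<le> phi + 1}"

definition set_B :: "plane set" where
  "set_B = {(x, y). x \<le> 1 \<and> y \<le> 1 \<and> x + y \<le> 1 \<and> 0 \<le> phi * x + y \<and> 0 \<le> x + phi * y}"

lemma convex_set_A: "convex set_A"
proof -
  have eq: "set_A = {(x, y). 0 \<le> 1 * x + 0 * y} \<inter> {(x, y). 0 \<le> 0 * x + 1 * y} \<inter> {(x, y). 1 \<le> 1 * x + 1 * y}
      \<inter> {(x, y). phi * x + 1 * y \<le> phi + 1} \<inter> {(x, y). 1 * x + phi * y \<le> phi + 1}"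
    unfolding set_A_def by auto
  show ?thesis
    unfolding eq by (intro convex_Int halfspaces)
qed

lemma convex_hull_3_mem:
  assumes "0 \<le> u" "0 \<le> v" "0 \<le> w" "u + v + w = 1" "{a, b, c} \<subseteq> X"
  shows "u *\<^sub>R a + v *\<^sub>R b + w *\<^sub>R c \<in> convex hull X"
proof -
  have "u *\<^sub>R a + v *\<^sub>R b + w *\<^sub>R c \<in> convex hull {a, b, c}"
    unfolding convex_hull_3 using assms(1-4) by blast
  then show ?thesis
    using hull_mono[OF assms(5)] by blast
qed

text \<open>The pentagon is cut into three triangles by the lines \<open>x = 1\<close> and
  \<open>y = 1\<close>; in each, the weights passed to \<open>convex_hull_3_mem\<close> are
  barycentric coordinates.\<close>

lemma set_A_hull: "set_A = convex hull {(0, phi), (0, 1), (1, 0), (phi, 0), (1, 1)}" (is "_ = convex hull ?V")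
proof
  show "convex hull ?V \<subseteq> set_A"
    by (rule hull_minimal) (use convex_set_A phi_gt_1 phi_sq in \<open>auto simp: set_A_def\<close>)
  show "set_A \<subseteq> convex hull ?V"
  proof
    fix p assume "p \<in> set_A"
    then obtain x y where p: "p = (x, y)" and xy: "0 \<le> x" "0 \<le> y" "1 \<le> x + y" "phi * x + y \<le> phi + 1" "x + phi * y \<le> phi + 1"
      unfolding set_A_def by auto
    consider "x \<le> 1" "y \<le> 1" | "1 \<le> x" | "1 \<le> y" by linarith
    then show "p \<in> convex hull ?V"
    proof cases
      case 1
      then show ?thesis
        using convex_hull_3_mem[of "1 - y" "x + y - 1" "1 - x" "(1, 0)" "(1, 1)" "(0, 1)" ?V] xy p by simp
    next
      case 2
      have "phi * (x - 1) \<ge> 0"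
        using 2 phi_gt_1 by simp
      moreover have "1 - y - phi * (x - 1) \<ge> 0"
        using xy by (simp add: algebra_simps)
      moreover have "x = 1 - y - phi * (x - 1) + (phi * (x - 1) * phi + y)"
        using phi_sq by (simp add: algebra_simps phi_phi)
      ultimately show ?thesis
        using convex_hull_3_mem[of "1 - y - phi * (x - 1)" "phi * (x - 1)" y "(1, 0)" "(phi, 0)" "(1, 1)" ?V] xy p by simp
    next
      case 3
      have "phi * (y - 1) \<ge> 0"
        using 3 phi_gt_1 by simp
      moreover have "1 - x - phi * (y - 1) \<ge> 0"
        using xy by (simp add: algebra_simps)
      moreover have "y = 1 - x - phi * (y - 1) + (phi * (y - 1) * phi + x)"
        using phi_sq by (simp add: algebra_simps phi_phi)
      ultimately show ?thesis
        using convex_hull_3_mem[of "1 - x - phi * (y - 1)" "phi * (y - 1)" x "(0, 1)" "(0, phi)" "(1, 1)" ?V] xy p by simp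
    qed
  qed
qed

lemma to_A_image: "to_A ` X = (+) shift_A ` L_to_pentagon ` X"
  unfolding image_image to_A_def by (simp add: add.commute)

lemma pentagon_eq: "pentagon = to_A ` set_A"
proof -
  have "pentagon_vertex ` {..<5} = to_A ` {(0, phi), (0, 1), (1, 0), (phi, 0), (1, 1)}"
  proof -
    have "{..<5::nat} = {0, 1, 2, 3, 4}" by auto
    then show ?thesis
      by (simp only: image_insert image_empty pentagon_vertex_simps)
  qed
  then show ?thesis
    unfolding pentagon_def set_A_hull to_A_image
    by (simp only: convex_hull_translation convex_hull_linear_image[OF linear_L_to_pentagon])
qed

lemma set_B_iff: "p \<in> set_B \<longleftrightarrow> (1, 1) - p \<in> set_A"
  by (cases p) (auto simp: set_A_def set_B_def algebra_simps)

lemma region_D: "region double_pentagon = to_A ` set_A \<union> to_B ` set_B"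
proof -
  have "uminus ` to_A ` set_A = to_B ` set_B"
  proof (intro equalityI subsetI)
    fix z assume "z \<in> uminus ` to_A ` set_A"
    then obtain p where "p \<in> set_A" "z = - to_A p" by blast
    then show "z \<in> to_B ` set_B"
      by (intro image_eqI[of _ _ "(1, 1) - p"]) (simp_all add: to_B_eq set_B_iff)
  next
    fix z assume "z \<in> to_B ` set_B"
    then obtain p where "p \<in> set_B" "z = to_B p" by blast
    then show "z \<in> uminus ` to_A ` set_A"
      using to_B_eq set_B_iff by blast
  qed
  then show ?thesis
    by (simp add: double_pentagon_def pentagon_eq)
qed

lemma to_A_inj: "to_A p = to_A q \<longleftrightarrow> p = q" and to_B_inj: "to_B p = to_B q \<longleftrightarrow> p = q"
  unfolding to_A_def to_B_def using pentagon_to_L_inverse(1) by (metis add_right_cancel)+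

lemma to_A_pos: "p \<in> set_A \<Longrightarrow> snd (to_A p) > 0"
proof -
  assume "p \<in> set_A"
  then have "s5 * snd p \<ge> 0"
    using s5_pos by (auto simp: set_A_def)
  moreover have "(phi + 2) / 5 * s5 < 1 * 1"
    by (rule mult_strict_mono) (use s5_lt_1 s5_pos phi_lt in auto)
  ultimately show ?thesis
    by (simp add: to_A_def L_to_pentagon_eq shift_A_def)
qed

lemma to_B_neg: "p \<in> set_B \<Longrightarrow> snd (to_B p) < 0"
  using to_A_pos[of "(1, 1) - p"] by (simp add: to_B_eq set_B_iff)

lemma to_A_neq_to_B: "p \<in> set_A \<Longrightarrow> q \<in> set_B \<Longrightarrow> to_A p \<noteq> to_B q"
  using to_A_pos[of p] to_B_neg[of q] by auto

section \<open>Sides and gluings of the double pentagon\<close>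

definition edge :: "nat \<Rightarrow> plane set" where
  "edge k = [{(x, y). x = 0 \<and> 1 \<le> y \<and> y \<le> phi}, {(x, y). x + y = 1 \<and> 0 \<le> x \<and> 0 \<le> y},
    {(x, y). y = 0 \<and> 1 \<le> x \<and> x \<le> phi}, {(x, y). phi * x + y = phi + 1 \<and> 0 \<le> y \<and> y \<le> 1},
    {(x, y). x + phi * y = phi + 1 \<and> 0 \<le> x \<and> x \<le> 1}] ! k"

text \<open>The gluing translation of side \<open>k\<close> in the plane of the L, namely
  \<open>(1, 1) - corner k - corner (Suc k)\<close>. It vanishes for side 1, which the two affine
  pentagons share.\<close>

definition offset :: "nat \<Rightarrow> plane" where
  "offset k = [(1, - phi), (0, 0), (- phi, 1), (- phi, 0), (0, - phi)] ! k"

lemma closed_segment_iff: "p \<in> closed_segment a b \<longleftrightarrow> (\<exists>u. 0 \<le> u \<and> u \<le> 1 \<and> p = (1 - u) *\<^sub>R a + u *\<^sub>R b)"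
  unfolding closed_segment_def by blast

lemma edge_segment:
  assumes "k < 5"
  shows "edge k = closed_segment (corner k) (corner (Suc k))"
proof -
  have sub: "closed_segment (0, 1) (1, 0) = {(x, y). x + y = 1 \<and> 0 \<le> x \<and> 0 \<le> (y::real)}"
  proof (intro equalityI subsetI)
    fix p :: plane assume "p \<in> {(x, y). x + y = 1 \<and> 0 \<le> x \<and> 0 \<le> y}"
    then show "p \<in> closed_segment (0, 1) (1, 0)"
      unfolding closed_segment_iff by (auto intro!: exI[of _ "fst p"])
  qed (auto simp: closed_segment_iff)
  \<comment> \<open>Division by \<open>phi\<close>, whose reciprocal is
    \<open>phi - 1\<close>.\<close>
  have inv: "x = 1 + (phi - 1) * t" if "phi * x = phi + t" for x t
  proof -
    have "phi * (1 + (phi - 1) * t) = phi + t"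
      using phi_sq by (simp add: algebra_simps phi_phi)
    with that show ?thesis
      using phi_gt_1 by (metis mult_cancel_left not_one_less_zero)
  qed
  have sub3: "closed_segment (phi, 0) (1, 1) = {(x, y). phi * x + y = phi + 1 \<and> 0 \<le> y \<and> y \<le> 1}"
  proof (intro equalityI subsetI)
    fix p :: plane assume "p \<in> {(x, y). phi * x + y = phi + 1 \<and> 0 \<le> y \<and> y \<le> 1}"
    then obtain x y where p: "p = (x, y)" "phi * x = phi + (1 - y)" "0 \<le> y" "y \<le> 1"
      by auto
    then show "p \<in> closed_segment (phi, 0) (1, 1)"
      unfolding closed_segment_iff using inv[OF p(2)] by (intro exI[of _ y]) (simp add: algebra_simps)
  qed (auto simp: closed_segment_iff phi_sq phi_phi algebra_simps)
  have sub4: "closed_segment (1, 1) (0, phi) = {(x, y). x + phi * y = phi + 1 \<and> 0 \<le> x \<and> x \<le> 1}"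
  proof (intro equalityI subsetI)
    fix p :: plane assume "p \<in> {(x, y). x + phi * y = phi + 1 \<and> 0 \<le> x \<and> x \<le> 1}"
    then obtain x y where p: "p = (x, y)" "x + phi * y = phi + 1" "0 \<le> x" "x \<le> 1"
      by auto
    from p(2) have "phi * y = phi + (1 - x)" by linarith
    note p = p(1) this p(3,4)
    then show "p \<in> closed_segment (1, 1) (0, phi)"
      unfolding closed_segment_iff using inv[OF p(2)] by (intro exI[of _ "1 - x"]) (simp add: algebra_simps)
  qed (auto simp: closed_segment_iff phi_sq phi_phi algebra_simps)
  have sub0: "closed_segment (0, phi) (0, 1) = {(x, y). x = 0 \<and> 1 \<le> y \<and> y \<le> phi}"
    using closed_segment_vertical[of 1 phi _ _ 0] phi_gt_1 by (auto simp: closed_segment_commute)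
  have sub2: "closed_segment (1, 0) (phi, 0) = {(x, y). y = 0 \<and> 1 \<le> x \<and> x \<le> phi}"
    using closed_segment_horizontal[of 1 phi _ _ 0] phi_gt_1 by auto
  have "k = 0 \<or> k = 1 \<or> k = 2 \<or> k = 3 \<or> k = 4"
    using assms by auto
  then show ?thesis
    by (elim disjE) (simp_all add: edge_def corner_def sub sub0 sub2 sub3 sub4)
qed

lemma to_A_segment: "closed_segment (to_A a) (to_A b) = to_A ` closed_segment a b"
proof -
  have to_A: "to_A p = shift_A + L_to_pentagon p" for p
    by (simp add: to_A_def add.commute)
  show ?thesis
    unfolding to_A_image unfolding to_A closed_segment_translation closed_segment_linear_image[OF linear_L_to_pentagon] ..
qed

lemma pairings_D: "pairings double_pentagon =
    (\<lambda>k. (to_A (corner k), to_A (corner (Suc k)), - to_A (corner k) - to_A (corner (Suc k)))) ` {..<5}"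
  unfolding double_pentagon_def by (auto simp: pentagon_vertex_eq)

lemma to_A_offset:
  assumes "k < 5"
  shows "to_A p + (- to_A (corner k) - to_A (corner (Suc k))) = to_B (p + offset k)"
proof -
  have "k = 0 \<or> k = 1 \<or> k = 2 \<or> k = 3 \<or> k = 4"
    using assms by auto
  then have "p + offset k = p + ((1, 1) - corner k - corner (Suc k))"
    by (elim disjE) (simp_all add: offset_def corner_def zero_prod_def[symmetric])
  then show ?thesis
    by (simp add: to_A_def to_B_def shift_B_def linear_add[OF linear_L_to_pentagon] linear_diff[OF linear_L_to_pentagon])
qed

lemma side_D_cases:
  assumes "(a, b, w) \<in> pairings double_pentagon" "z \<in> closed_segment a b"
  obtains k p where "k < 5" "p \<in> edge k" "z = to_A p" "z + w = to_B (p + offset k)"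
proof -
  obtain k where k: "k < 5" "a = to_A (corner k)" "b = to_A (corner (Suc k))"
    "w = - to_A (corner k) - to_A (corner (Suc k))"
    using assms(1) unfolding pairings_D by auto
  then obtain p where p: "p \<in> edge k" "z = to_A p"
    using assms(2) unfolding k(2,3) to_A_segment edge_segment[OF k(1)] by blast
  then show thesis
    using that[OF k(1) p] to_A_offset[OF k(1)] k(4) by simp
qed

lemma glue_D:
  assumes "k < 5" "p \<in> edge k"
  shows "pt_D (to_B (p + offset k)) = pt_D (to_A p)"
proof -
  have "(to_A (corner k), to_A (corner (Suc k)), - to_A (corner k) - to_A (corner (Suc k))) \<in> pairings double_pentagon"
    using assms(1) unfolding pairings_D by blast
  from pt_glue[OF this, of "to_A p"] show ?thesis
    unfolding to_A_segment edge_segment[OF assms(1), symmetric] to_A_offset[OF assms(1)] using assms(2) by blast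
qed

lemma edge_simps:
  "(x, y) \<in> edge 0 \<longleftrightarrow> x = 0 \<and> 1 \<le> y \<and> y \<le> phi" "(x, y) \<in> edge 1 \<longleftrightarrow> x + y = 1 \<and> 0 \<le> x \<and> 0 \<le> y"
  "(x, y) \<in> edge (Suc 0) \<longleftrightarrow> x + y = 1 \<and> 0 \<le> x \<and> 0 \<le> y"
  "(x, y) \<in> edge 2 \<longleftrightarrow> y = 0 \<and> 1 \<le> x \<and> x \<le> phi" "(x, y) \<in> edge 3 \<longleftrightarrow> phi * x + y = phi + 1 \<and> 0 \<le> y \<and> y \<le> 1"
  "(x, y) \<in> edge 4 \<longleftrightarrow> x + phi * y = phi + 1 \<and> 0 \<le> x \<and> x \<le> 1"
  by (simp_all add: edge_def)

lemma offset_simps: "offset 0 = (1, - phi)" "offset 1 = (0, 0)" "offset (Suc 0) = (0, 0)" "offset 2 = (- phi, 1)" "offset 3 = (- phi, 0)"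
  "offset 4 = (0, - phi)"
  by (simp_all add: offset_def)

lemma less_5_cases:
  assumes "k < (5::nat)"
  obtains "k = 0" | "k = 1" | "k = 2" | "k = 3" | "k = 4"
  using assms by fastforce

lemma glue_D_edges:
  "1 \<le> y \<Longrightarrow> y \<le> phi \<Longrightarrow> pt_D (to_B (1, y - phi)) = pt_D (to_A (0, y))"
  "x + y = 1 \<Longrightarrow> 0 \<le> x \<Longrightarrow> 0 \<le> y \<Longrightarrow> pt_D (to_B (x, y)) = pt_D (to_A (x, y))"
  "1 \<le> x \<Longrightarrow> x \<le> phi \<Longrightarrow> pt_D (to_B (x - phi, 1)) = pt_D (to_A (x, 0))"
  "phi * x + y = phi + 1 \<Longrightarrow> 0 \<le> y \<Longrightarrow> y \<le> 1 \<Longrightarrow> pt_D (to_B (x - phi, y)) = pt_D (to_A (x, y))"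
  "x + phi * y = phi + 1 \<Longrightarrow> 0 \<le> x \<Longrightarrow> x \<le> 1 \<Longrightarrow> pt_D (to_B (x, y - phi)) = pt_D (to_A (x, y))"
  using glue_D[of 0 "(0, y)"] glue_D[of 1 "(x, y)"] glue_D[of 2 "(x, 0)"] glue_D[of 3 "(x, y)"] glue_D[of 4 "(x, y)"]
  by (simp_all add: edge_simps offset_simps)

lemma glue_D_vertices:
  "pt_D (to_A (0, phi)) = pt_D (to_A (1, 0))"
  "pt_D (to_A (0, 1)) = pt_D (to_A (1, 0))"
  "pt_D (to_A (phi, 0)) = pt_D (to_A (1, 0))"
  "pt_D (to_A (1, 1)) = pt_D (to_A (1, 0))"
  "pt_D (to_B (1 - phi, 1)) = pt_D (to_A (1, 0))"
  "pt_D (to_B (1, 1 - phi)) = pt_D (to_A (1, 0))"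
  using glue_D_edges(1)[of 1] glue_D_edges(1)[of phi] glue_D_edges(2)[of 0 1] glue_D_edges(2)[of 1 0]
    glue_D_edges(3)[of 1] glue_D_edges(3)[of phi] glue_D_edges(4)[of 1 1] glue_D_edges(4)[of phi 0]
    glue_D_edges(5)[of 1 1] glue_D_edges(5)[of 0 phi] phi_gt_1 phi_sq
  by simp_all

lemma vertex_points_D: "vertex_points double_pentagon = {pt_D (to_A (1, 0))}"
proof -
  have "pt_D (to_A (corner k)) = pt_D (to_A (1, 0))" if "k \<le> 5" for k
  proof -
    have "k = 0 \<or> k = 1 \<or> k = 2 \<or> k = 3 \<or> k = 4 \<or> k = 5"
      using that by auto
    then show ?thesis
      by (elim disjE) (simp_all add: corner_simps glue_D_vertices)
  qed
  then have *: "P = pt_D (to_A (1, 0))" if "P \<in> vertex_points double_pentagon" for P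
    using that unfolding vertex_points_def pairings_D by auto
  have "(to_A (corner 2), to_A (corner (Suc 2)), - to_A (corner 2) - to_A (corner (Suc 2))) \<in> pairings double_pentagon"
    unfolding pairings_D by (rule image_eqI[of _ _ 2]) simp_all
  from vertex_pointI(1)[OF this] have "pt_D (to_A (1, 0)) \<in> vertex_points double_pentagon"
    by (simp add: corner_simps)
  with * show ?thesis by blast
qed

text \<open>Removing the affine pentagon from the L leaves three triangles. The lower left one stays
  in place, the right one moves left by \<open>phi\<close> and the top one moves down by
  \<open>phi\<close>; together they form \<open>set_B\<close>.\<close>

definition pentagon_pieces :: "(plane set \<times> plane) set" where
  "pentagon_pieces =
    {(set_A, shift_A),
     ({0..1} \<times> {0..1} \<inter> {(x, y). 1 * x + 1 * y \<le> 1}, shift_B),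
     ({1..phi} \<times> {0..1} \<inter> {(x, y). phi + 1 \<le> phi * x + 1 * y}, shift_B - L_to_pentagon (phi, 0)),
     ({0..1} \<times> {1..phi} \<inter> {(x, y). phi + 1 \<le> 1 * x + phi * y}, shift_B - L_to_pentagon (0, phi))}"

abbreviation moved_D :: "plane \<Rightarrow> plane set" where "moved_D \<equiv> moved L_to_pentagon pentagon_pieces"

lemma moved_pentagon: "z \<in> moved_D (x, y) \<longleftrightarrow>
    (x, y) \<in> set_A \<and> z = to_A (x, y) \<or>
    0 \<le> x \<and> 0 \<le> y \<and> x + y \<le> 1 \<and> z = to_B (x, y) \<or>
    1 \<le> x \<and> x \<le> phi \<and> 0 \<le> y \<and> y \<le> 1 \<and> phi + 1 \<le> phi * x + y \<and> z = to_B (x - phi, y) \<or>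
    0 \<le> x \<and> x \<le> 1 \<and> 1 \<le> y \<and> y \<le> phi \<and> phi + 1 \<le> x + phi * y \<and> z = to_B (x, y - phi)"
proof -
  have B: "to_B (x - phi, y) = L_to_pentagon (x, y) + (shift_B - L_to_pentagon (phi, 0))"
    "to_B (x, y - phi) = L_to_pentagon (x, y) + (shift_B - L_to_pentagon (0, phi))"
    using linear_diff[OF linear_L_to_pentagon, of "(x, y)" "(phi, 0)"]
      linear_diff[OF linear_L_to_pentagon, of "(x, y)" "(0, phi)"]
    by (simp_all add: to_B_def)
  have T0: "0 \<le> x \<and> x \<le> 1 \<and> 0 \<le> y \<and> y \<le> 1 \<and> x + y \<le> 1 \<longleftrightarrow> 0 \<le> x \<and> 0 \<le> y \<and> x + y \<le> 1"
    by auto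
  have "z \<in> moved_D (x, y) \<longleftrightarrow>
    (x, y) \<in> set_A \<and> z = to_A (x, y) \<or>
    (0 \<le> x \<and> x \<le> 1 \<and> 0 \<le> y \<and> y \<le> 1 \<and> x + y \<le> 1) \<and> z = to_B (x, y) \<or>
    (1 \<le> x \<and> x \<le> phi \<and> 0 \<le> y \<and> y \<le> 1 \<and> phi + 1 \<le> phi * x + y) \<and> z = to_B (x - phi, y) \<or>
    (0 \<le> x \<and> x \<le> 1 \<and> 1 \<le> y \<and> y \<le> phi \<and> phi + 1 \<le> x + phi * y) \<and> z = to_B (x, y - phi)"
    unfolding pentagon_pieces_def B unfolding to_A_def to_B_def mem_moved_insert moved_empty by (simp add: conj_assoc)
  then show ?thesis
    unfolding T0 by (simp add: conj_assoc)
qed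

lemma phi_mult_bounds:
  "0 \<le> x \<Longrightarrow> 0 \<le> phi * x" "x \<le> 1 \<Longrightarrow> phi * x \<le> phi" "1 \<le> x \<Longrightarrow> phi \<le> phi * x" "x \<le> phi \<Longrightarrow> phi * x \<le> phi + 1"
  "phi \<le> phi * x \<Longrightarrow> 1 \<le> x" "phi * x \<le> phi + 1 \<Longrightarrow> x \<le> phi" "x \<le> 0 \<Longrightarrow> phi * x \<le> 0"
  unfolding phi_sq[symmetric] using phi_gt_1
  by (simp_all add: mult_le_0_iff zero_le_mult_iff)

text \<open>Multiplication by \<open>phi\<close> turns \<open>phi * x + y\<close> into
  \<open>phi * x + (x + phi * y)\<close>. So beyond \<open>x = 1\<close> or \<open>x = 0\<close>,
  one slanted half-plane is contained in the other.\<close>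

lemma phi_halfplanes:
  "phi * x + y \<le> phi + 1 \<Longrightarrow> 1 \<le> x \<Longrightarrow> x + phi * y \<le> phi + 1" "0 \<le> phi * x + y \<Longrightarrow> x \<le> 0 \<Longrightarrow> 0 \<le> x + phi * y"
proof -
  have e: "phi * (phi * x + y) = phi * x + x + phi * y"
    by (simp add: distrib_left phi_phi)
  have e': "phi * (phi + 1) = phi + 1 + phi"
    by (simp add: distrib_left phi_sq)
  show "x + phi * y \<le> phi + 1" if "phi * x + y \<le> phi + 1" "1 \<le> x"
    using mult_left_mono[OF that(1), of phi] phi_gt_1 phi_mult_bounds(3)[OF that(2)] unfolding e e' by linarith
  show "0 \<le> x + phi * y" if "0 \<le> phi * x + y" "x \<le> 0"
    using mult_left_mono[OF that(1), of phi] phi_gt_1 phi_mult_bounds(7)[OF that(2)] unfolding e by simp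
qed

lemma mem_set_A: "(x, y) \<in> set_A \<longleftrightarrow> 0 \<le> x \<and> 0 \<le> y \<and> 1 \<le> x + y \<and> phi * x + y \<le> phi + 1 \<and> x + phi * y \<le> phi + 1"
  and mem_set_B: "(x, y) \<in> set_B \<longleftrightarrow> x \<le> 1 \<and> y \<le> 1 \<and> x + y \<le> 1 \<and> 0 \<le> phi * x + y \<and> 0 \<le> x + phi * y"
  by (simp_all add: set_A_def set_B_def)

lemma cover_L: "(x, y) \<in> region golden_L \<longleftrightarrow> (x, y) \<in> set_A \<or> 0 \<le> x \<and> 0 \<le> y \<and> x + y \<le> 1 \<or>
      1 \<le> x \<and> x \<le> phi \<and> 0 \<le> y \<and> y \<le> 1 \<and> phi + 1 \<le> phi * x + y \<or>
      0 \<le> x \<and> x \<le> 1 \<and> 1 \<le> y \<and> y \<le> phi \<and> phi + 1 \<le> x + phi * y" (is "_ \<longleftrightarrow> ?R")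
proof
  assume R: "(x, y) \<in> region golden_L"
  then have pos: "0 \<le> x" "0 \<le> y"
    by (simp_all add: region_L)
  consider "x + y \<le> 1" | "1 \<le> x + y" "x \<le> 1" "y \<le> 1" | "1 \<le> x" "x \<le> phi" "y \<le> 1" | "1 \<le> y" "y \<le> phi" "x \<le> 1"
    using R unfolding region_L by linarith
  then show ?R
  proof cases
    case 2
    then show ?thesis
      unfolding mem_set_A using phi_mult_bounds(2)[OF 2(2)] phi_mult_bounds(2)[OF 2(3)] pos by linarith
  next
    case 3
    then show ?thesis
      unfolding mem_set_A using phi_halfplanes(1)[of x y] pos by linarith
  next
    case 4
    then show ?thesis
      unfolding mem_set_A using phi_halfplanes(1)[of y x] pos by (smt (verit))
  qed (use pos in blast)
next
  assume ?R
  moreover have "(x, y) \<in> region golden_L" if "(x, y) \<in> set_A"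
  proof (cases "y \<le> 1")
    case True
    then show ?thesis
      using that phi_mult_bounds(6)[of x] unfolding mem_set_A region_L by linarith
  next
    case False
    then show ?thesis
      using that phi_mult_bounds(3)[of y] phi_mult_bounds(6)[of y] unfolding mem_set_A region_L by linarith
  qed
  ultimately show "(x, y) \<in> region golden_L"
    unfolding region_L using phi_gt_1 by linarith
qed

text \<open>The images are described from the side of the target: points mapped to the same place
  have the same \<open>(x, y)\<close> in \<open>set_B\<close>, and only the translation can
  differ.\<close>

lemma moved_pentagon_cases:
  assumes "z \<in> moved_D p"
  obtains (A) "p \<in> set_A" "z = to_A p"
  | (B) x y where "(x, y) \<in> set_B" "z = to_B (x, y)" "p = (x, y) \<and> 0 \<le> x \<and> 0 \<le> y \<and> x + y \<le> 1 \<or>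
      p = (x + phi, y) \<and> x \<le> 0 \<and> 0 \<le> y \<and> y \<le> 1 \<or> p = (x, y + phi) \<and> y \<le> 0 \<and> 0 \<le> x \<and> x \<le> 1"
proof -
  obtain x y where p: "p = (x, y)" by fastforce
  have e: "phi * (x - phi) = phi * x - phi - 1" "phi * (y - phi) = phi * y - phi - 1"
    by (simp_all add: right_diff_distrib phi_sq)
  have 0: "(x, y) \<in> set_B" if "0 \<le> x" "0 \<le> y" "x + y \<le> 1"
    unfolding mem_set_B using that phi_mult_bounds(1)[OF that(1)] phi_mult_bounds(1)[OF that(2)] by linarith
  have 1: "(x - phi, y) \<in> set_B" if "x \<le> phi" "y \<le> 1" "phi + 1 \<le> phi * x + y"
    unfolding mem_set_B using that phi_halfplanes(2)[of "x - phi" y] unfolding e by (smt (verit))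
  have 2: "(x, y - phi) \<in> set_B" if "x \<le> 1" "y \<le> phi" "phi + 1 \<le> x + phi * y"
    unfolding mem_set_B using that phi_halfplanes(2)[of "y - phi" x] unfolding e by (smt (verit))
  show thesis
    using assms unfolding p moved_pentagon
  proof (elim disjE conjE)
    assume "(x, y) \<in> set_A" "z = to_A (x, y)"
    then show thesis by (intro A) (simp_all add: p)
  next
    assume "0 \<le> x" "0 \<le> y" "x + y \<le> 1" "z = to_B (x, y)"
    then show thesis by (intro B[OF 0]) (simp_all add: p)
  next
    assume "1 \<le> x" "x \<le> phi" "0 \<le> y" "y \<le> 1" "phi + 1 \<le> phi * x + y" "z = to_B (x - phi, y)"
    then show thesis by (intro B[OF 1]) (simp_all add: p)
  next
    assume "0 \<le> x" "x \<le> 1" "1 \<le> y" "y \<le> phi" "phi + 1 \<le> x + phi * y" "z = to_B (x, y - phi)"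
    then show thesis by (intro B[OF 2]) (simp_all add: p)
  qed
qed

text \<open>Cutting and regluing: the remaining work is to match the sides of one surface with sides
  or cuts of the other.\<close>

lemma pentagon_L: "affine_equivalence golden_L double_pentagon L_to_pentagon pentagon_to_L pentagon_pieces"
proof (rule affine_equivalenceI[where x = "(1, 0)" and x' = "to_A (1, 0)"])
  show "linear L_to_pentagon" "linear pentagon_to_L" "pentagon_to_L (L_to_pentagon x) = x"
    "L_to_pentagon (pentagon_to_L x) = x" for x
    by (rule linear_L_to_pentagon linear_pentagon_to_L pentagon_to_L_inverse)+
  show "finite pentagon_pieces"
    by (simp add: pentagon_pieces_def)
  have "compact set_A"
    unfolding set_A_hull by (rule finite_imp_compact_convex_hull) simp
  then show "compact R" if "(R, \<tau>) \<in> pentagon_pieces" for R \<tau>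
    using that unfolding pentagon_pieces_def
    by (elim insertE emptyE Pair_inject; hypsubst) (assumption | intro compact_Int_closed compact_convex_box halfspaces)+
  show "convex R" if "(R, \<tau>) \<in> pentagon_pieces" for R \<tau>
    using that unfolding pentagon_pieces_def
    by (elim insertE emptyE Pair_inject; hypsubst) (rule convex_set_A | intro convex_Int compact_convex_box halfspaces)+
  show "p \<in> region golden_L \<longleftrightarrow> (\<exists>p'. p' \<in> moved_D p)" for p
  proof -
    obtain x y where p: "p = (x, y)" by fastforce
    show ?thesis
      unfolding p moved_pentagon cover_L by blast
  qed
  show "z \<in> region double_pentagon \<longleftrightarrow> (\<exists>p. z \<in> moved_D p)" for z
  proof
    assume "z \<in> region double_pentagon"
    then consider p where "p \<in> set_A" "z = to_A p" | p where "p \<in> set_B" "z = to_B p"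
      unfolding region_D by blast
    then show "\<exists>p. z \<in> moved_D p"
    proof cases
      case (1 p)
      then show ?thesis
        by (intro exI[of _ p]) (cases p; simp add: moved_pentagon)
    next
      case (2 p)
      obtain x y where p: "p = (x, y)" by fastforce
      have xy: "x \<le> 1" "y \<le> 1" "x + y \<le> 1" "0 \<le> phi * x + y" "0 \<le> x + phi * y"
        using 2(1) unfolding p set_B_def by simp_all
      have e: "phi * (x + phi) = phi * x + phi + 1" "phi * (y + phi) = phi * y + phi + 1"
        by (simp_all add: algebra_simps phi_sq)
      \<comment> \<open>According to its signs, a point of \<open>set_B\<close> goes back into the L
        unchanged, by \<open>phi\<close> to the right or by \<open>phi\<close> upwards.\<close>
      consider "0 \<le> x" "0 \<le> y" | "x \<le> 0" | "y \<le> 0" by linarith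
      then show ?thesis
      proof cases
        case 1
        then have "z \<in> moved_D (x, y)"
          unfolding moved_pentagon using xy 2(2) p by simp
        then show ?thesis by blast
      next
        case 2
        have "0 \<le> y"
          using xy phi_mult_bounds(7)[OF 2] by linarith
        moreover have "1 \<le> x + phi"
          by (rule phi_mult_bounds(5)) (use xy e in linarith)
        moreover have "x + phi \<le> phi"
          using 2 by simp
        ultimately have "z \<in> moved_D (x + phi, y)"
          unfolding moved_pentagon e using xy \<open>z = to_B p\<close> p by simp
        then show ?thesis by blast
      next
        case 3
        have "0 \<le> x"
          using xy phi_mult_bounds(7)[OF 3] by linarith
        moreover have "1 \<le> y + phi"
          by (rule phi_mult_bounds(5), unfold e(2)) (use xy(1,5) in linarith)
        moreover have "y + phi \<le> phi"
          using 3 by simp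
        ultimately have "z \<in> moved_D (x, y + phi)"
          unfolding moved_pentagon e using xy \<open>z = to_B p\<close> p by simp
        then show ?thesis by blast
      qed
    qed
  next
    assume "\<exists>p. z \<in> moved_D p"
    then obtain p where "z \<in> moved_D p" ..
    then show "z \<in> region double_pentagon"
      unfolding region_D by (cases rule: moved_pentagon_cases) blast+
  qed
  show "pt_D z = pt_D z'"
    if z: "z \<in> moved_D p" "z' \<in> moved_D p" for p z z'
  proof -
    obtain x y where p: "p = (x, y)" by fastforce
    let ?T0 = "0 \<le> x \<and> 0 \<le> y \<and> x + y \<le> 1"
    let ?T1 = "1 \<le> x \<and> x \<le> phi \<and> 0 \<le> y \<and> y \<le> 1 \<and> phi + 1 \<le> phi * x + y"
    let ?T2 = "0 \<le> x \<and> x \<le> 1 \<and> 1 \<le> y \<and> y \<le> phi \<and> phi + 1 \<le> x + phi * y"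
    define P where "P = pt_D (to_A (x, y))"
    define P0 where "P0 = pt_D (to_B (x, y))"
    define P1 where "P1 = pt_D (to_B (x - phi, y))"
    define P2 where "P2 = pt_D (to_B (x, y - phi))"
    have a0: "P0 = P" if "(x, y) \<in> set_A" "?T0"
      using that unfolding P_def P0_def mem_set_A by (intro glue_D_edges(2)) auto
    have a1: "P1 = P" if "(x, y) \<in> set_A" "?T1"
      using that unfolding P_def P1_def mem_set_A by (intro glue_D_edges(4)) auto
    have a2: "P2 = P" if "(x, y) \<in> set_A" "?T2"
      using that unfolding P_def P2_def mem_set_A by (intro glue_D_edges(5)) auto
    \<comment> \<open>The lower left triangle meets neither of the other two, and those meet only in
      (1, 1). Each triangle meets \<open>set_A\<close> inside a side of the pentagon.\<close>
    have not01: "\<not> (?T0 \<and> ?T1)" "\<not> (?T0 \<and> ?T2)"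
      using phi_mult_bounds(2)[of x] phi_mult_bounds(2)[of y] phi_gt_1 by (smt (verit))+
    have 12: "P1 = P2" if "?T1" "?T2"
    proof -
      have "x = 1" "y = 1" using that by auto
      then show ?thesis
        unfolding P1_def P2_def by (simp add: glue_D_vertices)
    qed
    have "(x, y) \<in> set_A \<and> pt_D q = P \<or> ?T0 \<and> pt_D q = P0 \<or>
        ?T1 \<and> pt_D q = P1 \<or> ?T2 \<and> pt_D q = P2"
      if "q \<in> moved_D p" for q
      using that unfolding P_def P0_def P1_def P2_def p moved_pentagon by blast
    from this[OF z(1)] this[OF z(2)] show ?thesis
      using a0 a1 a2 not01 12 by metis
  qed
  show "pt_L p = pt_L q"
    if pq: "z \<in> moved_D p" "z \<in> moved_D q" for p q z
  proof -
    from pq(1) show ?thesis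
    proof (cases rule: moved_pentagon_cases)
      case A
      from pq(2) show ?thesis
        by (cases rule: moved_pentagon_cases) (use A to_A_inj to_A_neq_to_B in \<open>metis+\<close>)
    next
      case p: (B x y)
      from pq(2) show ?thesis
      proof (cases rule: moved_pentagon_cases)
        case A
        then show ?thesis
          using p to_A_neq_to_B by metis
      next
        case q: (B x' y')
        then have "x' = x" "y' = y"
          using p(2) to_B_inj by (metis Pair_inject)+
        \<comment> \<open>A point of \<open>set_B\<close> comes from different points of the L only
          if a coordinate is 0, and then those are glued.\<close>
        have "y \<le> 1" "x \<le> 1"
          using p(1) by (simp_all add: mem_set_B)
        then show ?thesis
          using p(3) q(3) unfolding \<open>x' = x\<close> \<open>y' = y\<close>
          by (elim disjE conjE) (auto simp: glue_L glue_L_vertices)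
      qed
    qed
  qed
  \<comment> \<open>The right and top sides of the L become diagonals of -Q, so their glued points
    go to one point. The other two pairs become pentagon sides 0 and 2.\<close>
  show "\<exists>z z'. z \<in> moved_D p \<and> z' \<in> moved_D (p + w) \<and>
      pt_D z = pt_D z'"
    if "(a, b, w) \<in> pairings golden_L" "p \<in> closed_segment a b" for a b w p
    using that
  proof (cases rule: side_L_cases)
    case (right y)
    then have "to_B (0, y) \<in> moved_D p" "to_B (0, y) \<in> moved_D (p + w)"
      using phi_gt_1 phi_sq by (auto simp: moved_pentagon)
    then show ?thesis by blast
  next
    case (upper_right y)
    then have "to_B (1, y - phi) \<in> moved_D p" "to_A (0, y) \<in> moved_D (p + w)"
      using phi_gt_1 phi_sq phi_mult_bounds(3,4)[of y] by (simp_all add: moved_pentagon mem_set_A)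
    then show ?thesis using glue_D_edges(1)[OF upper_right(2,3)] by blast
  next
    case (right_top x)
    then have "to_B (x - phi, 1) \<in> moved_D p" "to_A (x, 0) \<in> moved_D (p + w)"
      using phi_gt_1 phi_sq phi_mult_bounds(3,4)[of x] by (simp_all add: moved_pentagon mem_set_A)
    then show ?thesis using glue_D_edges(3)[OF right_top(2,3)] by blast
  next
    case (top x)
    then have "to_B (x, 0) \<in> moved_D p" "to_B (x, 0) \<in> moved_D (p + w)"
      using phi_gt_1 phi_sq by (auto simp: moved_pentagon)
    then show ?thesis by blast
  qed
  show "\<exists>p q. z \<in> moved_D p \<and> z + w \<in> moved_D q \<and>
      pt_L p = pt_L q"
    if side: "(a, b, w) \<in> pairings double_pentagon" "z \<in> closed_segment a b" for a b w z
  proof -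
    obtain k p where k: "k < 5" "p \<in> edge k" "z = to_A p" "z + w = to_B (p + offset k)"
      by (rule side_D_cases[OF side])
    obtain x y where p: "p = (x, y)" by fastforce
    have A: "z \<in> moved_D (x, y)" if "(x, y) \<in> set_A"
      unfolding moved_pentagon k(3) p using that by simp
    \<comment> \<open>Sides 0 and 2 of the pentagon lie on glued sides of the L. On sides 1, 3 and 4
      the pentagon meets a triangle, so both members of the pair come from the same point.\<close>
    from k(1) show ?thesis
    proof (cases rule: less_5_cases)
      case 1
      then have xy: "x = 0" "1 \<le> y" "y \<le> phi"
        using k(2) by (simp_all add: p edge_simps)
      have "z + w \<in> moved_D (1, y)"
        unfolding moved_pentagon k(4) 1 using xy phi_mult_bounds(3)[OF xy(2)] by (simp add: offset_simps p)
      moreover have "(x, y) \<in> set_A"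
        unfolding mem_set_A using xy phi_mult_bounds(4)[OF xy(3)] phi_gt_1 by simp
      ultimately show ?thesis
        using A glue_L(2)[OF xy(2,3)] unfolding xy(1) by metis
    next
      case 2
      then have xy: "x + y = 1" "0 \<le> x" "0 \<le> y"
        using k(2) by (simp_all only: p edge_simps)
      have "z + w \<in> moved_D (x, y)"
        unfolding moved_pentagon k(4) 2 using xy by (simp only: offset_simps p) simp
      moreover have "(x, y) \<in> set_A"
        unfolding mem_set_A using xy phi_mult_bounds(2)[of x] phi_mult_bounds(2)[of y] by simp
      ultimately show ?thesis
        using A by blast
    next
      case 3
      then have xy: "y = 0" "1 \<le> x" "x \<le> phi"
        using k(2) by (simp_all add: p edge_simps)
      have "z + w \<in> moved_D (x, 1)"
        unfolding moved_pentagon k(4) 3 using xy phi_mult_bounds(3)[OF xy(2)] by (simp add: offset_simps p)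
      moreover have "(x, y) \<in> set_A"
        unfolding mem_set_A using xy phi_mult_bounds(4)[OF xy(3)] phi_gt_1 by simp
      ultimately show ?thesis
        using A glue_L(3)[OF xy(2,3)] unfolding xy(1) by metis
    next
      case 4
      then have xy: "phi * x + y = phi + 1" "0 \<le> y" "y \<le> 1"
        using k(2) by (simp_all add: p edge_simps)
      have x: "1 \<le> x" "x \<le> phi"
        using xy phi_mult_bounds(5,6)[of x] by simp_all
      have "z + w \<in> moved_D (x, y)"
        unfolding moved_pentagon k(4) 4 using xy x by (simp add: offset_simps p)
      moreover have "(x, y) \<in> set_A"
        unfolding mem_set_A using xy x phi_halfplanes(1)[of x y] by simp
      ultimately show ?thesis
        using A by blast
    next
      case 5
      then have xy: "x + phi * y = phi + 1" "0 \<le> x" "x \<le> 1"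
        using k(2) by (simp_all add: p edge_simps)
      have y: "1 \<le> y" "y \<le> phi"
        using xy phi_mult_bounds(5,6)[of y] by simp_all
      have "z + w \<in> moved_D (x, y)"
        unfolding moved_pentagon k(4) 5 using xy y by (simp add: offset_simps p)
      moreover have "(x, y) \<in> set_A"
        unfolding mem_set_A using xy y phi_halfplanes(1)[of y x] by (simp add: add.commute)
      ultimately show ?thesis
        using A by blast
    qed
  qed
  show "vertex_points golden_L = {pt_L (1, 0)}"
    by (simp add: vertex_points_L glue_L_vertices)
  show "vertex_points double_pentagon = {pt_D (to_A (1, 0))}"
    by (rule vertex_points_D)
  show "to_A (1, 0) \<in> moved_D (1, 0)"
    using phi_gt_1 by (simp add: moved_pentagon set_A_def)
qed

section \<open>Crossings of the pentagon sides\<close>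

lemma edge_subset_A: "k < 5 \<Longrightarrow> edge k \<subseteq> set_A"
proof
  fix p assume "k < 5" "p \<in> edge k"
  moreover have "corner k \<in> set_A" if "k \<le> 5" for k
  proof -
    have "k = 0 \<or> k = 1 \<or> k = 2 \<or> k = 3 \<or> k = 4 \<or> k = 5"
      using that by auto
    then show ?thesis
      using phi_gt_1 phi_sq by (elim disjE) (simp_all add: corner_simps mem_set_A)
  qed
  ultimately show "p \<in> set_A"
    using edge_segment[of k] closed_segment_subset[OF _ _ convex_set_A, of "corner k" "corner (Suc k)"] by auto
qed

text \<open>By the formula for \<open>offset\<close>, this point is
  \<open>corner k + corner (Suc k) - p\<close>, the reflection of \<open>p\<close> in the midpoint
  of the side.\<close>

lemma edge_offset_reflect:
  assumes "k < 5" "p \<in> edge k"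
  shows "(1, 1) - (p + offset k) \<in> edge k"
proof -
  obtain x y where p: "p = (x, y)" by fastforce
  from assms(1) show ?thesis
    using assms(2) phi_sq unfolding p
    by (cases rule: less_5_cases) (auto simp: edge_simps offset_simps algebra_simps)
qed

lemma edge_offset_in_B: "k < 5 \<Longrightarrow> p \<in> edge k \<Longrightarrow> p + offset k \<in> set_B"
  using edge_offset_reflect edge_subset_A unfolding set_B_iff by blast

lemma edge_disjoint:
  assumes "k < 5" "k' < 5" "k \<noteq> k'" "p \<in> edge k" "p \<in> edge k'"
  shows "p \<in> {(0, phi), (0, 1), (1, 0), (phi, 0), (1, 1)}"
proof -
  have less: "p \<in> {(0, phi), (0, 1), (1, 0), (phi, 0), (1, 1)}"
    if "k < k'" "k' < 5" "p \<in> edge k" "p \<in> edge k'" for k k'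
  proof -
    obtain x y where p: "p = (x, y)" by fastforce
    have e: "z = phi" if "phi * z = phi + 1" for z
      using that phi_gt_1 unfolding phi_sq[symmetric] by simp
    have 13: False if "u + w = 1" "0 \<le> u" "0 \<le> w" "phi * u + w = phi + 1" for u w
    proof -
      have "phi * u \<le> phi"
        using that by (intro phi_mult_bounds(2)) simp
      then have "u = 0"
        using that by simp
      then show False
        using that phi_gt_1 by simp
    qed
    have "k = 0 \<and> k' = 1 \<or> k = 0 \<and> k' = 2 \<or> k = 0 \<and> k' = 3 \<or> k = 0 \<and> k' = 4 \<or> k = 1 \<and> k' = 2 \<or>
        k = 1 \<and> k' = 3 \<or> k = 1 \<and> k' = 4 \<or> k = 2 \<and> k' = 3 \<or> k = 2 \<and> k' = 4 \<or> k = 3 \<and> k' = 4"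
      using that(1,2) by presburger
    then show ?thesis
    proof (elim disjE conjE)
      assume "k = 1" "k' = 3"
      then show ?thesis
        using 13[of x y] that(3,4) by (simp add: p edge_simps)
    next
      assume "k = 1" "k' = 4"
      then show ?thesis
        using 13[of y x] that(3,4) by (simp add: p edge_simps add.commute)
    next
      assume "k = 3" "k' = 4"
      then have xy: "phi * x + y = phi + 1" "y \<le> 1" "x \<le> 1"
        using that(3,4) by (simp_all add: p edge_simps)
      then have "x = 1"
        using phi_mult_bounds(5)[of x] by linarith
      then show ?thesis
        using xy p by simp
    qed (use that(3,4) phi_gt_1 e[of x] e[of y] in \<open>auto simp: p edge_simps\<close>)
  qed
  show ?thesis
    using less[of k k'] less[of k' k] assms by linarith
qed

text \<open>The indicator of the two points is preserved by every gluing: a non-vertex point of a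
  side lies on no other side, and the same holds for its partner.\<close>

lemma pt_D_edge:
  assumes k: "k < 5" "e \<in> edge k" and nv: "pt_D (to_A e) \<noteq> pt_D (to_A (1, 0))"
    and z: "pt_D z = pt_D (to_A e)"
  shows "z = to_A e \<or> z = to_B (e + offset k)"
proof -
  have noncorner: "e \<notin> {(0, phi), (0, 1), (1, 0), (phi, 0), (1, 1)}"
    using nv glue_D_vertices by auto
  have noncorner': "(1, 1) - (e + offset k) \<notin> {(0, phi), (0, 1), (1, 0), (phi, 0), (1, 1)}"
  proof
    assume "(1, 1) - (e + offset k) \<in> {(0, phi), (0, 1), (1, 0), (phi, 0), (1, 1)}"
    moreover have "(1, 1) - (e + offset k) \<in> edge k"
      by (rule edge_offset_reflect[OF k])
    ultimately have "e \<in> {(0, phi), (0, 1), (1, 0), (phi, 0), (1, 1)}"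
      using phi_gt_1 by (cases e, cases rule: less_5_cases[OF k(1)]) (auto simp: edge_simps offset_simps)
    with noncorner show False ..
  qed
  define f where "f z \<longleftrightarrow> z = to_A e \<or> z = to_B (e + offset k)" for z
  have "f z = f (to_A e)"
  proof (rule pt_invariant[OF _ z])
    fix a b w z' assume "(a, b, w) \<in> pairings double_pentagon" "z' \<in> closed_segment a b"
    then obtain k' p where k': "k' < 5" "p \<in> edge k'" "z' = to_A p" "z' + w = to_B (p + offset k')"
      by (rule side_D_cases)
    have 1: "f z' \<longleftrightarrow> p = e"
      unfolding f_def k'(3) to_A_inj
      using to_A_neq_to_B[of p "e + offset k"] edge_subset_A[OF k'(1)] k'(2) edge_offset_in_B[OF k] by blast
    have "to_A e \<noteq> to_B (p + offset k')"
      using to_A_neq_to_B edge_subset_A[OF k(1)] k(2) edge_offset_in_B[OF k'(1,2)] by blast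
    then have 2: "f (z' + w) \<longleftrightarrow> p + offset k' = e + offset k"
      unfolding f_def k'(4) to_B_inj by metis
    have "k' = k" if "p = e"
      using edge_disjoint[OF k(1) k'(1) _ k(2)] k'(2) that noncorner by blast
    \<comment> \<open>Reflection in the midpoints turns equal points on partner sides into a common
      point of \<open>edge k\<close> and \<open>edge k'\<close> that is no corner.\<close>
    moreover have "k' = k" if eq: "p + offset k' = e + offset k"
      using edge_disjoint[OF k(1) k'(1) _ edge_offset_reflect[OF k]] edge_offset_reflect[OF k'(1,2)] noncorner'
      unfolding eq by blast
    ultimately show "f (z' + w) = f z'"
      unfolding 1 2 by (metis add_right_cancel)
  qed
  then show ?thesis
    by (simp add: f_def)
qed

lemma eventually_pos:
  fixes a b :: real
  assumes "a > 0"
  shows "\<forall>\<^sub>F s in at_right 0. a + s * b > 0"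
proof -
  have "((\<lambda>s. a + s * b) \<longlongrightarrow> a + 0 * b) (at_right 0)"
    by (intro tendsto_intros)
  then show ?thesis
    using assms order_tendstoD(1) by fastforce
qed

lemma region_D_pos: "z \<in> region double_pentagon \<Longrightarrow> snd z > 0 \<Longrightarrow> z \<in> to_A ` set_A"
  and region_D_neg: "z \<in> region double_pentagon \<Longrightarrow> snd z < 0 \<Longrightarrow> z \<in> to_B ` set_B"
  and region_D_nonzero: "z \<in> region double_pentagon \<Longrightarrow> snd z \<noteq> 0"
proof -
  have "z \<in> to_A ` set_A \<and> snd z > 0 \<or> z \<in> to_B ` set_B \<and> snd z < 0" if "z \<in> region double_pentagon"
    using that to_A_pos to_B_neg unfolding region_D by blast
  then show "z \<in> region double_pentagon \<Longrightarrow> snd z > 0 \<Longrightarrow> z \<in> to_A ` set_A"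
    "z \<in> region double_pentagon \<Longrightarrow> snd z < 0 \<Longrightarrow> z \<in> to_B ` set_B"
    "z \<in> region double_pentagon \<Longrightarrow> snd z \<noteq> 0"
    by linarith+
qed

text \<open>The sign of the height separates the two pentagons, so near a point of Q the region is Q
  alone.\<close>

lemma to_A_germ:
  assumes "e \<in> set_A" "\<forall>\<^sub>F s in at_right 0. to_A e + s *\<^sub>R L_to_pentagon w \<in> region double_pentagon"
  obtains s where "s > 0" "e + s *\<^sub>R w \<in> set_A"
proof -
  have "\<forall>\<^sub>F s in at_right 0. snd (to_A e) + s * snd (L_to_pentagon w) > 0"
    by (rule eventually_pos[OF to_A_pos[OF assms(1)]])
  with assms(2) have "\<forall>\<^sub>F s in at_right (0::real). e + s *\<^sub>R w \<in> set_A"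
  proof eventually_elim
    case (elim s)
    have eq: "to_A e + s *\<^sub>R L_to_pentagon w = to_A (e + s *\<^sub>R w)"
      by (simp add: to_A_def linear_add[OF linear_L_to_pentagon] linear_scale[OF linear_L_to_pentagon])
    have "snd (to_A (e + s *\<^sub>R w)) > 0"
      using elim(2) unfolding eq[symmetric] by simp
    then have "to_A (e + s *\<^sub>R w) \<in> to_A ` set_A"
      using region_D_pos elim(1) unfolding eq by blast
    then show ?case
      unfolding image_iff to_A_inj by simp
  qed
  then obtain \<epsilon> where "\<epsilon> > 0" "\<forall>s. 0 < s \<longrightarrow> s < \<epsilon> \<longrightarrow> e + s *\<^sub>R w \<in> set_A"
    unfolding eventually_at_right_0 by blast
  then show thesis
    using that[of "\<epsilon> / 2"] by simp
qed

lemma to_B_germ: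
  assumes "e \<in> set_B" "\<forall>\<^sub>F s in at_right 0. to_B e + s *\<^sub>R L_to_pentagon w \<in> region double_pentagon"
  obtains s where "s > 0" "e + s *\<^sub>R w \<in> set_B"
proof -
  have "\<forall>\<^sub>F s in at_right 0. - snd (to_B e) + s * (- snd (L_to_pentagon w)) > 0"
    by (rule eventually_pos) (use to_B_neg[OF assms(1)] in simp)
  with assms(2) have "\<forall>\<^sub>F s in at_right (0::real). e + s *\<^sub>R w \<in> set_B"
  proof eventually_elim
    case (elim s)
    have eq: "to_B e + s *\<^sub>R L_to_pentagon w = to_B (e + s *\<^sub>R w)"
      by (simp add: to_B_def linear_add[OF linear_L_to_pentagon] linear_scale[OF linear_L_to_pentagon])
    have "snd (to_B (e + s *\<^sub>R w)) < 0"
      using elim(2) unfolding eq[symmetric] by simp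
    then have "to_B (e + s *\<^sub>R w) \<in> to_B ` set_B"
      using region_D_neg elim(1) unfolding eq by blast
    then show ?case
      unfolding image_iff to_B_inj by simp
  qed
  then obtain \<epsilon> where "\<epsilon> > 0" "\<forall>s. 0 < s \<longrightarrow> s < \<epsilon> \<longrightarrow> e + s *\<^sub>R w \<in> set_B"
    unfolding eventually_at_right_0 by blast
  then show thesis
    using that[of "\<epsilon> / 2"] by simp
qed

text \<open>The linear form that defines each side is strictly monotone along \<open>v\<close>; for
  side 2 this needs \<open>snd v > 0\<close>. Motion along \<open>v\<close> enters
  \<open>set_A\<close> across sides 0, 1, 2 and leaves it across sides 3, 4, and any other choice of
  \<open>p\<close> or \<open>q\<close> would put a germ outside the region.\<close>

lemma crossing_direction:
  assumes v: "fst v > 0" "snd v \<ge> 0" and k: "k < 5" "e \<in> edge k" "k = 2 \<Longrightarrow> snd v > 0"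
    and p: "p = to_A e \<or> p = to_B (e + offset k)" and q: "q = to_A e \<or> q = to_B (e + offset k)"
    and inc: "\<forall>\<^sub>F s in at_right 0. p - s *\<^sub>R L_to_pentagon v \<in> region double_pentagon"
    and out: "\<forall>\<^sub>F s in at_right 0. q + s *\<^sub>R L_to_pentagon v \<in> region double_pentagon"
  shows "if k < 3 then p = to_B (e + offset k) \<and> q = to_A e else p = to_A e \<and> q = to_B (e + offset k)"
proof -
  obtain x y where e: "e = (x, y)" by fastforce
  obtain a b where ab: "v = (a, b)" "a > 0" "b \<ge> 0" using v by (cases v) auto
  have neg: "p - s *\<^sub>R L_to_pentagon v = p + s *\<^sub>R L_to_pentagon (- v)" for s
    by (simp add: linear_neg[OF linear_L_to_pentagon])
  have eA: "e \<in> set_A" and eB: "e + offset k \<in> set_B"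
    using edge_subset_A edge_offset_in_B k by blast+
  have inA: "\<exists>s>0. e + s *\<^sub>R (- v) \<in> set_A" if "p = to_A e"
    using to_A_germ[OF eA inc[unfolded neg, unfolded that]] by metis
  have outA: "\<exists>s>0. e + s *\<^sub>R v \<in> set_A" if "q = to_A e"
    using to_A_germ[OF eA out[unfolded that]] by metis
  have inB: "\<exists>s>0. e + offset k + s *\<^sub>R (- v) \<in> set_B" if "p = to_B (e + offset k)"
    using to_B_germ[OF eB inc[unfolded neg, unfolded that]] by metis
  have outB: "\<exists>s>0. e + offset k + s *\<^sub>R v \<in> set_B" if "q = to_B (e + offset k)"
    using to_B_germ[OF eB out[unfolded that]] by metis
  have pos: "s * a > 0" "s * b \<ge> 0" "phi * (s * a) > 0" "phi * (s * b) \<ge> 0" if "s > 0" for s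
    using ab that phi_gt_1 by simp_all
  have pos': "s * b > 0" if "s > 0" "b > 0" for s
    using that by simp
  have low: "p \<noteq> to_A e \<and> q \<noteq> to_B (e + offset k)" if "k < 3"
  proof -
    have "k = 0 \<or> k = 1 \<or> k = 2" using that by auto
    then have "\<not> (\<exists>s>0. e + s *\<^sub>R (- v) \<in> set_A) \<and> \<not> (\<exists>s>0. e + offset k + s *\<^sub>R v \<in> set_B)"
    proof (elim disjE)
      assume "k = 0"
      then show ?thesis
        using k(2) pos unfolding e ab(1) by (auto simp: edge_simps offset_simps mem_set_A mem_set_B not_le)
    next
      assume "k = 1"
      then have "x + y = 1"
        using k(2) unfolding e by (simp add: edge_simps)
      moreover have "\<not> 1 \<le> x - s * a + (y - s * b)" "\<not> x + s * a + (y + s * b) \<le> 1" if "s > 0" for s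
        using pos[OF that] \<open>x + y = 1\<close> by auto
      ultimately show ?thesis
        unfolding e ab(1) \<open>k = 1\<close> by (auto simp: offset_simps mem_set_A mem_set_B)
    next
      assume "k = 2"
      then show ?thesis
        using k(2) k(3) pos' unfolding e ab(1) by (auto simp: edge_simps offset_simps mem_set_A mem_set_B not_le)
    qed
    then show ?thesis
      using inA outB by blast
  qed
  have high: "p \<noteq> to_B (e + offset k) \<and> q \<noteq> to_A e" if "\<not> k < 3"
  proof -
    have "k = 3 \<or> k = 4" using that k(1) by auto
    then have "\<not> (\<exists>s>0. e + s *\<^sub>R v \<in> set_A) \<and> \<not> (\<exists>s>0. e + offset k + s *\<^sub>R (- v) \<in> set_B)"
    proof (elim disjE)
      assume "k = 3"
      then have xy: "phi * x + y = phi + 1"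
        using k(2) unfolding e by (simp add: edge_simps)
      have "\<not> phi * (x + s * a) + (y + s * b) \<le> phi + 1" "\<not> 0 \<le> phi * (x - phi - s * a) + (y - s * b)" if "s > 0" for s
        using pos[OF that] xy by (simp_all add: distrib_left right_diff_distrib phi_sq)
      then show ?thesis
        unfolding e ab(1) \<open>k = 3\<close> by (auto simp: offset_simps mem_set_A mem_set_B)
    next
      assume "k = 4"
      then have xy: "x + phi * y = phi + 1"
        using k(2) unfolding e by (simp add: edge_simps)
      have "\<not> x + s * a + phi * (y + s * b) \<le> phi + 1" "\<not> 0 \<le> x - s * a + phi * (y - phi - s * b)" if "s > 0" for s
        using pos[OF that] xy by (simp_all add: distrib_left right_diff_distrib phi_sq)
      then show ?thesis
        unfolding e ab(1) \<open>k = 4\<close> by (auto simp: offset_simps mem_set_A mem_set_B)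
    qed
    then show ?thesis
      using inB outA by blast
  qed
  show ?thesis
    using low high p q by auto
qed

text \<open>A relation between 1 and \<open>phi\<close> gives \<open>m * m = m * n + n * n\<close>
  after a change of sign of \<open>n\<close>. Parity forces both integers to be even, and halving
  them is an infinite descent.\<close>

lemma phi_irrational:
  fixes m n :: int
  assumes "of_int m + of_int n * phi = 0"
  shows "m = 0 \<and> n = 0"
proof -
  have "m = 0 \<and> n = 0" if "m * m = m * n + n * n" for m n :: int
    using that
  proof (induction "nat \<bar>n\<bar>" arbitrary: m n rule: less_induct)
    case less
    have "even m \<and> even n"
      using less.prems by (metis even_add even_mult_iff)
    then obtain m' n' where mn: "m = 2 * m'" "n = 2 * n'"
      by (auto elim!: evenE)
    show ?case
    proof (cases "n = 0")
      case True
      then show ?thesis using less.prems by simp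
    next
      case False
      have "m' * m' = m' * n' + n' * n'"
        using less.prems unfolding mn by simp
      then have "m' = 0 \<and> n' = 0"
        using False by (intro less.hyps) (auto simp: mn)
      then show ?thesis using mn by simp
    qed
  qed
  note int = this
  have "of_int m = - of_int n * phi"
    using assms by simp
  then have "of_int m * of_int m = of_int n * of_int n * (phi * phi)"
    by simp
  also have "\<dots> = - of_int n * (- of_int n * phi) + of_int n * of_int n"
    unfolding phi_sq by (simp add: algebra_simps)
  also have "- of_int n * phi = of_int m"
    using assms by simp
  finally have "real_of_int (m * m) = real_of_int (- n * m + n * n)"
    by simp
  then have "m * m = - n * m + n * n"
    by (simp only: of_int_eq_iff)
  then have "m * m = m * (- n) + (- n) * (- n)"
    by simp
  from int[OF this] show ?thesis by simp
qed

lemma phi_coefficients: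
  fixes a b c d :: int
  assumes "of_int a + of_int b * phi = of_int c + of_int d * phi"
  shows "a = c" "b = d"
  using phi_irrational[of "a - c" "b - d"] assms by (auto simp: algebra_simps)

text \<open>The sign of the height tells which pentagon contains \<open>z\<close>, and the matching
  shift is undone. The extra component records the pentagon, so that its jumps balance the passages
  from Q to -Q against those back.\<close>

definition chart :: "plane \<Rightarrow> plane \<times> real" where
  "chart z = (if snd z > 0 then (pentagon_to_L (z - shift_A), 1) else (pentagon_to_L (z - shift_B), 0))"

lemma chart_simps: "p \<in> set_A \<Longrightarrow> chart (to_A p) = (p, 1)" "p \<in> set_B \<Longrightarrow> chart (to_B p) = (p, 0)"
  using to_A_pos[of p] to_B_neg[of p] unfolding chart_def
  by (auto simp: to_A_def to_B_def pentagon_to_L_inverse)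

text \<open>A segment inside the region never has height 0, so by the intermediate value theorem it
  stays in one pentagon, where the chart is affine.\<close>

lemma chart_translate:
  assumes "0 < s" and reg: "\<And>r. 0 \<le> r \<Longrightarrow> r \<le> s \<Longrightarrow> z + r *\<^sub>R L_to_pentagon v \<in> region double_pentagon"
  shows "chart (z + s *\<^sub>R L_to_pentagon v) = chart z + s *\<^sub>R (v, 0)"
proof -
  define h where "h r = snd z + r * snd (L_to_pentagon v)" for r
  have nz: "h r \<noteq> 0" if "0 \<le> r" "r \<le> s" for r
    using region_D_nonzero[OF reg[OF that]] by (simp add: h_def)
  have "(0 < h s) = (0 < h 0)"
  proof (rule ccontr)
    assume "(0 < h s) \<noteq> (0 < h 0)"
    moreover have "continuous_on {0..s} h"
      unfolding h_def by (intro continuous_intros)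
    ultimately have "\<exists>r. 0 \<le> r \<and> r \<le> s \<and> h r = 0"
      using IVT'[of h 0 0 s] IVT2'[of h s 0 0] assms(1) by fastforce
    then show False using nz by blast
  qed
  then have sign: "0 < snd (z + s *\<^sub>R L_to_pentagon v) \<longleftrightarrow> 0 < snd z"
    by (simp add: h_def)
  have "pentagon_to_L (z + s *\<^sub>R L_to_pentagon v - \<tau>) = pentagon_to_L (z - \<tau>) + s *\<^sub>R v" for \<tau>
  proof -
    have "pentagon_to_L ((z - \<tau>) + s *\<^sub>R L_to_pentagon v) = pentagon_to_L (z - \<tau>) + s *\<^sub>R v"
      by (simp add: linear_add[OF linear_pentagon_to_L] linear_scale[OF linear_pentagon_to_L] pentagon_to_L_inverse)
    then show ?thesis by (simp add: algebra_simps)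
  qed
  then show ?thesis
    unfolding chart_def sign by simp
qed

text \<open>Stated for an arbitrary period \<open>T\<close>, so that it serves short and long
  trajectories with different coefficients. The hypothesis \<open>horizontal\<close> concerns the
  only side that can be parallel to \<open>v\<close>.\<close>

lemma combinatorial_period_D:
  fixes a b c d :: nat
  assumes \<gamma>: "trajectory double_pentagon (L_to_pentagon v) \<gamma>" and T: "T \<in> periods \<gamma>" "primitive_period \<gamma> = T"
    and v: "fst v > 0" "snd v \<ge> 0" and Tv: "T *\<^sub>R v = (real a + real b * phi, real c + real d * phi)"
    and horizontal: "\<And>t. snd v = 0 \<Longrightarrow> \<gamma> t \<notin> pt_D ` to_A ` edge 2"
  shows "combinatorial_period double_pentagon \<gamma> = 2 * (a + b + c + d)"
proof -
  let ?D = double_pentagon and ?u = "L_to_pentagon v"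
  have fin: "finite (pairings ?D)"
    by (simp add: pairings_D)
  \<comment> \<open>With \<open>fst v > 0\<close> and \<open>snd v \<ge> 0\<close>, a side parallel
    to \<open>v\<close> must be the bottom side of Q, and then \<open>v\<close> is
    horizontal.\<close>
  have par: "\<gamma> t \<notin> pt ?D ` closed_segment a b" if ab: "(a, b, w) \<in> pairings ?D" "\<exists>c. ?u = c *\<^sub>R (b - a)" for a b w t
  proof -
    obtain k where k: "k < 5" "a = to_A (corner k)" "b = to_A (corner (Suc k))"
      using ab(1) unfolding pairings_D by auto
    obtain c where "?u = c *\<^sub>R (b - a)"
      using ab(2) by blast
    then have "?u = L_to_pentagon (c *\<^sub>R (corner (Suc k) - corner k))"
      by (simp add: k to_A_def linear_diff[OF linear_L_to_pentagon] linear_scale[OF linear_L_to_pentagon])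
    then have vc: "v = c *\<^sub>R (corner (Suc k) - corner k)"
      by (metis pentagon_to_L_inverse(1))
    have "k = 2"
    proof (rule ccontr)
      assume "k \<noteq> 2"
      with k(1) show False
        using v phi_gt_1 unfolding vc
        by (cases rule: less_5_cases) (auto simp: corner_def zero_less_mult_iff zero_le_mult_iff)
    qed
    then have "snd v = 0"
      unfolding vc by (simp add: corner_def)
    then show ?thesis
      using horizontal[of t] \<open>k = 2\<close> unfolding k(2,3) to_A_segment edge_segment[OF k(1), symmetric] by simp
  qed
  obtain p q where all: "\<forall>t. pt ?D (p t) = \<gamma> t \<and> pt ?D (q t) = \<gamma> t \<and> p t \<in> region ?D \<and> q t \<in> region ?D \<and>
      (\<forall>\<^sub>F s in at_right 0. p t - s *\<^sub>R ?u \<in> region ?D) \<and> (\<forall>\<^sub>F s in at_right 0. q t + s *\<^sub>R ?u \<in> region ?D)"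
    and finK: "finite {t \<in> {0..<T}. \<gamma> t \<in> side_points ?D}"
    and sum0: "T *\<^sub>R (v, 0) = (\<Sum>t | t \<in> {0..<T} \<and> \<gamma> t \<in> side_points ?D. chart (p t) - chart (q t))"
    by (rule crossing_sum[OF \<gamma> T(1) fin par chart_translate])
  let ?K = "{t. t \<in> {0..<T} \<and> \<gamma> t \<in> side_points ?D}"
  \<comment> \<open>Sides 0, 1, 2 are crossed from -Q to Q and sides 3, 4 from Q to -Q, which fixes
    the signs.\<close>
  define jump where "jump k = (if k < 3 then (offset k, - 1) else (- offset k, 1 :: real))" for k
  have ex: "\<exists>k<5. chart (p t) - chart (q t) = jump k" if t: "t \<in> ?K" for t
  proof -
    obtain a b w z where z: "(a, b, w) \<in> pairings ?D" "z \<in> closed_segment a b" "\<gamma> t = pt ?D z"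
      using t unfolding side_points_def by auto
    obtain k e where k: "k < 5" "e \<in> edge k" "z = to_A e"
      using side_D_cases[OF z(1,2)] by metis
    have \<gamma>t: "\<gamma> t = pt ?D (to_A e)"
      using z(3) k(3) by simp
    have nv: "pt ?D (to_A e) \<noteq> pt ?D (to_A (1, 0))"
      using trajectory_not_vertex[OF \<gamma>, of t] unfolding vertex_points_D \<gamma>t by blast
    have vert: "snd v > 0" if "k = 2"
      using horizontal[of t] v(2) k that unfolding \<gamma>t by fastforce
    have pq: "p t = to_A e \<or> p t = to_B (e + offset k)" "q t = to_A e \<or> q t = to_B (e + offset k)"
      by (rule pt_D_edge[OF k(1,2) nv]; use all \<gamma>t in metis)+
    have "\<forall>\<^sub>F s in at_right 0. p t - s *\<^sub>R ?u \<in> region ?D" "\<forall>\<^sub>F s in at_right 0. q t + s *\<^sub>R ?u \<in> region ?D"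
      using all by blast+
    from crossing_direction[OF v k(1,2) vert pq this]
    have dir: "if k < 3 then p t = to_B (e + offset k) \<and> q t = to_A e else p t = to_A e \<and> q t = to_B (e + offset k)" .
    have "e \<in> set_A" "e + offset k \<in> set_B"
      using edge_subset_A edge_offset_in_B k by blast+
    then have "chart (p t) - chart (q t) = jump k"
      using dir by (auto simp: chart_simps jump_def split: if_splits)
    with k(1) show ?thesis by blast
  qed
  define \<kappa> where "\<kappa> t = (SOME k. k < 5 \<and> chart (p t) - chart (q t) = jump k)" for t
  have \<kappa>: "\<kappa> t < 5 \<and> chart (p t) - chart (q t) = jump (\<kappa> t)" if "t \<in> ?K" for t
    unfolding \<kappa>_def using ex[OF that] by (rule someI_ex)
  define n where "n k = card {t \<in> ?K. \<kappa> t = k}" for k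
  have count: "(\<Sum>t\<in>?K. f (\<kappa> t)) = real (n 0) * f 0 + real (n 1) * f 1 + real (n 2) * f 2 + real (n 3) * f 3 + real (n 4) * f 4"
    for f :: "nat \<Rightarrow> real"
  proof -
    have "(\<Sum>t\<in>?K. f (\<kappa> t)) = (\<Sum>k\<in>{..<5}. of_nat (card {t \<in> ?K. \<kappa> t = k}) * f k)"
      by (rule sum_fun_comp) (use finK \<kappa> in auto)
    then show ?thesis
      by (simp add: n_def eval_nat_numeral)
  qed
  have sum: "T *\<^sub>R (v, 0) = (\<Sum>t\<in>?K. jump (\<kappa> t))"
    unfolding sum0 by (rule sum.cong) (use \<kappa> in auto)
  have "real a + real b * phi = fst (fst (T *\<^sub>R (v, 0 :: real)))"
    using Tv by simp
  also have "\<dots> = (\<Sum>t\<in>?K. fst (fst (jump (\<kappa> t))))"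
    unfolding sum by (simp add: fst_sum snd_sum)
  also note count[of "\<lambda>k. fst (fst (jump (k)))"]
  finally have 1: "real a + real b * phi = real (n 0) + (real (n 3) - real (n 2)) * phi"
    by (simp add: jump_def offset_simps algebra_simps)
  have "real c + real d * phi = snd (fst (T *\<^sub>R (v, 0 :: real)))"
    using Tv by simp
  also have "\<dots> = (\<Sum>t\<in>?K. snd (fst (jump (\<kappa> t))))"
    unfolding sum by (simp add: fst_sum snd_sum)
  also note count[of "\<lambda>k. snd (fst (jump (k)))"]
  finally have 2: "real c + real d * phi = real (n 2) + (real (n 4) - real (n 0)) * phi"
    by (simp add: jump_def offset_simps algebra_simps)
  have "(0::real) = snd (T *\<^sub>R (v, 0 :: real))"
    using Tv by simp
  also have "\<dots> = (\<Sum>t\<in>?K. snd (jump (\<kappa> t)))"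
    unfolding sum by (simp add: fst_sum snd_sum)
  also note count[of "\<lambda>k. snd (jump (k))"]
  finally have 3: "real (n 0) + real (n 1) + real (n 2) = real (n 3) + real (n 4)"
    by (simp add: jump_def)
  have card: "real (card ?K) = real (n 0) + real (n 1) + real (n 2) + real (n 3) + real (n 4)"
    using count[of "\<lambda>_. 1"] by simp
  \<comment> \<open>Coefficients of 1 and \<open>phi\<close> are compared. They are taken as
    integers, since \<open>n 3 - n 2\<close> and \<open>n 4 - n 0\<close> are differences.\<close>
  have "int a = int (n 0)" "int b = int (n 3) - int (n 2)" "int c = int (n 2)" "int d = int (n 4) - int (n 0)"
    using phi_coefficients[of "int a" "int b" "int (n 0)" "int (n 3) - int (n 2)"]
      phi_coefficients[of "int c" "int d" "int (n 2)" "int (n 4) - int (n 0)"] 1 2 by simp_all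
  then have "a = n 0" "n 3 = b + n 2" "c = n 2" "n 4 = d + n 0"
    by linarith+
  moreover have "card ?K = n 0 + n 1 + n 2 + n 3 + n 4" "n 0 + n 1 + n 2 = n 3 + n 4"
    using card 3 by (simp_all only: of_nat_add[symmetric] of_nat_eq_iff)
  ultimately have "card ?K = 2 * (a + b + c + d)"
    by simp
  then show ?thesis
    unfolding combinatorial_period_def T(2) .
qed

theorem theorem3p16:
  fixes a b c d :: nat and v :: "real \<times> real"
  assumes "v = (real a + real b * phi, real c + real d * phi)"
    and "v \<in> Lambda_L"
  shows
    "(\<exists>\<gamma>. short_trajectory golden_L v \<gamma>) \<and>
     (\<exists>\<gamma>. long_trajectory golden_L v \<gamma>) \<and>
     (\<forall>\<gamma>. short_trajectory golden_L v \<gamma> \<longrightarrow> holonomy v \<gamma> = v) \<and>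
     (\<forall>\<gamma>. long_trajectory golden_L v \<gamma> \<longrightarrow> holonomy v \<gamma> = phi *\<^sub>R v) \<and>
     (\<exists>\<gamma>. short_trajectory double_pentagon (L_to_pentagon v) \<gamma>) \<and>
     (\<exists>\<gamma>. long_trajectory double_pentagon (L_to_pentagon v) \<gamma>) \<and>
     (\<forall>\<gamma>. short_trajectory double_pentagon (L_to_pentagon v) \<gamma> \<longrightarrow>
        combinatorial_period double_pentagon \<gamma> = 2 * (a + b + c + d)) \<and>
     (\<forall>\<gamma>. long_trajectory double_pentagon (L_to_pentagon v) \<gamma> \<longrightarrow>
        combinatorial_period double_pentagon \<gamma> = 2 * (a + 2 * b + c + 2 * d))"
proof -
  interpret P: affine_equivalence golden_L double_pentagon L_to_pentagon pentagon_to_L pentagon_pieces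
    by (rule pentagon_L)
  have L: "two_cylinders golden_L v 1"
    by (rule Lambda_two_cylinders[OF assms(2)])
  have D: "two_cylinders double_pentagon (L_to_pentagon v) 1"
    by (rule P.two_cylinders_F[OF L])
  have v: "fst v > 0" "snd v \<ge> 0"
    using assms(2) unfolding Lambda_L_def by blast+
  \<comment> \<open>Pulled back to the golden L, side 2 lies on \<open>y = 0\<close>, on which no
    horizontal trajectory can be.\<close>
  have horizontal: "\<gamma> t \<notin> pt_D ` to_A ` edge 2"
    if \<gamma>: "trajectory double_pentagon (L_to_pentagon v) \<gamma>" and "snd v = 0" for \<gamma> t
  proof
    assume "\<gamma> t \<in> pt_D ` to_A ` edge 2"
    then obtain e where e: "e \<in> edge 2" "\<gamma> t = pt_D (to_A e)"
      by blast
    have "e \<in> set_A"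
      using edge_subset_A[of 2] e(1) by auto
    moreover have "(set_A, shift_A) \<in> pentagon_pieces"
      by (simp add: pentagon_pieces_def)
    ultimately have "(P.G \<circ> \<gamma>) t = pt_L e" "e \<in> region golden_L"
      using P.G_pt P.region e(2) unfolding to_A_def by auto
    moreover have "snd e \<in> {0, 1, phi}"
      using e(1) by (cases e) (simp add: edge_simps)
    moreover have "trajectory golden_L (fst v, 0) (P.G \<circ> \<gamma>)"
      using P.trajectory_G[OF \<gamma>] \<open>snd v = 0\<close> by (metis prod.collapse)
    ultimately show False
      using horizontal_levels by blast
  qed
  have short: "combinatorial_period double_pentagon \<gamma> = 2 * (a + b + c + d)"
    if \<gamma>: "short_trajectory double_pentagon (L_to_pentagon v) \<gamma>" for \<gamma>
  proof -
    have traj: "trajectory double_pentagon (L_to_pentagon v) \<gamma>"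
      using \<gamma> unfolding short_trajectory_def periodic_trajectory_def by blast
    have "1 \<in> periods \<gamma>" "primitive_period \<gamma> = 1"
      using two_cylindersD(3)[OF D \<gamma>] by auto
    from traj this v _ horizontal[OF traj] show ?thesis
      by (rule combinatorial_period_D) (simp add: assms(1))
  qed
  have long: "combinatorial_period double_pentagon \<gamma> = 2 * (a + 2 * b + c + 2 * d)"
    if \<gamma>: "long_trajectory double_pentagon (L_to_pentagon v) \<gamma>" for \<gamma>
  proof -
    have traj: "trajectory double_pentagon (L_to_pentagon v) \<gamma>"
      using \<gamma> unfolding long_trajectory_def periodic_trajectory_def by blast
    have "phi \<in> periods \<gamma>" "primitive_period \<gamma> = phi"
      using two_cylindersD(4)[OF D \<gamma>] by auto
    \<comment> \<open>From \<open>phi * phi = phi + 1\<close>, multiplication by \<open>phi\<close>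
      sends the coefficients \<open>a\<close>, \<open>b\<close> to \<open>b\<close>,
      \<open>a + b\<close>, whose sum is \<open>a + 2 * b\<close>.\<close>
    moreover have "phi *\<^sub>R v = (real b + real (a + b) * phi, real d + real (c + d) * phi)"
      by (simp add: assms(1) algebra_simps phi_sq phi_phi)
    ultimately have "combinatorial_period double_pentagon \<gamma> = 2 * (b + (a + b) + d + (c + d))"
      using traj v horizontal[OF traj] by (intro combinatorial_period_D) auto
    then show ?thesis by simp
  qed
  have "holonomy v \<gamma> = v" if "short_trajectory golden_L v \<gamma>" for \<gamma>
    using two_cylindersD(3)[OF L that] by (simp add: holonomy_def)
  moreover have "holonomy v \<gamma> = phi *\<^sub>R v" if "long_trajectory golden_L v \<gamma>" for \<gamma>
    using two_cylindersD(4)[OF L that] by (simp add: holonomy_def)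
  ultimately show ?thesis
    using two_cylindersD(1,2)[OF L] two_cylindersD(1,2)[OF D] short long by blast
qed

end
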